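(* Let $X$ be a compact symmetric space with compact symmetry group $G$, let $r>0$ and $1<p_0<\infty$, and let $T$ be a translation invariant linear operator which is bounded on $L^{p_0}(X)$. Then the following are equivalent: (i) $T$ is bounded on $L^p(X)$ for every $1<p<p_0$, with operator norm $O(1/(p-1)^r)$, i.e. there is a constant $C$ independent of $p$ with $\|T\|_{L^p(X)\to L^p(X)}\le C(p-1)^{-r}$ for all $1<p<p_0$; (ii) one has $$\int_X |T\chi_E| \lesssim |E|\,\log(1/|E|)^r$$ for all measurable subsets $E$ of $X$ with $0<|E|\ll 1$; i.e. there are constants $c\in(0,1)$ and $C'>0$ such that $\int_X|T\chi_E|\le C'|E|\log(1/|E|)^r$ for every measurable $E\subset X$ with $0<|E|\le c$.
   Context: $X$ is equipped with its finite $G$-invariant measure, denoted $|\cdot|$; $G$ acts transitively on $X$ by measure-preserving transformations. An operator $T$ is translation invariant if it commutes with the action of $G$: $T(f\circ\Omega)=(Tf)\circ\Omega$ for all $\Omega\in G$. $\chi_E$ is the characteristic function of $E$. Since $T$ is given on $L^{p_0}(X)$, which is dense in $L^p(X)$ for $1<p<p_0$, boundedness of $T$ on $L^p$ means that $\|Tf\|_p\le C\|f\|_p$ for all $f\in L^{p_0}(X)$, so that $T$ extends uniquely to a bounded operator on $L^p(X)$. *)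

theory Defs
  imports "HOL-Analysis.Analysis"
begin

text \<open>
  Smoothness on an open subset of a Euclidean space: all iterated directional derivatives exist
  and are continuous.
\<close>

primrec Ck_on :: "nat \<Rightarrow> ('a::euclidean_space \<Rightarrow> 'b::euclidean_space) \<Rightarrow> 'a set \<Rightarrow> bool" where
  "Ck_on 0 f U \<longleftrightarrow> continuous_on U f"
| "Ck_on (Suc k) f U \<longleftrightarrow>
     f differentiable_on U \<and> (\<forall>v. Ck_on k (\<lambda>x. frechet_derivative f (at x) v) U)"

definition smooth_on :: "('a::euclidean_space \<Rightarrow> 'b::euclidean_space) \<Rightarrow> 'a set \<Rightarrow> bool" where
  "smooth_on f U \<longleftrightarrow> (\<forall>k. Ck_on k f U)"

text \<open>
  A chart is a pair of its domain and its coordinate map, whose values off the domain are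
  irrelevant. An atlas is not required to be maximal.
\<close>

type_synonym ('x, 'e) chart = "'x set \<times> ('x \<Rightarrow> 'e)"

definition coord_dom :: "('x, 'e) chart \<Rightarrow> ('x, 'e) chart \<Rightarrow> ('x \<Rightarrow> 'x) \<Rightarrow> 'e set" where
  "coord_dom c d F = snd c ` (fst c \<inter> F -` fst d)"

definition coord_rep :: "('x, 'e) chart \<Rightarrow> ('x, 'e) chart \<Rightarrow> ('x \<Rightarrow> 'x) \<Rightarrow> 'e \<Rightarrow> 'e" where
  "coord_rep c d F = snd d \<circ> F \<circ> inv_into (fst c) (snd c)"

definition smooth_map ::
  "('x::topological_space, 'e::euclidean_space) chart set \<Rightarrow> ('x \<Rightarrow> 'x) \<Rightarrow> bool" where
  "smooth_map A F \<longleftrightarrow> continuous_on UNIV F \<and>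
     (\<forall>c\<in>A. \<forall>d\<in>A. smooth_on (coord_rep c d F) (coord_dom c d F))"

text \<open>Smoothness of the identity says that the transition maps are smooth.\<close>

definition smooth_atlas ::
  "('x::topological_space, 'e::euclidean_space) chart set \<Rightarrow> bool" where
  "smooth_atlas A \<longleftrightarrow> (\<Union>c\<in>A. fst c) = UNIV \<and>
     (\<forall>(U, \<phi>)\<in>A. open U \<and> open (\<phi> ` U) \<and> homeomorphism U (\<phi> ` U) \<phi> (inv_into U \<phi>)) \<and>
     smooth_map A id"

text \<open>
  A Riemannian metric is given in coordinates: \<open>g c y\<close> is the inner product on the tangent space
  at the point with coordinates \<open>y\<close> in the chart \<open>c\<close>. That \<open>id\<close> preserves the metric is the
  transformation rule between charts.
\<close>

type_synonym ('x, 'e) metric_coeffs = "('x, 'e) chart \<Rightarrow> 'e \<Rightarrow> 'e \<Rightarrow> 'e \<Rightarrow> real"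

definition preserves_metric ::
  "('x, 'e::euclidean_space) chart set \<Rightarrow> ('x, 'e) metric_coeffs \<Rightarrow> ('x \<Rightarrow> 'x) \<Rightarrow> bool" where
  "preserves_metric A g F \<longleftrightarrow>
     (\<forall>c\<in>A. \<forall>d\<in>A. \<forall>y\<in>coord_dom c d F. \<forall>v w.
        let D = frechet_derivative (coord_rep c d F) (at y)
        in g d (coord_rep c d F y) (D v) (D w) = g c y v w)"

definition riemannian_metric ::
  "('x, 'e::euclidean_space) chart set \<Rightarrow> ('x, 'e) metric_coeffs \<Rightarrow> bool" where
  "riemannian_metric A g \<longleftrightarrow>
     (\<forall>c\<in>A. \<forall>y\<in>snd c ` fst c. bilinear (g c y) \<and>
        (\<forall>v w. g c y v w = g c y w v) \<and> (\<forall>v. v \<noteq> 0 \<longrightarrow> 0 < g c y v v)) \<and>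
     (\<forall>c\<in>A. \<forall>v w. smooth_on (\<lambda>y. g c y v w) (snd c ` fst c)) \<and>
     preserves_metric A g id"

definition riemannian_isometry ::
  "('x::topological_space, 'e::euclidean_space) chart set \<Rightarrow> ('x, 'e) metric_coeffs \<Rightarrow> ('x \<Rightarrow> 'x) \<Rightarrow> bool" where
  "riemannian_isometry A g F \<longleftrightarrow>
     bij F \<and> smooth_map A F \<and> smooth_map A (inv F) \<and> preserves_metric A g F"

text \<open>
  Cartan's definition of a (globally) symmetric space: a connected Riemannian manifold each point
  of which is an isolated fixed point of an involutive isometry.
\<close>

definition compact_symmetric_space ::
  "('x::{t2_space, second_countable_topology}, 'e::euclidean_space) chart set
     \<Rightarrow> ('x, 'e) metric_coeffs \<Rightarrow> bool" where
  "compact_symmetric_space A g \<longleftrightarrow>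
     compact (UNIV :: 'x set) \<and> connected (UNIV :: 'x set) \<and>
     smooth_atlas A \<and> riemannian_metric A g \<and>
     (\<forall>p. \<exists>s. riemannian_isometry A g s \<and> s \<circ> s = id \<and> s p = p \<and>
        (\<exists>N. open N \<and> p \<in> N \<and> (\<forall>x\<in>N. s x = x \<longrightarrow> x = p)))"

text \<open>
  A compact group acting continuously and transitively by isometries. The library's class of
  topological groups that need not be commutative, \<open>topological_group_add\<close>, is written additively.
\<close>

definition compact_symmetry_group ::
  "('x::topological_space, 'e::euclidean_space) chart set \<Rightarrow> ('x, 'e) metric_coeffs
     \<Rightarrow> ('g::{topological_group_add, t2_space} \<Rightarrow> 'x \<Rightarrow> 'x) \<Rightarrow> bool" where
  "compact_symmetry_group A g act \<longleftrightarrow>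
     compact (UNIV :: 'g set) \<and>
     (\<forall>x. act 0 x = x) \<and> (\<forall>a b x. act (a + b) x = act a (act b x)) \<and>
     continuous_on UNIV (\<lambda>(a, x). act a x) \<and>
     (\<forall>x y. \<exists>a. act a x = y) \<and>
     (\<forall>a. riemannian_isometry A g (act a))"

definition invariant_measure ::
  "('g \<Rightarrow> 'x \<Rightarrow> 'x) \<Rightarrow> 'x::topological_space measure \<Rightarrow> bool" where
  "invariant_measure act M \<longleftrightarrow>
     sets M = sets borel \<and> finite_measure M \<and> emeasure M UNIV \<noteq> 0 \<and>
     (\<forall>a. \<forall>E\<in>sets M. emeasure M (act a -` E) = emeasure M E)"

text \<open>
  Complex Lebesgue spaces, for \<open>0 < p < \<infinity>\<close>. Elements are functions rather than classes, so
  identities between them are stated almost everywhere.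
\<close>

definition Lp :: "'x measure \<Rightarrow> real \<Rightarrow> ('x \<Rightarrow> complex) set" where
  "Lp M p = {f \<in> borel_measurable M. integrable M (\<lambda>x. cmod (f x) powr p)}"

definition Lp_norm :: "'x measure \<Rightarrow> real \<Rightarrow> ('x \<Rightarrow> complex) \<Rightarrow> real" where
  "Lp_norm M p f = (LINT x|M. cmod (f x) powr p) powr (1 / p)"

definition linear_operator_on_Lp ::
  "'x measure \<Rightarrow> real \<Rightarrow> (('x \<Rightarrow> complex) \<Rightarrow> 'x \<Rightarrow> complex) \<Rightarrow> bool" where
  "linear_operator_on_Lp M p T \<longleftrightarrow>
     (\<forall>f\<in>Lp M p. T f \<in> Lp M p) \<and>
     (\<forall>f\<in>Lp M p. \<forall>g\<in>Lp M p. (AE x in M. f x = g x) \<longrightarrow> (AE x in M. T f x = T g x)) \<and>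
     (\<forall>f\<in>Lp M p. \<forall>g\<in>Lp M p. AE x in M. T (\<lambda>x. f x + g x) x = T f x + T g x) \<and>
     (\<forall>f\<in>Lp M p. \<forall>a. AE x in M. T (\<lambda>x. a * f x) x = a * T f x)"

definition translation_invariant ::
  "('g \<Rightarrow> 'x \<Rightarrow> 'x) \<Rightarrow> 'x measure \<Rightarrow> real \<Rightarrow> (('x \<Rightarrow> complex) \<Rightarrow> 'x \<Rightarrow> complex) \<Rightarrow> bool" where
  "translation_invariant act M p T \<longleftrightarrow>
     (\<forall>a. \<forall>f\<in>Lp M p. AE x in M. T (f \<circ> act a) x = (T f \<circ> act a) x)"

text \<open>
  For an operator \<open>T\<close> given on the dense subspace \<open>Lp M p0\<close> of \<open>Lp M p\<close>, where \<open>p \<le> p0\<close>: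
  \<open>T\<close> is bounded on \<open>Lp M p\<close> with operator norm at most \<open>K\<close>.
\<close>

definition Lp_bounded ::
  "'x measure \<Rightarrow> real \<Rightarrow> real \<Rightarrow> (('x \<Rightarrow> complex) \<Rightarrow> 'x \<Rightarrow> complex) \<Rightarrow> real \<Rightarrow> bool" where
  "Lp_bounded M p0 p T K \<longleftrightarrow> (\<forall>f\<in>Lp M p0. Lp_norm M p (T f) \<le> K * Lp_norm M p f)"

end

theory Submission
  imports Defs
begin

text \<open>
  Write \<open>\<Phi> s = s (1 + ln (1 + s)) ^ r\<close>; this is \<open>LlogL r s\<close>.

  From norms to sets, one applies the norm bound to the indicator of \<open>E\<close> with
  \<open>p = 1 + 1 / ln (1 / |E|)\<close>: then \<open>(p - 1) ^ (- r) = ln (1 / |E|) ^ r\<close>, and \<open>|E| ^ (1 / p)\<close> exceeds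
  \<open>|E|\<close> by at most the factor \<open>exp 1\<close>.

  The converse rests on translation invariance. Slicing a bounded function into indicators of its
  superlevel sets turns the bound on sets into \<open>\<integral>|T F| \<le> B (1 + \<integral>\<Phi> |F|)\<close>
  (\<open>L_log_L_bound\<close>). The additive constant makes this useless for small functions, and it is removed
  as follows (\<open>tail_bound\<close>). If \<open>N \<integral>\<Phi> |f| \<le> 1\<close>, take \<open>N\<close> independent random translates of \<open>f\<close>
  and add up a random subset of them. The result still has \<open>\<integral>\<Phi>\<close> bounded, because a sum of
  independent variables behaves for \<open>\<Phi>\<close> like a disjoint sum up to a product term
  (\<open>LlogL_sum_le\<close>). Since \<open>T\<close> commutes with translations, its image is the corresponding sum of
  translates of \<open>T f\<close>, and the mean over the subsets dominates half of the largest of the \<open>N\<close> summands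
  (\<open>norm_le_subset_sums\<close>). At a given point these summands are independent and distributed like
  \<open>T f\<close>, so the expected maximum is at least a constant times \<open>N\<close> times the integral of \<open>|T f|\<close> over
  \<open>{|T f| > R}\<close>, once \<open>R\<close> is so large that with probability \<open>1 / 2\<close> no summand exceeds \<open>R\<close>.
  Choosing \<open>N\<close> of size \<open>1 / \<integral>\<Phi> |f|\<close> gives
  \<open>\<integral>\<^bsub>|T f| > R\<^esub> |T f| \<le> B \<integral>\<Phi> |f|\<close>, with no additive constant.

  The random translates are drawn from finite lists of group elements. For a continuous \<open>h\<close> on \<open>X\<close>,
  von Neumann's argument gives finite averages of translates of \<open>h\<close> uniformly close to the mean of \<open>h\<close>
  (\<open>average_close_to_mean_continuous\<close>). By density, finite averages come close to the mean in \<open>L\<^sup>1\<close>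
  for finitely many integrable functions simultaneously (\<open>averages_tendsto_means\<close>). Drawing translates
  from such lists, one obtains the expectations above as limits of finite sums.

  Finally, for \<open>p\<close> near 1 apply the tail bound to the part of \<open>f / \<lambda>\<close> where it exceeds 1, apply
  the \<open>p0\<close> bound to the rest, multiply by \<open>\<lambda> ^ (p - 1)\<close> and integrate over \<open>\<lambda>\<close>. The left-hand side
  becomes \<open>\<integral>|T f| ^ p\<close> times a quantity of order \<open>1 / (p - 1)\<close>, the right-hand side
  \<open>\<integral>|f| ^ p\<close> times one of order \<open>(p - 1) ^ (- r - 1)\<close>; the quotient is \<open>(p - 1) ^ (- r)\<close>, so no
  power of \<open>p - 1\<close> is lost (\<open>bounded_near_one\<close>). The same integration over levels, with the truncation
  function \<open>min (s ^ a) (s ^ p0)\<close> on both sides, gives bounds on the remaining exponents that are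
  uniform as \<open>p\<close> tends to \<open>p0\<close> (\<open>interpolate_upper_range\<close>).
\<close>

section \<open>Finite averages of translates of continuous functions\<close>

locale compact_group_action = finite_measure M
  for M :: "'x::{t2_space, second_countable_topology} measure" +
  fixes act :: "'g::{topological_group_add, t2_space} \<Rightarrow> 'x \<Rightarrow> 'x"
  assumes compact_group: "compact (UNIV :: 'g set)"
    and compact_points: "compact (UNIV :: 'x set)"
    and act_add: "act (a + b) x = act a (act b x)"
    and continuous_act: "continuous_on UNIV (\<lambda>(a, x). act a x)"
    and transitive: "\<exists>a. act a x = y"
    and sets_M: "sets M = sets borel"
    and M_nonzero: "emeasure M UNIV \<noteq> 0"
    and M_invariant: "E \<in> sets M \<Longrightarrow> emeasure M (act a -` E) = emeasure M E"
begin

lemma space_M [simp]: "space M = UNIV"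
  using sets_eq_imp_space_eq[OF sets_M] by simp

lemma measure_UNIV_pos: "measure M UNIV > 0"
  using M_nonzero by (simp add: emeasure_eq_measure zero_less_measure_iff)

lemma continuous_act_point: "continuous_on UNIV (act a)"
proof -
  have "continuous_on UNIV (\<lambda>x. (\<lambda>(a, x). act a x) (a, x))"
    by (rule continuous_on_compose2[OF continuous_act]) (auto intro!: continuous_intros)
  then show ?thesis by simp
qed

lemma measurable_act [measurable]: "act a \<in> M \<rightarrow>\<^sub>M M"
  using borel_measurable_continuous_onI[OF continuous_act_point]
  by (simp cong: measurable_cong_sets add: sets_M)

lemma distr_act: "distr M M (act a) = M"
  by (rule measure_eqI) (auto simp: emeasure_distr M_invariant)

lemma continuous_borel_measurable:
  "continuous_on UNIV h \<Longrightarrow> h \<in> borel_measurable M"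
  using borel_measurable_continuous_onI[of h] by (simp cong: measurable_cong_sets add: sets_M)

lemma integrable_act_iff:
  fixes h :: "'x \<Rightarrow> 'b::{banach, second_countable_topology}"
  assumes "h \<in> borel_measurable M"
  shows "integrable M (\<lambda>x. h (act a x)) \<longleftrightarrow> integrable M h"
  using integrable_distr_eq[of "act a" M M h] assms by (simp add: distr_act)

lemma integrable_act:
  fixes h :: "'x \<Rightarrow> 'b::{banach, second_countable_topology}"
  shows "integrable M h \<Longrightarrow> integrable M (\<lambda>x. h (act a x))"
  by (simp add: integrable_act_iff)

lemma integral_act:
  fixes h :: "'x \<Rightarrow> 'b::{banach, second_countable_topology}"
  assumes "h \<in> borel_measurable M"
  shows "(LINT x|M. h (act a x)) = (LINT x|M. h x)"
  using integral_distr[of "act a" M M h] assms by (simp add: distr_act)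

definition average :: "'g list \<Rightarrow> ('x \<Rightarrow> real) \<Rightarrow> 'x \<Rightarrow> real" where
  "average as h x = (\<Sum>a\<leftarrow>as. h (act a x)) / real (length as)"

definition mean :: "('x \<Rightarrow> real) \<Rightarrow> real" where
  "mean h = (LINT x|M. h x) / measure M UNIV"

lemma integrable_average: "integrable M h \<Longrightarrow> integrable M (average as h)"
proof -
  assume h: "integrable M h"
  have "integrable M (\<lambda>x. \<Sum>a\<leftarrow>as. h (act a x))"
    by (induction as) (auto intro!: integrable_act h)
  then show ?thesis by (simp add: average_def[abs_def])
qed

lemma integral_average:
  assumes "integrable M h" "as \<noteq> []"
  shows "(LINT x|M. average as h x) = (LINT x|M. h x)"
proof -
  have "integrable M (\<lambda>x. \<Sum>a\<leftarrow>as. h (act a x)) \<and>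
      (LINT x|M. (\<Sum>a\<leftarrow>as. h (act a x))) = length as * (LINT x|M. h x)"
    using assms(1) by (induction as) (auto simp: integrable_act integral_act algebra_simps)
  then show ?thesis using assms(2) by (simp add: average_def[abs_def])
qed

lemma mean_average: "integrable M h \<Longrightarrow> as \<noteq> [] \<Longrightarrow> mean (average as h) = mean h"
  by (simp add: mean_def integral_average)

lemma average_average:
  "average bs (average as h) = average (concat (map (\<lambda>b. map (\<lambda>a. a + b) as) bs)) h"
proof
  fix x
  define cs where "cs = concat (map (\<lambda>b. map (\<lambda>a. a + b) as) bs)"
  have len: "length cs = length bs * length as"
    unfolding cs_def by (induction bs) auto
  have "(\<Sum>b\<leftarrow>bs. (\<Sum>a\<leftarrow>as. h (act a (act b x)))) = (\<Sum>c\<leftarrow>cs. h (act c x))"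
    unfolding cs_def by (induction bs) (auto simp: o_def act_add)
  moreover have "average bs (average as h) x
      = (\<Sum>b\<leftarrow>bs. (\<Sum>a\<leftarrow>as. h (act a (act b x)))) / (real (length as) * real (length bs))"
  proof -
    have "(\<Sum>b\<leftarrow>bs. k b / c) = (\<Sum>b\<leftarrow>bs. k b) / c" for k and c :: real
      by (induction bs) (auto simp: add_divide_distrib)
    then show ?thesis by (simp add: average_def)
  qed
  ultimately show "average bs (average as h) x = average cs h x"
    by (simp add: average_def len)
qed

lemma average_mono: "(\<And>x. h x \<le> k x) \<Longrightarrow> average as h x \<le> average as k x"
  by (simp add: average_def divide_right_mono sum_list_mono)

lemma average_const: "as \<noteq> [] \<Longrightarrow> average as (\<lambda>x. c) x = c"
  by (simp add: average_def sum_list_triv)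

lemma average_diff: "average as (\<lambda>x. h x - k x) x = average as h x - average as k x"
  by (simp add: average_def sum_list_subtractf diff_divide_distrib)

lemma abs_average_le: "\<bar>average as h x\<bar> \<le> average as (\<lambda>x. \<bar>h x\<bar>) x"
  using sum_list_abs[of "map (\<lambda>a. h (act a x)) as"]
  by (simp add: average_def divide_right_mono o_def)

lemma L1_average_le:
  assumes "integrable M h" "as \<noteq> []"
  shows "(LINT x|M. \<bar>average as h x\<bar>) \<le> (LINT x|M. \<bar>h x\<bar>)"
proof -
  have "(LINT x|M. \<bar>average as h x\<bar>) \<le> (LINT x|M. average as (\<lambda>x. \<bar>h x\<bar>) x)"
    using assms by (intro integral_mono abs_average_le integrable_abs integrable_average)
  also have "\<dots> = (LINT x|M. \<bar>h x\<bar>)"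
    using assms by (intro integral_average) auto
  finally show ?thesis .
qed

text \<open>
  Compactness enters here. The translates of \<open>h\<close> by the whole group are equicontinuous, and finitely many
  group elements suffice to move any point close to any other. The estimate is uniform in the further
  translation \<open>a\<close>, so it passes to every average of translates of \<open>h\<close> with the same list \<open>bs\<close>.
\<close>
lemma finite_recurrent_translates:
  fixes h :: "'x \<Rightarrow> real"
  assumes h: "continuous_on UNIV h" and e: "e > 0"
  obtains bs where "bs \<noteq> []"
    "\<And>x y. \<exists>b\<in>set bs. \<forall>a. \<bar>h (act a (act b x)) - h (act a y)\<bar> \<le> e"
proof -
  have ch: "continuous_on UNIV (\<lambda>z :: 'x \<times> 'g. h (act (snd z) (fst z)))"
  proof -
    have "continuous_on UNIV (\<lambda>z :: 'x \<times> 'g. (\<lambda>(a, x). act a x) (snd z, fst z))"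
      by (rule continuous_on_compose2[OF continuous_act]) (auto intro!: continuous_intros)
    then show ?thesis
      by (intro continuous_on_compose2[OF h]) (auto simp: case_prod_beta)
  qed
  \<comment> \<open>Equicontinuity of all translates of \<open>h\<close>: the tube lemma over the compact group.\<close>
  have "\<exists>V. y \<in> V \<and> open V \<and> (\<forall>z\<in>V. \<forall>a. \<bar>h (act a z) - h (act a y)\<bar> < e / 2)" for y
  proof -
    define W where "W = {z :: 'x \<times> 'g. \<bar>h (act (snd z) (fst z)) - h (act (snd z) y)\<bar> < e / 2}"
    have "continuous_on UNIV (\<lambda>z :: 'x \<times> 'g. h (act (snd z) y))"
    proof -
      have "continuous_on UNIV (\<lambda>z :: 'x \<times> 'g. (\<lambda>z. h (act (snd z) (fst z))) (y, snd z))"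
        by (rule continuous_on_compose2[OF ch]) (auto intro!: continuous_intros)
      then show ?thesis by simp
    qed
    then have "open W"
      unfolding W_def by (intro open_Collect_less continuous_intros ch)
    moreover have "{y} \<times> UNIV \<subseteq> W" using e by (auto simp: W_def)
    ultimately obtain V where "y \<in> V" "open V" "V \<times> UNIV \<subseteq> W"
      using Elementary_Topology.tube_lemma[OF compact_group] by metis
    moreover from this have "\<bar>h (act a z) - h (act a y)\<bar> < e / 2" if "z \<in> V" for z a
      using that unfolding W_def by force
    ultimately show ?thesis by blast
  qed
  then obtain V where V: "\<And>y. y \<in> V y" "\<And>y. open (V y)"
    "\<And>y z a. z \<in> V y \<Longrightarrow> \<bar>h (act a z) - h (act a y)\<bar> < e / 2" by metis
  obtain Y where Y: "finite Y" "UNIV \<subseteq> (\<Union>y\<in>Y. V y)"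
  proof (rule compactE_image[OF compact_points, of UNIV V])
    show "UNIV \<subseteq> (\<Union>y. V y)" using V(1) by blast
  qed (use V(2) in auto)
  have "\<exists>B. finite B \<and> (\<forall>x. \<exists>b\<in>B. act b x \<in> V y)" for y
  proof -
    have "open (act b -` V y)" for b
      using open_vimage[OF V(2) continuous_act_point] .
    moreover have "UNIV \<subseteq> (\<Union>b. act b -` V y)"
    proof
      fix x
      obtain b where "act b x = y" using transitive[of x y] ..
      then show "x \<in> (\<Union>b. act b -` V y)" using V(1)[of y] by auto
    qed
    ultimately obtain B where "finite B" "UNIV \<subseteq> (\<Union>b\<in>B. act b -` V y)"
      by (rule compactE_image[OF compact_points])
    then show ?thesis by (intro exI[of _ B]) auto
  qed
  then have "\<exists>B. \<forall>y. finite (B y) \<and> (\<forall>x. \<exists>b\<in>B y. act b x \<in> V y)"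
    by (intro choice) simp
  then obtain B where B: "\<And>y. finite (B y)" "\<And>y x. \<exists>b\<in>B y. act b x \<in> V y" by blast
  obtain bs where bs: "set bs = (\<Union>y\<in>Y. B y)"
    using finite_list[of "\<Union>y\<in>Y. B y"] Y(1) B(1) by auto
  have *: "\<exists>b\<in>set bs. \<forall>a. \<bar>h (act a (act b x)) - h (act a y)\<bar> \<le> e" for x y
  proof -
    obtain y' where y': "y' \<in> Y" "y \<in> V y'" using Y(2) by blast
    obtain b where b: "b \<in> B y'" "act b x \<in> V y'" using B(2) by blast
    have "\<bar>h (act a (act b x)) - h (act a y)\<bar> \<le> e" for a
      using V(3)[OF b(2), of a] V(3)[OF y'(2), of a] by linarith
    then show ?thesis using b(1) y'(1) bs by blast
  qed
  moreover have "bs \<noteq> []" using *[of undefined undefined] by auto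
  ultimately show ?thesis using that by blast
qed

text \<open>
  Von Neumann's construction of the mean. Take an average \<open>u\<close> of translates of \<open>h\<close> whose upper bound is
  almost least possible. At every point some translate of \<open>u\<close> by an element of \<open>bs\<close> is almost as small as
  \<open>u\<close> is anywhere, so averaging \<open>u\<close> over \<open>bs\<close> would lower the upper bound by a fixed fraction of the oscillation of
  \<open>u\<close>. Hence that oscillation is small; as \<open>u\<close> has the same integral as \<open>h\<close>, it is close to the mean of \<open>h\<close>.
\<close>
lemma average_close_to_mean_continuous:
  fixes h :: "'x \<Rightarrow> real"
  assumes h: "continuous_on UNIV h" and e: "e > 0"
  obtains as where "as \<noteq> []" "\<And>x. \<bar>average as h x - mean h\<bar> \<le> e"
proof -
  obtain L where L: "\<And>x. \<bar>h x\<bar> \<le> L"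
  proof -
    have "bounded (range h)"
      using compact_continuous_image[OF h compact_points] compact_imp_bounded by blast
    then show ?thesis using that unfolding bounded_iff by auto
  qed
  obtain bs where bs: "bs \<noteq> []"
    "\<And>x y. \<exists>b\<in>set bs. \<forall>a. \<bar>h (act a (act b x)) - h (act a y)\<bar> \<le> e / 2"
    using finite_recurrent_translates[OF h, of "e / 2"] e by auto
  define n where "n = length bs"
  have n: "n > 0" using bs by (simp add: n_def)
  \<comment> \<open>The least possible upper bound \<open>c\<close> of an average need not be attained; the slack \<open>e / (2 * n)\<close> is
    small compared with the gain from averaging over the \<open>n\<close> elements of \<open>bs\<close>.\<close>
  define T where "T = {t. \<exists>as. as \<noteq> [] \<and> (\<forall>x. average as h x \<le> t)}"
  have avL: "\<bar>average as h x\<bar> \<le> L" if "as \<noteq> []" for as x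
    using abs_average_le[of as h x] average_mono[of "\<lambda>x. \<bar>h x\<bar>" "\<lambda>x. L" as x, OF L]
      average_const[OF that, of L x] by linarith
  have T_ne: "T \<noteq> {}"
      proof -
    have "\<forall>x. average [0] h x \<le> L" using avL[of "[0]"] by (simp add: abs_le_iff)
    then have "L \<in> T" unfolding T_def by (intro CollectI exI[of _ "[0]"]) simp
    then show ?thesis by blast
  qed
  have T_bdd: "bdd_below T"
  proof (rule bdd_belowI)
    fix t assume "t \<in> T"
    then obtain as where "as \<noteq> []" "\<forall>x. average as h x \<le> t" by (auto simp: T_def)
    then have "average as h undefined \<le> t" "\<bar>average as h undefined\<bar> \<le> L"
      using avL by blast+
    then show "- L \<le> t" by linarith
  qed
  define c where "c = Inf T"
  have "\<exists>t\<in>T. t < c + e / (2 * n)"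
    unfolding c_def by (rule cInf_lessD[OF T_ne]) (use n e in auto)
  then obtain t as where as': "t < c + e / (2 * n)" "as \<noteq> []" "\<forall>x. average as h x \<le> t"
    unfolding T_def by blast
  then have as: "as \<noteq> []" "\<And>x. average as h x < c + e / (2 * n)"
    using order_le_less_trans by blast+
  define u where "u = average as h"
  have osc: "u x - u y \<le> e" for x y
  proof -
    define cs where "cs = concat (map (\<lambda>b. map (\<lambda>a. a + b) as) bs)"
    have "cs \<noteq> []" using as(1) bs(1) unfolding cs_def by (cases as; cases bs) auto
    define U where "U = c + e / (2 * n)"
    have close: "\<exists>b\<in>set bs. \<bar>u (act b z) - u y\<bar> \<le> e / 2" for z
    proof -
      obtain b where b: "b \<in> set bs" "\<And>a. \<bar>h (act a (act b z)) - h (act a y)\<bar> \<le> e / 2"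
        using bs(2) by blast
      have "u (act b z) - u y = (\<Sum>a\<leftarrow>as. h (act a (act b z)) - h (act a y)) / length as"
        by (simp add: u_def average_def sum_list_subtractf diff_divide_distrib)
      also have "\<bar>\<dots>\<bar> \<le> (\<Sum>a\<leftarrow>as. \<bar>h (act a (act b z)) - h (act a y)\<bar>) / length as"
        using sum_list_abs[of "map (\<lambda>a. h (act a (act b z)) - h (act a y)) as"]
        by (simp add: o_def divide_right_mono)
      also have "\<dots> \<le> (\<Sum>a\<leftarrow>as. e / 2) / length as"
        by (intro divide_right_mono sum_list_mono b(2)) auto
      also have "\<dots> = e / 2" using as(1) by (simp add: sum_list_triv)
      finally show ?thesis using b(1) by blast
    qed
    have "average cs h z \<le> ((real n - 1) * U + (u y + e / 2)) / n" for z
    proof -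
      obtain b where b: "b \<in> set bs" "\<bar>u (act b z) - u y\<bar> \<le> e / 2" using close by blast
      have "(\<Sum>b\<leftarrow>bs. u (act b z)) = u (act b z) + (\<Sum>b\<leftarrow>remove1 b bs. u (act b z))"
        using b(1) by (simp add: sum_list_map_remove1)
      also have "\<dots> \<le> (u y + e / 2) + (\<Sum>b\<leftarrow>remove1 b bs. U)"
      proof (intro add_mono sum_list_mono)
        show "u (act b z) \<le> u y + e / 2" using b(2) by linarith
        show "u (act b' z) \<le> U" for b'
          using as(2) by (auto simp: u_def U_def less_imp_le)
      qed
      also have "(\<Sum>b\<leftarrow>remove1 b bs. U) = (real n - 1) * U"
        using b(1) n by (simp add: sum_list_triv length_remove1 n_def Suc_leI of_nat_diff)
      finally have "average bs u z \<le> ((u y + e / 2) + (real n - 1) * U) / n"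
        unfolding average_def n_def by (intro divide_right_mono) auto
      then show ?thesis by (simp add: u_def average_average cs_def add.commute)
    qed
    then have "((real n - 1) * U + (u y + e / 2)) / n \<in> T"
      unfolding T_def using \<open>cs \<noteq> []\<close> by blast
    then have "c \<le> ((real n - 1) * U + (u y + e / 2)) / n"
      unfolding c_def by (intro cInf_lower T_bdd)
    then have "c * n \<le> (real n - 1) * U + (u y + e / 2)"
      using n by (simp add: field_simps)
    moreover have "(real n - 1) * U = real n * c + e / 2 - U"
      using n by (simp add: U_def field_simps)
    ultimately have "U \<le> u y + e" by (simp add: mult.commute)
    then show ?thesis using as(2)[of x] by (simp add: u_def U_def)
  qed
  have hint: "integrable M h"
    by (rule integrable_const_bound[of _ L]) (auto simp: L continuous_borel_measurable[OF h])
  have uint: "integrable M u" unfolding u_def by (intro integrable_average hint)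
  have mean_u: "(LINT y|M. u y) = mean h * measure M UNIV"
    using measure_UNIV_pos by (simp add: mean_def u_def integral_average[OF hint as(1)])
  have "\<bar>u x - mean h\<bar> \<le> e" for x
  proof -
    have "(LINT y|M. u x - e) \<le> (LINT y|M. u y)"
      using osc[of x] by (intro integral_mono uint) (auto simp: algebra_simps)
    then have 1: "(u x - e) * measure M UNIV \<le> mean h * measure M UNIV"
      by (simp add: mean_u mult.commute)
    have "(LINT y|M. u y) \<le> (LINT y|M. u x + e)"
      using osc[of _ x] by (intro integral_mono uint) (auto simp: algebra_simps)
    then have 2: "mean h * measure M UNIV \<le> (u x + e) * measure M UNIV"
      by (simp add: mean_u mult.commute)
    show ?thesis using 1 2 measure_UNIV_pos by (auto simp: mult_le_cancel_right abs_le_iff)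
  qed
  then show ?thesis using that as(1) by (simp add: u_def)
qed

section \<open>Averages of translates of integrable functions\<close>

definition L1_approximable :: "('x \<Rightarrow> real) \<Rightarrow> bool" where
  "L1_approximable u \<longleftrightarrow> (\<forall>e>0. \<exists>h. continuous_on UNIV h \<and> (LINT x|M. \<bar>u x - h x\<bar>) < e)"

lemma integrable_continuous:
  fixes h :: "'x \<Rightarrow> real"
  assumes h: "continuous_on UNIV h"
  shows "integrable M h"
proof -
  have "bounded (range h)"
    using compact_continuous_image[OF h compact_points] compact_imp_bounded by blast
  then obtain L where "\<And>x. norm (h x) \<le> L" unfolding bounded_iff by auto
  then show ?thesis
    by (intro integrable_const_bound[of _ L]) (auto simp: continuous_borel_measurable[OF h])
qed

lemma L1_triangle:
  fixes u v w :: "'x \<Rightarrow> real"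
  assumes "integrable M u" "integrable M v" "integrable M w"
  shows "(LINT x|M. \<bar>u x - w x\<bar>) \<le> (LINT x|M. \<bar>u x - v x\<bar>) + (LINT x|M. \<bar>v x - w x\<bar>)"
proof -
  have "(LINT x|M. \<bar>u x - w x\<bar>) \<le> (LINT x|M. \<bar>u x - v x\<bar> + \<bar>v x - w x\<bar>)"
    using assms by (intro integral_mono) auto
  also have "\<dots> = (LINT x|M. \<bar>u x - v x\<bar>) + (LINT x|M. \<bar>v x - w x\<bar>)"
    using assms by (intro Bochner_Integration.integral_add) auto
  finally show ?thesis .
qed

lemma L1_approximable_limit:
  assumes "\<And>n. integrable M (s n)" "\<And>n. L1_approximable (s n)" "integrable M u"
    and lim: "(\<lambda>n. LINT x|M. \<bar>u x - s n x\<bar>) \<longlonglongrightarrow> 0"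
  shows "L1_approximable u"
  unfolding L1_approximable_def
proof (intro allI impI)
  fix e :: real assume e: "e > 0"
  have "eventually (\<lambda>n. (LINT x|M. \<bar>u x - s n x\<bar>) < e / 2) sequentially"
    using order_tendstoD(2)[OF lim, of "e / 2"] e by simp
  then obtain n where n: "(LINT x|M. \<bar>u x - s n x\<bar>) < e / 2"
    by (auto simp: eventually_sequentially)
  obtain h where h: "continuous_on UNIV h" "(LINT x|M. \<bar>s n x - h x\<bar>) < e / 2"
    using assms(2)[of n] e unfolding L1_approximable_def by (meson half_gt_zero)
  have "(LINT x|M. \<bar>u x - h x\<bar>) < e"
    using L1_triangle[OF assms(3) assms(1)[of n] integrable_continuous[OF h(1)]] n h(2) by linarith
  then show "\<exists>h. continuous_on UNIV h \<and> (LINT x|M. \<bar>u x - h x\<bar>) < e" using h(1) by blast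
qed

lemma L1_approximable_continuous: "continuous_on UNIV h \<Longrightarrow> L1_approximable h"
  unfolding L1_approximable_def by (auto intro!: exI[of _ h])

lemma L1_approximable_add:
  assumes "integrable M u" "integrable M v" "L1_approximable u" "L1_approximable v"
  shows "L1_approximable (\<lambda>x. u x + v x)"
  unfolding L1_approximable_def
proof (intro allI impI)
  fix e :: real assume e: "e > 0"
  obtain h where h: "continuous_on UNIV h" "(LINT x|M. \<bar>u x - h x\<bar>) < e / 2"
    using assms(3) e unfolding L1_approximable_def by (meson half_gt_zero)
  obtain k where k: "continuous_on UNIV k" "(LINT x|M. \<bar>v x - k x\<bar>) < e / 2"
    using assms(4) e unfolding L1_approximable_def by (meson half_gt_zero)
  note [simp] = integrable_continuous[OF h(1)] integrable_continuous[OF k(1)] assms(1,2)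
  have "(LINT x|M. \<bar>u x + v x - (h x + k x)\<bar>) \<le> (LINT x|M. \<bar>u x - h x\<bar> + \<bar>v x - k x\<bar>)"
    by (intro integral_mono) auto
  also have "\<dots> = (LINT x|M. \<bar>u x - h x\<bar>) + (LINT x|M. \<bar>v x - k x\<bar>)"
    by (intro Bochner_Integration.integral_add) auto
  finally show "\<exists>h. continuous_on UNIV h \<and> (LINT x|M. \<bar>u x + v x - h x\<bar>) < e"
    using h k by (intro exI[of _ "\<lambda>x. h x + k x"]) (auto intro!: continuous_intros)
qed

lemma L1_approximable_cmult:
  assumes "integrable M u" "L1_approximable u"
  shows "L1_approximable (\<lambda>x. c * u x)"
proof (cases "c = 0")
  case False
  show ?thesis unfolding L1_approximable_def
  proof (intro allI impI)
    fix e :: real assume e: "e > 0"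
    obtain h where h: "continuous_on UNIV h" "(LINT x|M. \<bar>u x - h x\<bar>) < e / \<bar>c\<bar>"
      using assms(2) e False unfolding L1_approximable_def by (meson divide_pos_pos zero_less_abs_iff)
    have "(LINT x|M. \<bar>c * u x - c * h x\<bar>) = \<bar>c\<bar> * (LINT x|M. \<bar>u x - h x\<bar>)"
      by (simp add: abs_mult flip: right_diff_distrib)
    also have "\<dots> < e" using h(2) False by (simp add: field_simps)
    finally show "\<exists>h. continuous_on UNIV h \<and> (LINT x|M. \<bar>c * u x - h x\<bar>) < e"
      using h(1) by (intro exI[of _ "\<lambda>x. c * h x"]) (auto intro!: continuous_intros)
  qed
qed (auto intro!: L1_approximable_continuous)

lemma urysohn_at_point:
  assumes "open U" "x \<in> U"
  obtains h :: "'x \<Rightarrow> real" where "continuous_on UNIV h" "\<And>y. 0 \<le> h y \<and> h y \<le> 1"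
    "h x = 1" "\<And>y. y \<notin> U \<Longrightarrow> h y = 0"
proof -
  have "compact_space (euclidean :: 'x topology)"
    using compact_points by (simp add: compact_space_def)
  moreover have "Hausdorff_space (euclidean :: 'x topology)"
    unfolding Hausdorff_space_def by (auto simp: disjnt_def) (metis hausdorff)
  ultimately have "normal_space (euclidean :: 'x topology)"
    by (simp add: compact_Hausdorff_or_regular_imp_normal_space)
  moreover have "closedin euclidean (- U)" "closedin euclidean {x}"
    using assms by (auto simp: closed_Compl)
  moreover have "disjnt (- U) {x}" using assms by (auto simp: disjnt_def)
  ultimately obtain h where h: "continuous_map euclidean (top_of_set {0..1::real}) h"
    "h ` (- U) \<subseteq> {0}" "h ` {x} \<subseteq> {1}"
    using Urysohn_lemma[of "euclidean :: 'x topology" "- U" "{x}" 0 1] by auto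
  have "continuous_on UNIV h" "range h \<subseteq> {0..1}"
    using h(1) by (auto simp: continuous_map_in_subtopology)
  then show ?thesis using h that by (force simp: image_subset_iff)
qed

lemma L1_approximable_indicator_empty: "L1_approximable (indicator {})"
proof -
  have "(indicator {} :: 'x \<Rightarrow> real) = (\<lambda>_. 0)" by auto
  then show ?thesis using L1_approximable_continuous[of "\<lambda>_. 0"] by simp
qed

text \<open>
  Urysohn functions of points of \<open>U\<close> exceed \<open>1 / 2\<close> on neighbourhoods of those points. Countably many of
  these cover \<open>U\<close>, and the truncated partial sums of the doubled functions are eventually 1 at every point
  of \<open>U\<close> and vanish off \<open>U\<close>.
\<close>
lemma L1_approximable_indicator_open:
  assumes U: "open U"
  shows "L1_approximable (indicator U)"
proof (cases "U = {}")
  case False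
  have "\<forall>x\<in>U. \<exists>h :: 'x \<Rightarrow> real. continuous_on UNIV h \<and> (\<forall>y. 0 \<le> h y \<and> h y \<le> 1) \<and> h x = 1 \<and> (\<forall>y. y \<notin> U \<longrightarrow> h y = 0)"
    using urysohn_at_point[OF U] by metis
  then obtain h :: "'x \<Rightarrow> 'x \<Rightarrow> real" where h: "\<And>x. x \<in> U \<Longrightarrow> continuous_on UNIV (h x)"
    "\<And>x y. x \<in> U \<Longrightarrow> 0 \<le> h x y \<and> h x y \<le> 1" "\<And>x. x \<in> U \<Longrightarrow> h x x = 1"
    "\<And>x y. x \<in> U \<Longrightarrow> y \<notin> U \<Longrightarrow> h x y = 0" by metis
  define V where "V x = {y. 1 / 2 < h x y}" for x
  have V: "open (V x)" "x \<in> V x" "V x \<subseteq> U" if "x \<in> U" for x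
    using h that unfolding V_def by (auto intro!: open_Collect_less continuous_intros) force
  obtain \<F> where \<F>: "\<F> \<subseteq> V ` U" "countable \<F>" "\<Union>\<F> = \<Union>(V ` U)"
    using Lindelof[of "V ` U"] V by (metis imageE)
  obtain C where C: "C \<subseteq> U" "countable C" "\<F> = V ` C"
    using \<F> by (metis countable_image_eq_inj countable_subset_image)
  have cover: "U \<subseteq> \<Union>(V ` C)" using \<F>(3) V(2) C(3) by blast
  then have "C \<noteq> {}" using False by auto
  define c where "c = from_nat_into C"
  have c: "c n \<in> U" for n
    using from_nat_into[OF \<open>C \<noteq> {}\<close>] C(1) by (auto simp: c_def)
  define s where "s n y = min 1 (\<Sum>i\<le>n. 2 * h (c i) y)" for n y
  have cont: "continuous_on UNIV (s n)" for n
    unfolding s_def by (intro continuous_intros h c)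
  have s01: "0 \<le> s n y" "s n y \<le> 1" for n y
    unfolding s_def using h(2)[OF c] by (auto intro!: sum_nonneg)
  have lim: "(\<lambda>n. s n y) \<longlonglongrightarrow> indicator U y" for y
  proof (cases "y \<in> U")
    case True
    then obtain k where k: "y \<in> V (c k)"
      using cover C(2) \<open>C \<noteq> {}\<close> unfolding c_def by (metis UN_E from_nat_into_surj subsetD)
    have "s n y = 1" if "n \<ge> k" for n
    proof -
      have "2 * h (c k) y \<le> (\<Sum>i\<le>n. 2 * h (c i) y)"
        using that h(2)[OF c] by (intro member_le_sum) auto
      then show ?thesis using k by (simp add: s_def V_def)
    qed
    then show ?thesis using True by (intro tendsto_eventually) (auto simp: eventually_sequentially)
  next
    case False
    then show ?thesis using h(4)[OF c] by (simp add: s_def)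
  qed
  have Um: "U \<in> sets M" using U by (simp add: sets_M)
  show ?thesis
  proof (rule L1_approximable_limit)
    show "integrable M (s n)" "L1_approximable (s n)" for n
      using cont by (auto intro: integrable_continuous L1_approximable_continuous)
    show "integrable M (indicator U :: 'x \<Rightarrow> real)"
      using Um by (simp add: integrable_real_indicator emeasure_eq_measure)
    have "(\<lambda>n. LINT x|M. \<bar>indicator U x - s n x\<bar>) \<longlonglongrightarrow> (LINT x|M. 0)"
    proof (rule integral_dominated_convergence[where w = "\<lambda>_. 1"])
      show "(\<lambda>x. \<bar>indicator U x - s n x\<bar>) \<in> borel_measurable M" for n
        using Um continuous_borel_measurable[OF cont, of n] by auto
      show "AE x in M. (\<lambda>n. \<bar>indicator U x - s n x\<bar>) \<longlonglongrightarrow> 0"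
        using tendsto_rabs_zero[OF LIM_zero[OF lim]] by (auto simp: abs_minus_commute)
      show "AE x in M. norm \<bar>indicator U x - s n x\<bar> \<le> 1" for n
      proof (rule AE_I2)
        fix x
        show "norm \<bar>indicator U x - s n x\<bar> \<le> 1"
          using s01[of n x] by (auto simp: indicator_def abs_le_iff)
      qed
    qed auto
    then show "(\<lambda>n. LINT x|M. \<bar>indicator U x - s n x\<bar>) \<longlonglongrightarrow> 0" by simp
  qed
qed (use L1_approximable_indicator_empty in simp)

lemma L1_approximable_indicator:
  assumes "E \<in> sets M"
  shows "L1_approximable (indicator E)"
proof -
  have ind: "integrable M (indicator A :: 'x \<Rightarrow> real)" if "A \<in> sets M" for A
    using that by (simp add: integrable_real_indicator emeasure_eq_measure)
  have G: "sigma_sets UNIV {U :: 'x set. open U} = sets M"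
    by (simp add: sets_M borel_def)
  have "Int_stable {U :: 'x set. open U}" "{U :: 'x set. open U} \<subseteq> Pow UNIV"
    "E \<in> sigma_sets UNIV {U. open U}"
    using assms G by (auto simp: Int_stable_def)
  then show ?thesis
  proof (induction rule: sigma_sets_induct_disjoint)
    case (compl A)
    then have A: "A \<in> sets M" using G by simp
    have "L1_approximable (\<lambda>x. 1 + (- 1) * indicator A x)"
      using compl ind[OF A]
      by (intro L1_approximable_add L1_approximable_cmult L1_approximable_continuous[of "\<lambda>_. 1"]) auto
    also have "(\<lambda>x. 1 + (- 1) * indicator A x) = (indicator (UNIV - A) :: 'x \<Rightarrow> real)"
      by (auto simp: indicator_def)
    finally show ?case .
  next
    case (union A)
    have A: "A i \<in> sets M" for i using union(2) G by auto
    define s :: "nat \<Rightarrow> 'x \<Rightarrow> real" where "s n x = (\<Sum>i<n. indicator (A i) x)" for n x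
    have s_eq: "s n x = indicator (\<Union>i<n. A i) x" for n x
      unfolding s_def using union(1)
      by (subst indicator_UN_disjoint) (auto simp: disjoint_family_on_def)
    have s_int: "integrable M (s n)" for n
      unfolding s_def by (intro Bochner_Integration.integrable_sum ind A)
    show ?case
    proof (rule L1_approximable_limit)
      show "integrable M (s n)" for n by (rule s_int)
      show "L1_approximable (s n)" for n
      proof (induction n)
        case 0 show ?case unfolding s_def by (auto intro: L1_approximable_continuous)
      next
        case (Suc n)
        have "s (Suc n) = (\<lambda>x. s n x + indicator (A n) x)" by (simp add: s_def fun_eq_iff)
        then show ?case using L1_approximable_add[OF s_int ind[OF A] Suc union(3)] by simp
      qed
      show "integrable M (indicator (\<Union>i. A i) :: 'x \<Rightarrow> real)"
        using A by (intro ind) auto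
      have "(\<lambda>n. LINT x|M. \<bar>indicator (\<Union>i. A i) x - s n x\<bar>) \<longlonglongrightarrow> (LINT x|M. 0)"
      proof (rule integral_dominated_convergence[where w = "\<lambda>_. 1"])
        show "(\<lambda>x. \<bar>indicator (\<Union>i. A i) x - s n x\<bar>) \<in> borel_measurable M" for n
          using A s_int[of n] by (auto intro!: borel_measurable_abs borel_measurable_diff)
        show "AE x in M. (\<lambda>n. \<bar>indicator (\<Union>i. A i) x - s n x\<bar>) \<longlonglongrightarrow> 0"
        proof (rule AE_I2)
          fix x
          show "(\<lambda>n. \<bar>indicator (\<Union>i. A i) x - s n x\<bar>) \<longlonglongrightarrow> 0"
            unfolding s_eq
            using tendsto_rabs_zero[OF LIM_zero[OF LIMSEQ_indicator_UN[of A x]]]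
            by (simp add: abs_minus_commute)
        qed
        show "AE x in M. norm \<bar>indicator (\<Union>i. A i) x - s n x\<bar> \<le> 1" for n
          unfolding s_eq by (auto simp: indicator_def)
      qed auto
      then show "(\<lambda>n. LINT x|M. \<bar>indicator (\<Union>i. A i) x - s n x\<bar>) \<longlonglongrightarrow> 0" by simp
    qed
  next
    case empty
    show ?case by (rule L1_approximable_indicator_empty)
  next
    case (basic A)
    then show ?case by (intro L1_approximable_indicator_open) simp
  qed
qed

lemma L1_approximable_integrable:
  "integrable M u \<Longrightarrow> L1_approximable u"
proof (induction u rule: integrable_induct)
  case (base A c)
  then have "L1_approximable (\<lambda>x. c * indicator A x)"
    by (intro L1_approximable_cmult L1_approximable_indicator) (auto simp: integrable_real_indicator)
  then show ?case by (simp add: mult.commute)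
next
  case (add f g)
  then show ?case by (intro L1_approximable_add)
next
  case (lim f s)
  have "(\<lambda>n. LINT x|M. \<bar>f x - s n x\<bar>) \<longlonglongrightarrow> (LINT x|M. 0)"
  proof (rule integral_dominated_convergence[where w = "\<lambda>x. 3 * \<bar>f x\<bar>"])
    show "(\<lambda>x. \<bar>f x - s n x\<bar>) \<in> borel_measurable M" for n
      using lim.hyps(1)[of n] lim.hyps(4) by (auto intro!: borel_measurable_abs borel_measurable_diff)
    show "AE x in M. (\<lambda>n. \<bar>f x - s n x\<bar>) \<longlonglongrightarrow> 0"
    proof (rule AE_I2)
      fix x
      show "(\<lambda>n. \<bar>f x - s n x\<bar>) \<longlonglongrightarrow> 0" 
        using tendsto_rabs_zero[OF LIM_zero[OF lim.hyps(2)[of x]]] by (simp add: abs_minus_commute)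
    qed
    show "AE x in M. norm \<bar>f x - s n x\<bar> \<le> 3 * \<bar>f x\<bar>" for n
    proof (rule AE_I2)
      fix x
      have "\<bar>s n x\<bar> \<le> 2 * \<bar>f x\<bar>" using lim.hyps(3)[of x n] by simp
      then show "norm \<bar>f x - s n x\<bar> \<le> 3 * \<bar>f x\<bar>"
        using abs_triangle_ineq4[of "f x" "s n x"] unfolding real_norm_def abs_abs by linarith
    qed
  qed (use lim.hyps(4) in auto)
  then show ?case
    by (intro L1_approximable_limit[OF lim.hyps(1) lim.IH lim.hyps(4)]) simp
qed

lemma L1_average_mean_le:
  assumes "integrable M h" "as \<noteq> []"
  shows "(LINT x|M. \<bar>average as h x - mean h\<bar>) \<le> (LINT x|M. \<bar>h x - mean h\<bar>)"
  using L1_average_le[of "\<lambda>x. h x - mean h" as] assms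
  by (simp add: average_diff average_const)

lemma average_close_to_mean:
  assumes u: "integrable M u" and e: "e > 0"
  obtains as where "as \<noteq> []" "(LINT x|M. \<bar>average as u x - mean u\<bar>) \<le> e"
proof -
  define m where "m = measure M UNIV"
  have m: "m > 0" using measure_UNIV_pos by (simp add: m_def)
  obtain h where h: "continuous_on UNIV h" "(LINT x|M. \<bar>u x - h x\<bar>) < e / 3"
    using L1_approximable_integrable[OF u] e unfolding L1_approximable_def
    by (meson divide_pos_pos zero_less_numeral)
  note hi = integrable_continuous[OF h(1)]
  have "e / (3 * m) > 0" using e m by simp
  then obtain as where as: "as \<noteq> []" "\<And>x. \<bar>average as h x - mean h\<bar> \<le> e / (3 * m)"
    using average_close_to_mean_continuous[OF h(1)] by blast
  have 1: "(LINT x|M. \<bar>average as u x - average as h x\<bar>) \<le> e / 3"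
    using L1_average_le[of "\<lambda>x. u x - h x" as] u hi as(1) h(2) by (simp add: average_diff)
  have "(LINT x|M. \<bar>average as h x - mean h\<bar>) \<le> (LINT x|M. e / (3 * m))"
    using as(2) by (intro integral_mono) (auto intro!: integrable_average hi)
  also have "\<dots> = e / 3" using m by (simp add: m_def)
  finally have 2: "(LINT x|M. \<bar>average as h x - mean h\<bar>) \<le> e / 3" .
  have "\<bar>mean h - mean u\<bar> = \<bar>LINT x|M. u x - h x\<bar> / m"
    using u hi m by (simp add: mean_def m_def abs_minus_commute flip: diff_divide_distrib)
  also have "\<dots> \<le> (LINT x|M. \<bar>u x - h x\<bar>) / m"
    using m by (intro divide_right_mono integral_abs_bound) auto
  finally have "(LINT x|M. \<bar>mean h - mean u\<bar>) \<le> e / 3"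
    using m h(2) by (simp add: m_def field_simps)
  then have "(LINT x|M. \<bar>average as u x - mean u\<bar>) \<le> e"
    using 1 2 L1_triangle[of "average as u" "average as h" "\<lambda>_. mean u"]
      L1_triangle[of "average as h" "\<lambda>_. mean h" "\<lambda>_. mean u"] u hi
    by (simp add: integrable_average)
  then show ?thesis using that as(1) by blast
qed

text \<open>
  A further average does not increase the distance of a function to its mean, so the functions in \<open>H\<close>
  can be treated one after the other, composing the averages.
\<close>
lemma averages_close_to_means:
  assumes "finite H" "\<And>h. h \<in> H \<Longrightarrow> integrable M h" "e > 0"
  obtains as where "as \<noteq> []" "\<And>h. h \<in> H \<Longrightarrow> (LINT x|M. \<bar>average as h x - mean h\<bar>) \<le> e"
proof -
  have "\<exists>as. as \<noteq> [] \<and> (\<forall>h\<in>H. (LINT x|M. \<bar>average as h x - mean h\<bar>) \<le> e)"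
    using assms(1,2)
  proof (induction H)
    case empty
    show ?case by (intro exI[of _ "[0]"]) simp
  next
    case (insert k H)
    then obtain as where as: "as \<noteq> []" "\<forall>h\<in>H. (LINT x|M. \<bar>average as h x - mean h\<bar>) \<le> e" by auto
    have k: "integrable M (average as k)" using insert by (intro integrable_average) auto
    obtain bs where bs: "bs \<noteq> []" "(LINT x|M. \<bar>average bs (average as k) x - mean (average as k)\<bar>) \<le> e"
      using average_close_to_mean[OF k assms(3)] by blast
    define cs where "cs = concat (map (\<lambda>b. map (\<lambda>a. a + b) as) bs)"
    have cs: "average cs h = average bs (average as h)" for h
      by (simp add: average_average cs_def)
    have "cs \<noteq> []" using as(1) bs(1) unfolding cs_def by (cases as; cases bs) auto
    moreover have "(LINT x|M. \<bar>average cs h x - mean h\<bar>) \<le> e" if "h \<in> insert k H" for h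
    proof (cases "h = k")
      case True
      then show ?thesis using bs(2) insert.prems as(1) by (simp add: cs mean_average)
    next
      case False
      then have h: "h \<in> H" "integrable M h" using that insert.prems by auto
      then show ?thesis
        using L1_average_mean_le[OF integrable_average[OF h(2), of as] bs(1)] as
        by (force simp: cs mean_average)
    qed
    ultimately show ?case by blast
  qed
  then show ?thesis using that by blast
qed

lemma averages_tendsto_means:
  assumes "finite H" "\<And>h. h \<in> H \<Longrightarrow> integrable M h"
  obtains as :: "nat \<Rightarrow> 'g list" where "\<And>k. as k \<noteq> []"
    "\<And>h. h \<in> H \<Longrightarrow> (\<lambda>k. LINT x|M. \<bar>average (as k) h x - mean h\<bar>) \<longlonglongrightarrow> 0"
proof -
  have "\<exists>as. as \<noteq> [] \<and> (\<forall>h\<in>H. (LINT x|M. \<bar>average as h x - mean h\<bar>) \<le> inverse (real (Suc k)))" for k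
    using averages_close_to_means[OF assms, of "inverse (real (Suc k))"]
    by (metis inverse_positive_iff_positive of_nat_0_less_iff zero_less_Suc)
  then obtain as where as: "\<And>k. as k \<noteq> []"
    "\<And>k h. h \<in> H \<Longrightarrow> (LINT x|M. \<bar>average (as k) h x - mean h\<bar>) \<le> inverse (real (Suc k))"
    by metis
  have "(\<lambda>k. LINT x|M. \<bar>average (as k) h x - mean h\<bar>) \<longlonglongrightarrow> 0" if "h \<in> H" for h
  proof (rule tendsto_sandwich[OF _ _ tendsto_const LIMSEQ_inverse_real_of_nat])
    show "\<forall>\<^sub>F k in sequentially. (LINT x|M. \<bar>average (as k) h x - mean h\<bar>) \<le> inverse (real (Suc k))"
      by (intro always_eventually allI as that)
  qed simp
  then show ?thesis using that as(1) by blast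
qed

end

text \<open>
  Convergence in \<open>L\<^sup>1\<close> to constants passes to these products because the factors \<open>v k\<close> are uniformly
  bounded. The products arise as expectations over independent translates.
\<close>
lemma (in finite_measure) tendsto_integral_mult_power:
  fixes u v :: "nat \<Rightarrow> 'a \<Rightarrow> real"
  assumes u: "\<And>k. integrable M (u k)" and v: "\<And>k. integrable M (v k)"
    and bound: "\<And>k x. \<bar>v k x\<bar> \<le> L" "\<bar>v'\<bar> \<le> L"
    and lim_u: "(\<lambda>k. LINT x|M. \<bar>u k x - u'\<bar>) \<longlonglongrightarrow> 0"
    and lim_v: "(\<lambda>k. LINT x|M. \<bar>v k x - v'\<bar>) \<longlonglongrightarrow> 0"
  shows "(\<lambda>k. LINT x|M. u k x * v k x ^ n) \<longlonglongrightarrow> measure M (space M) * (u' * v' ^ n)"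
    and "integrable M (\<lambda>x. u k x * v k x ^ n)"
proof -
  have L: "L \<ge> 0" using bound(2) by linarith
  have int: "integrable M (\<lambda>x. w x * v k x ^ n)" if "integrable M w" for w k
  proof (rule Bochner_Integration.integrable_bound[of _ "\<lambda>x. L ^ n * \<bar>w x\<bar>"])
    show "AE x in M. norm (w x * v k x ^ n) \<le> norm (L ^ n * \<bar>w x\<bar>)"
    proof (rule AE_I2)
      fix x
      have "\<bar>v k x\<bar> ^ n \<le> L ^ n" using bound by (intro power_mono) auto
      then show "norm (w x * v k x ^ n) \<le> norm (L ^ n * \<bar>w x\<bar>)"
        using L by (simp add: abs_mult power_abs mult.commute[of "L ^ n"] mult_left_mono)
    qed
  qed (use that v[of k] in auto)
  then show "integrable M (\<lambda>x. u k x * v k x ^ n)" using u by blast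
  have pow: "\<bar>v k x ^ n - v' ^ n\<bar> \<le> real n * L ^ (n - 1) * \<bar>v k x - v'\<bar>" for k x
  proof -
    have "\<bar>\<Sum>i<n. v' ^ (n - Suc i) * v k x ^ i\<bar> \<le> (\<Sum>i<n. \<bar>v' ^ (n - Suc i) * v k x ^ i\<bar>)"
      by (rule sum_abs)
    also have "\<dots> \<le> (\<Sum>i<n. L ^ (n - 1))"
    proof (rule sum_mono)
      fix i assume i: "i \<in> {..<n}"
      have "\<bar>v' ^ (n - Suc i) * v k x ^ i\<bar> \<le> L ^ (n - Suc i) * L ^ i"
        unfolding abs_mult power_abs using bound L by (intro mult_mono power_mono) auto
      also have "\<dots> = L ^ (n - 1)" using i by (simp flip: power_add)
      finally show "\<bar>v' ^ (n - Suc i) * v k x ^ i\<bar> \<le> L ^ (n - 1)" .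
    qed
    finally have "\<bar>v k x - v'\<bar> * \<bar>\<Sum>i<n. v' ^ (n - Suc i) * v k x ^ i\<bar>
        \<le> \<bar>v k x - v'\<bar> * (real n * L ^ (n - 1))"
      by (intro mult_left_mono) auto
    moreover have "\<bar>v k x ^ n - v' ^ n\<bar> = \<bar>v k x - v'\<bar> * \<bar>\<Sum>i<n. v' ^ (n - Suc i) * v k x ^ i\<bar>"
      by (simp add: power_diff_sumr2 abs_mult)
    ultimately show ?thesis by (simp add: mult.commute)
  qed
  have est: "\<bar>(LINT x|M. u k x * v k x ^ n) - measure M (space M) * (u' * v' ^ n)\<bar>
      \<le> L ^ n * (LINT x|M. \<bar>u k x - u'\<bar>) + \<bar>u'\<bar> * (real n * L ^ (n - 1)) * (LINT x|M. \<bar>v k x - v'\<bar>)" for k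
  proof -
    have "(LINT x|M. u k x * v k x ^ n) - measure M (space M) * (u' * v' ^ n)
        = (LINT x|M. u k x * v k x ^ n - u' * v' ^ n)"
      using int[OF u] by simp
    also have "\<bar>\<dots>\<bar> \<le> (LINT x|M. \<bar>u k x * v k x ^ n - u' * v' ^ n\<bar>)" by (rule integral_abs_bound)
    also have "\<dots> \<le> (LINT x|M. L ^ n * \<bar>u k x - u'\<bar> + \<bar>u'\<bar> * (real n * L ^ (n - 1)) * \<bar>v k x - v'\<bar>)"
    proof (rule integral_mono)
      fix x
      have "u k x * v k x ^ n - u' * v' ^ n = (u k x - u') * v k x ^ n + u' * (v k x ^ n - v' ^ n)"
        by (simp add: algebra_simps)
      also have "\<bar>\<dots>\<bar> \<le> \<bar>u k x - u'\<bar> * \<bar>v k x\<bar> ^ n + \<bar>u'\<bar> * \<bar>v k x ^ n - v' ^ n\<bar>"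
        by (metis abs_mult abs_triangle_ineq power_abs)
      also have "\<dots> \<le> \<bar>u k x - u'\<bar> * L ^ n + \<bar>u'\<bar> * (real n * L ^ (n - 1) * \<bar>v k x - v'\<bar>)"
        using bound by (intro add_mono mult_left_mono power_mono pow) auto
      finally show "\<bar>u k x * v k x ^ n - u' * v' ^ n\<bar>
        \<le> L ^ n * \<bar>u k x - u'\<bar> + \<bar>u'\<bar> * (real n * L ^ (n - 1)) * \<bar>v k x - v'\<bar>"
        by (simp add: mult.commute mult.left_commute)
    qed (use int[OF u] u v in auto)
    also have "\<dots> = L ^ n * (LINT x|M. \<bar>u k x - u'\<bar>) + \<bar>u'\<bar> * (real n * L ^ (n - 1)) * (LINT x|M. \<bar>v k x - v'\<bar>)"
      using u v by simp
    finally show ?thesis .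
  qed
  have "(\<lambda>k. L ^ n * (LINT x|M. \<bar>u k x - u'\<bar>) + \<bar>u'\<bar> * (real n * L ^ (n - 1)) * (LINT x|M. \<bar>v k x - v'\<bar>))
      \<longlonglongrightarrow> L ^ n * 0 + \<bar>u'\<bar> * (real n * L ^ (n - 1)) * 0"
    by (intro tendsto_intros lim_u lim_v)
  then have lim: "(\<lambda>k. L ^ n * (LINT x|M. \<bar>u k x - u'\<bar>)
      + \<bar>u'\<bar> * (real n * L ^ (n - 1)) * (LINT x|M. \<bar>v k x - v'\<bar>)) \<longlonglongrightarrow> 0"
    by simp
  have "(\<lambda>k. (LINT x|M. u k x * v k x ^ n) - measure M (space M) * (u' * v' ^ n)) \<longlonglongrightarrow> 0"
  proof (rule Lim_null_comparison[OF always_eventually lim], intro allI)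
    fix k
    show "norm ((LINT x|M. u k x * v k x ^ n) - measure M (space M) * (u' * v' ^ n))
        \<le> L ^ n * (LINT x|M. \<bar>u k x - u'\<bar>)
          + \<bar>u'\<bar> * (real n * L ^ (n - 1)) * (LINT x|M. \<bar>v k x - v'\<bar>)"
      unfolding real_norm_def by (rule est)
  qed
  then show "(\<lambda>k. LINT x|M. u k x * v k x ^ n) \<longlonglongrightarrow> measure M (space M) * (u' * v' ^ n)"
    by (rule LIM_zero_cancel)
qed

section \<open>Operators on Lebesgue spaces and the L log L bound\<close>

definition LlogL :: "real \<Rightarrow> real \<Rightarrow> real" where
  "LlogL r s = s * (1 + ln (1 + s)) powr r"

lemma LlogL_nonneg: "0 \<le> s \<Longrightarrow> 0 \<le> LlogL r s"
  by (simp add: LlogL_def)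

lemma LlogL_0 [simp]: "LlogL r 0 = 0"
  by (simp add: LlogL_def)

lemma log_weight_mono:
  fixes r s :: real
  shows
  "0 \<le> r \<Longrightarrow> 0 \<le> s \<Longrightarrow> s \<le> t \<Longrightarrow> (1 + ln (1 + s)) powr r \<le> (1 + ln (1 + t)) powr r"
  by (intro powr_mono2) (auto intro!: add_nonneg_nonneg)

lemma LlogL_mono:
  fixes r s :: real
  shows "0 \<le> r \<Longrightarrow> 0 \<le> s \<Longrightarrow> s \<le> t \<Longrightarrow> LlogL r s \<le> LlogL r t"
  unfolding LlogL_def by (intro mult_mono log_weight_mono) auto

lemma log_weight_ge_1:
  fixes r s :: real
  shows "0 \<le> r \<Longrightarrow> 0 \<le> s \<Longrightarrow> 1 \<le> (1 + ln (1 + s)) powr r"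
  by (intro ge_one_powr_ge_zero) auto

lemma LlogL_ge:
  fixes r s :: real
  shows "0 \<le> r \<Longrightarrow> 0 \<le> s \<Longrightarrow> s \<le> LlogL r s"
  unfolding LlogL_def using log_weight_ge_1[of r s] mult_left_mono[of 1 _ s] by fastforce

lemma LlogL_measurable [measurable]: "LlogL r \<in> borel_measurable borel"
  unfolding LlogL_def[abs_def] by measurable

text \<open>
  Hoelder's inequality against the constant 1, obtained by integrating the weighted arithmetic-geometric
  inequality for \<open>g x powr q\<close> divided by its mean.
\<close>
lemma (in finite_measure) moment_mono:
  assumes pq: "0 < p" "p \<le> q" and g: "g \<in> borel_measurable M" "\<And>x. 0 \<le> g x"
    and int: "integrable M (\<lambda>x. g x powr q)"
  shows "integrable M (\<lambda>x. g x powr p)"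
    and "0 < measure M (space M) \<Longrightarrow> (LINT x|M. g x powr p)
      \<le> measure M (space M) powr (1 - p / q) * (LINT x|M. g x powr q) powr (p / q)"
proof -
  note [measurable] = g(1)
  have young: "s powr (p / q) \<le> (p / q) * s + (1 - p / q)" if "0 \<le> s" for s
    using Youngs_inequality_0[of "p / q" "1 - p / q" s 1] pq that by (cases "s = 0") auto
  have pow: "g x powr p = (g x powr q) powr (p / q)" for x
    using pq by (simp add: powr_powr)
  show intp: "integrable M (\<lambda>x. g x powr p)"
  proof (rule Bochner_Integration.integrable_bound)
    show "integrable M (\<lambda>x. (p / q) * g x powr q + (1 - p / q))" using int by auto
    show "AE x in M. norm (g x powr p) \<le> norm ((p / q) * g x powr q + (1 - p / q))"
    proof (rule AE_I2)
      fix x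
      have "g x powr p \<le> (p / q) * g x powr q + (1 - p / q)"
        unfolding pow using young by simp
      then show "norm (g x powr p) \<le> norm ((p / q) * g x powr q + (1 - p / q))"
        by simp
    qed
  qed measurable
  assume m: "0 < measure M (space M)"
  define m where "m = measure M (space M)"
  define I where "I = (LINT x|M. g x powr q)"
  have "I \<ge> 0" by (simp add: I_def)
  show "(LINT x|M. g x powr p) \<le> m powr (1 - p / q) * I powr (p / q)"
  proof (cases "I = 0")
    case True
    then have "AE x in M. g x powr q = 0"
      unfolding I_def using int by (subst (asm) integral_nonneg_eq_0_iff_AE) auto
    then have "(LINT x|M. g x powr p) = (LINT x|M. 0)"
      by (intro integral_cong_AE) auto
    then show ?thesis by simp
  next
    case False
    with \<open>I \<ge> 0\<close> have I: "I > 0" by simp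
    have "(LINT x|M. (m / I) powr (p / q) * g x powr p)
        \<le> (LINT x|M. (p / q) * ((m / I) * g x powr q) + (1 - p / q))"
    proof (rule integral_mono)
      fix x
      show "(m / I) powr (p / q) * g x powr p \<le> (p / q) * ((m / I) * g x powr q) + (1 - p / q)"
        using young[of "(m / I) * g x powr q"] I m unfolding pow powr_mult[symmetric] m_def
        by simp
    qed (use intp int in auto)
    also have "\<dots> = (p / q) * ((m / I) * I) + (1 - p / q) * m"
      using int by (simp add: I_def m_def)
    also have "\<dots> = m" using I by (simp add: field_simps)
    finally have "(m / I) powr (p / q) * (LINT x|M. g x powr p) \<le> m" by simp
    then have "(LINT x|M. g x powr p) \<le> m / (m / I) powr (p / q)"
      using m I by (simp add: m_def field_simps)
    also have "\<dots> = m powr (1 - p / q) * I powr (p / q)"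
      using m I by (simp add: m_def powr_divide powr_diff)
    finally show ?thesis .
  qed
qed

text \<open>
  Any larger bound for the norm serves as well, so \<open>K\<close> may be taken at least 1, which keeps it positive.
\<close>
locale Lp_operator = finite_measure M for M :: "'x measure" +
  fixes T :: "('x \<Rightarrow> complex) \<Rightarrow> 'x \<Rightarrow> complex" and p0 K :: real
  assumes p0: "1 < p0"
    and linear_T: "linear_operator_on_Lp M p0 T"
    and K_ge_1: "1 \<le> K"
    and bounded_T: "Lp_bounded M p0 p0 T K"
    and space_UNIV: "space M = UNIV"
    and M_pos: "0 < measure M (space M)"
begin

lemma Lp_measurable: "f \<in> Lp M p \<Longrightarrow> f \<in> borel_measurable M"
  by (simp add: Lp_def)

lemma Lp_integrable: "f \<in> Lp M p \<Longrightarrow> integrable M (\<lambda>x. cmod (f x) powr p)"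
  by (simp add: Lp_def)

lemma Lp_mono: "f \<in> Lp M q \<Longrightarrow> 0 < p \<Longrightarrow> p \<le> q \<Longrightarrow> f \<in> Lp M p"
  using moment_mono(1)[of p q "\<lambda>x. cmod (f x)"] by (auto simp: Lp_def)

lemma Lp_imp_integrable: "f \<in> Lp M p \<Longrightarrow> 1 \<le> p \<Longrightarrow> integrable M f"
  using Lp_mono[of f p 1] by (auto simp: Lp_def integrable_norm_iff)

lemma bounded_in_Lp:
  assumes "f \<in> borel_measurable M" "\<And>x. cmod (f x) \<le> B" "0 < p"
  shows "f \<in> Lp M p"
proof -
  have "cmod (f x) powr p \<le> B powr p" for x
    using assms by (intro powr_mono2) auto
  then show ?thesis
    unfolding Lp_def using assms(1) by (auto intro!: integrable_const_bound[of _ "B powr p"])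
qed

lemma Lp_add:
  assumes "f \<in> Lp M p" "h \<in> Lp M p" "0 < p"
  shows "(\<lambda>x. f x + h x) \<in> Lp M p"
proof -
  note [measurable] = Lp_measurable[OF assms(1)] Lp_measurable[OF assms(2)]
  have "integrable M (\<lambda>x. cmod (f x + h x) powr p)"
  proof (rule Bochner_Integration.integrable_bound)
    show "integrable M (\<lambda>x. 2 powr p * (cmod (f x) powr p + cmod (h x) powr p))"
      using assms by (auto simp: Lp_def)
    show "AE x in M. norm (cmod (f x + h x) powr p)
        \<le> norm (2 powr p * (cmod (f x) powr p + cmod (h x) powr p))"
    proof (rule AE_I2)
      fix x
      have "cmod (f x + h x) \<le> 2 * max (cmod (f x)) (cmod (h x))"
        using norm_triangle_ineq[of "f x" "h x"] by linarith
      then have "cmod (f x + h x) powr p \<le> (2 * max (cmod (f x)) (cmod (h x))) powr p"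
        using assms by (intro powr_mono2) auto
      also have "\<dots> \<le> 2 powr p * (cmod (f x) powr p + cmod (h x) powr p)"
        by (auto simp: powr_mult max_def)
      finally show "norm (cmod (f x + h x) powr p)
          \<le> norm (2 powr p * (cmod (f x) powr p + cmod (h x) powr p))" by simp
    qed
  qed measurable
  then show ?thesis by (simp add: Lp_def)
qed

lemma Lp_cmult:
  assumes "f \<in> Lp M p" shows "(\<lambda>x. a * f x) \<in> Lp M p"
  using assms by (auto simp: Lp_def norm_mult powr_mult)

lemma Lp_zero: "(\<lambda>x. 0) \<in> Lp M p"
  by (simp add: Lp_def)

lemma Lp_sum:
  "finite I \<Longrightarrow> (\<And>i. i \<in> I \<Longrightarrow> f i \<in> Lp M p) \<Longrightarrow> 0 < p \<Longrightarrow> (\<lambda>x. \<Sum>i\<in>I. f i x) \<in> Lp M p"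
  by (induction I rule: finite_induct) (auto intro: Lp_add Lp_zero)

lemma T_in_Lp: "f \<in> Lp M p0 \<Longrightarrow> T f \<in> Lp M p0"
  using linear_T by (simp add: linear_operator_on_Lp_def)

lemma T_measurable: "f \<in> Lp M p0 \<Longrightarrow> T f \<in> borel_measurable M"
  using T_in_Lp Lp_measurable by blast

lemma T_integrable: "f \<in> Lp M p0 \<Longrightarrow> integrable M (T f)"
  using T_in_Lp Lp_imp_integrable p0 by force

lemma T_cong: "f \<in> Lp M p0 \<Longrightarrow> h \<in> Lp M p0 \<Longrightarrow> AE x in M. f x = h x \<Longrightarrow> AE x in M. T f x = T h x"
  using linear_T by (simp add: linear_operator_on_Lp_def)

lemma T_add: "f \<in> Lp M p0 \<Longrightarrow> h \<in> Lp M p0 \<Longrightarrow> AE x in M. T (\<lambda>x. f x + h x) x = T f x + T h x"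
  using linear_T by (simp add: linear_operator_on_Lp_def)

lemma T_cmult: "f \<in> Lp M p0 \<Longrightarrow> AE x in M. T (\<lambda>x. a * f x) x = a * T f x"
  using linear_T by (simp add: linear_operator_on_Lp_def)

lemma T_zero: "AE x in M. T (\<lambda>x. 0) x = 0"
  using T_cmult[OF Lp_zero, of 0] by simp

lemma T_lincomb:
  assumes "finite I" "\<And>i. i \<in> I \<Longrightarrow> f i \<in> Lp M p0"
  shows "AE x in M. T (\<lambda>x. \<Sum>i\<in>I. a i * f i x) x = (\<Sum>i\<in>I. a i * T (f i) x)"
  using assms
proof (induction I rule: finite_induct)
  case empty
  then show ?case using T_zero by simp
next
  case (insert j I)
  have "(\<lambda>x. \<Sum>i\<in>I. a i * f i x) \<in> Lp M p0"
    using insert p0 by (intro Lp_sum Lp_cmult) auto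
  moreover have "(\<lambda>x. a j * f j x) \<in> Lp M p0" using insert by (intro Lp_cmult) auto
  ultimately have "AE x in M. T (\<lambda>x. a j * f j x + (\<Sum>i\<in>I. a i * f i x)) x
      = T (\<lambda>x. a j * f j x) x + T (\<lambda>x. \<Sum>i\<in>I. a i * f i x) x"
    by (intro T_add)
  moreover have "AE x in M. T (\<lambda>x. a j * f j x) x = a j * T (f j) x"
    using insert by (intro T_cmult) auto
  ultimately show ?case using insert by (auto elim: eventually_elim2)
qed

lemma T_power_bound:
  assumes "f \<in> Lp M p0"
  shows "(LINT x|M. cmod (T f x) powr p0) \<le> K powr p0 * (LINT x|M. cmod (f x) powr p0)"
proof -
  have "Lp_norm M p0 (T f) \<le> K * Lp_norm M p0 f"
    using bounded_T assms by (simp add: Lp_bounded_def)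
  then have "Lp_norm M p0 (T f) powr p0 \<le> (K * Lp_norm M p0 f) powr p0"
    using p0 by (intro powr_mono2) (auto simp: Lp_norm_def)
  then show ?thesis
    using p0 K_ge_1 by (simp add: Lp_norm_def powr_mult powr_powr)
qed

lemma T_L1_bound_unit:
  assumes f: "f \<in> borel_measurable M" "\<And>x. cmod (f x) \<le> 1"
  shows "(LINT x|M. cmod (T f x)) \<le> K * measure M (space M)"
proof -
  define m where "m = measure M (space M)"
  have f0: "f \<in> Lp M p0" using bounded_in_Lp[OF f] p0 by simp
  have "(LINT x|M. cmod (f x) powr p0) \<le> (LINT x|M. 1)"
    using Lp_integrable[OF f0] f(2) p0 by (intro integral_mono) (auto intro: powr_le1)
  then have "(LINT x|M. cmod (T f x) powr p0) \<le> K powr p0 * m"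
    using T_power_bound[OF f0] K_ge_1 by (auto simp: m_def elim: order_trans intro: mult_left_mono)
  then have "(LINT x|M. cmod (T f x) powr p0) powr (1 / p0) \<le> (K powr p0 * m) powr (1 / p0)"
    using p0 by (intro powr_mono2) auto
  also have "\<dots> = K * m powr (1 / p0)"
    using p0 K_ge_1 by (simp add: powr_mult powr_powr m_def)
  finally have 1: "(LINT x|M. cmod (T f x) powr p0) powr (1 / p0) \<le> K * m powr (1 / p0)" .
  have "(LINT x|M. cmod (T f x) powr 1)
      \<le> m powr (1 - 1 / p0) * (LINT x|M. cmod (T f x) powr p0) powr (1 / p0)"
    unfolding m_def using p0 M_pos T_in_Lp[OF f0]
    by (intro moment_mono(2)) (auto simp: Lp_def)
  also have "\<dots> \<le> m powr (1 - 1 / p0) * (K * m powr (1 / p0))"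
    using 1 by (intro mult_left_mono) auto
  also have "\<dots> = K * m" using M_pos by (simp add: m_def flip: powr_add)
  finally show ?thesis by (simp add: m_def)
qed

end

locale L_log_L_on_sets = Lp_operator +
  fixes r c C :: real
  assumes r: "0 < r" and c: "0 < c" "c < 1" and C: "0 < C"
    and on_sets: "E \<in> sets M \<Longrightarrow> 0 < measure M E \<Longrightarrow> measure M E \<le> c \<Longrightarrow>
      (LINT x|M. cmod (T (indicator E) x)) \<le> C * (measure M E * ln (1 / measure M E) powr r)"
begin

text \<open>
  The bound on sets is prepared for summation over the superlevel sets \<open>{F \<ge> j}\<close>. If \<open>|E| \<le> j powr (- 2)\<close>, the
  logarithm costs only a small power of \<open>|E|\<close>, and what remains is summable in \<open>j\<close>. Otherwise
  \<open>ln (1 / |E|)\<close> is at most \<open>2 * ln j\<close>, which on the superlevel set is controlled by \<open>ln F\<close>.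
  Sets with \<open>|E| > c\<close> are covered by the \<open>p0\<close> bound.
\<close>
lemma indicator_bound:
  obtains B where "0 < B" "\<And>E j. E \<in> sets M \<Longrightarrow> 1 \<le> (j::nat) \<Longrightarrow>
    (LINT x|M. cmod (T (indicator E) x))
      \<le> B * (real j powr (- 3 / 2) + measure M E * (1 + ln (real j)) powr r)"
proof -
  define m where "m = measure M (space M)"
  have m: "m > 0" using M_pos by (simp add: m_def)
  define B where "B = C * 4 powr r * r powr r + C * 2 powr r + K * m / c"
  have Bs: "0 \<le> C * 4 powr r * r powr r" "0 < C * 2 powr r" "0 < K * m / c"
    using C K_ge_1 m c by auto
  then have B: "B > 0" by (simp add: B_def)
  have "(LINT x|M. cmod (T (indicator E) x))
      \<le> B * (real j powr (- 3 / 2) + measure M E * (1 + ln (real j)) powr r)"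
    if E: "E \<in> sets M" and j: "1 \<le> j" for E and j :: nat
  proof -
    define x where "x = measure M E"
    define w where "w = (1 + ln (real j)) powr r"
    have w: "1 \<le> w" unfolding w_def using j r by (intro ge_one_powr_ge_zero) auto
    have x0: "0 \<le> x" by (simp add: x_def)
    have ind: "indicator E \<in> borel_measurable M" "\<And>x. cmod (indicator E x) \<le> 1"
      using E by (auto simp: indicator_def)
    consider "x = 0" | "x > c" | "0 < x" "x \<le> c" "x \<le> real j powr (-2)" | "0 < x" "x \<le> c" "real j powr (-2) < x"
      using x0 by linarith
    then have "(LINT x|M. cmod (T (indicator E) x)) \<le> B * real j powr (- 3 / 2) \<or>
        (LINT x|M. cmod (T (indicator E) x)) \<le> B * (x * w)"
    proof cases
      case 1
      then have "AE y in M. y \<notin> E"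
        using E by (intro AE_not_in null_setsI) (auto simp: x_def emeasure_eq_measure)
      then have "AE y in M. indicator E y = (0 :: complex)" by (auto elim: eventually_mono)
      then have "AE y in M. T (indicator E) y = T (\<lambda>x. 0) y"
        using bounded_in_Lp[OF ind] p0 by (intro T_cong Lp_zero) auto
      then have "AE y in M. cmod (T (indicator E) y) = 0" using T_zero by eventually_elim simp
      then have "(LINT x|M. cmod (T (indicator E) x)) = 0"
        by (rule integral_eq_zero_AE)
      then show ?thesis using B by simp
    next
      case 2
      have "(LINT x|M. cmod (T (indicator E) x)) \<le> K * m"
        using T_L1_bound_unit[OF ind] by (simp add: m_def)
      also have "\<dots> = (K * m / c) * (c * 1)" using c by simp
      also have "\<dots> \<le> B * (x * w)"
        using 2 w c Bs unfolding B_def by (intro mult_mono) auto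
      finally show ?thesis by simp
    next
      case 3
      have x1: "x < 1" using 3 c by simp
      have "(LINT x|M. cmod (T (indicator E) x)) \<le> C * (x * ln (1 / x) powr r)"
        using on_sets[OF E] 3 by (simp add: x_def)
      also have "ln (1 / x) powr r \<le> 4 powr r * r powr r * x powr (- 1 / 4)"
      proof -
        have "ln ((1 / x) powr (1 / 4)) powr r \<le> r powr r * (1 / x) powr (1 / 4)"
          using 3 x1 r by (intro ln_powr_bound2) (auto simp: gr_one_powr)
        moreover have "ln (1 / x) powr r = 4 powr r * ln ((1 / x) powr (1 / 4)) powr r"
          using 3 x1 by (simp add: ln_powr flip: powr_mult)
        moreover have "(1 / x) powr (1 / 4) = x powr (- 1 / 4)"
          using 3 by (simp add: powr_divide powr_minus_divide)
        ultimately show ?thesis by (simp add: mult.assoc mult_left_mono)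
      qed
      then have "C * (x * ln (1 / x) powr r) \<le> C * (x * (4 powr r * r powr r * x powr (- 1 / 4)))"
        using C x0 by (intro mult_left_mono) auto
      also have "\<dots> = (C * 4 powr r * r powr r) * x powr (3 / 4)"
      proof -
        have "x * x powr (- 1 / 4) = x powr (3 / 4)"
          using powr_add[of x 1 "- 1 / 4"] 3 by simp
        then show ?thesis by (simp add: mult.assoc mult.left_commute)
      qed
      also have "\<dots> \<le> B * (real j powr (-2)) powr (3 / 4)"
        using 3 Bs unfolding B_def by (intro mult_mono powr_mono2) auto
      finally show ?thesis by (simp add: powr_powr)
    next
      case 4
      have "ln (1 / x) \<le> ln (real j ^ 2)"
        using 4 j by (subst ln_le_cancel_iff) (auto simp: powr_minus powr_numeral field_simps)
      then have "ln (1 / x) \<le> 2 * (1 + ln (real j))" using j by (simp add: ln_realpow)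
      moreover have "0 \<le> ln (1 / x)" using 4 c by simp
      ultimately have "ln (1 / x) powr r \<le> (2 * (1 + ln (real j))) powr r"
        using r by (intro powr_mono2) auto
      also have "\<dots> = 2 powr r * w" unfolding w_def by (rule powr_mult)
      finally have "C * (x * ln (1 / x) powr r) \<le> C * (x * (2 powr r * w))"
        using C x0 by (intro mult_left_mono) auto
      also have "\<dots> = (C * 2 powr r) * (x * w)" by simp
      also have "\<dots> \<le> B * (x * w)"
        using Bs x0 w unfolding B_def by (intro mult_right_mono) auto
      finally have "C * (x * ln (1 / x) powr r) \<le> B * (x * w)" .
      moreover have "(LINT x|M. cmod (T (indicator E) x)) \<le> C * (x * ln (1 / x) powr r)"
        using on_sets[OF E] 4 by (simp add: x_def)
      ultimately show ?thesis by linarith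
    qed
    moreover have "B * real j powr (- 3 / 2) \<le> B * (real j powr (- 3 / 2) + x * w)"
      "B * (x * w) \<le> B * (real j powr (- 3 / 2) + x * w)"
      using B x0 w by (auto intro!: mult_left_mono)
    ultimately show ?thesis by (auto simp: x_def w_def)
  qed
  then show ?thesis using that B by blast
qed

text \<open>
  A nonnegative \<open>F\<close> is the sum of its fractional part, which is bounded by 1 and harmless by the \<open>p0\<close> bound,
  and of the indicators of \<open>{F \<ge> j}\<close> for \<open>j \<ge> 1\<close>.
\<close>
lemma L1_bound_nonneg:
  obtains B where "0 < B" "\<And>F L. F \<in> borel_measurable M \<Longrightarrow> (\<And>x. 0 \<le> F x \<and> F x \<le> L) \<Longrightarrow>
    (LINT x|M. cmod (T (\<lambda>x. complex_of_real (F x)) x)) \<le> B * (1 + (LINT x|M. LlogL r (F x)))"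
proof -
  obtain B where B: "0 < B" "\<And>E j. E \<in> sets M \<Longrightarrow> 1 \<le> (j::nat) \<Longrightarrow>
    (LINT x|M. cmod (T (indicator E) x))
      \<le> B * (real j powr (- 3 / 2) + measure M E * (1 + ln (real j)) powr r)"
    using indicator_bound by blast
  have sm: "summable (\<lambda>j. real j powr (- 3 / 2))" by (subst summable_real_powr_iff) simp
  define Z where "Z = (\<Sum>j. real j powr (- 3 / 2))"
  define m where "m = measure M (space M)"
  have m: "0 < m" using M_pos by (simp add: m_def)
  have Z: "Z \<ge> 0" unfolding Z_def by (intro suminf_nonneg sm) auto
  define D where "D = K * m + B * Z + B"
  have D: "D > 0" using m K_ge_1 B Z by (auto simp: D_def intro!: add_nonneg_pos)
  have "(LINT x|M. cmod (T (\<lambda>x. complex_of_real (F x)) x)) \<le> D * (1 + (LINT x|M. LlogL r (F x)))"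
    if Fm: "F \<in> borel_measurable M" and FL: "\<And>x. 0 \<le> F x \<and> F x \<le> L" for F :: "'a \<Rightarrow> real" and L
  proof -
    note [measurable] = Fm
    define J where "J = nat \<lfloor>L\<rfloor>"
    define E where "E j = {x. real j \<le> F x}" for j :: nat
    have E [measurable]: "E j \<in> sets M" for j
    proof -
      have "{x \<in> space M. real j \<le> F x} \<in> sets M" by measurable
      then show ?thesis by (simp add: E_def space_UNIV)
    qed
    have layers: "(\<Sum>j = 1..J. indicator (E j) x) = real_of_int \<lfloor>F x\<rfloor>" for x
    proof -
      have "(\<Sum>j = 1..J. indicator (E j) x) = (\<Sum>j = 1..J. if j \<in> {1..nat \<lfloor>F x\<rfloor>} then 1 else (0::real))"
      proof (intro sum.cong refl)
        fix j assume "j \<in> {1..J}"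
        moreover have "real j \<le> F x \<longleftrightarrow> j \<le> nat \<lfloor>F x\<rfloor>"
          using FL[of x] by (simp add: le_nat_iff le_floor_iff)
        ultimately show "indicator (E j) x = (if j \<in> {1..nat \<lfloor>F x\<rfloor>} then 1 else (0::real))"
          by (auto simp: E_def)
      qed
      also have "\<dots> = real (card ({1..J} \<inter> {1..nat \<lfloor>F x\<rfloor>}))"
        by (subst sum.inter_restrict[symmetric]) auto
      also have "{1..J} \<inter> {1..nat \<lfloor>F x\<rfloor>} = {1..nat \<lfloor>F x\<rfloor>}"
      proof -
        have "nat \<lfloor>F x\<rfloor> \<le> J" unfolding J_def using FL[of x] by (intro nat_mono floor_mono) simp
        then show ?thesis by auto
      qed
      finally show ?thesis using FL[of x] by simp
    qed
    define f where "f j = (if j = 0 then (\<lambda>x. complex_of_real (F x - of_int \<lfloor>F x\<rfloor>)) else indicator (E j))" for j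
    have f: "f j \<in> borel_measurable M" "cmod (f j x) \<le> 1" for j x
    proof -
      show "f j \<in> borel_measurable M" unfolding f_def by (cases "j = 0") (simp_all, measurable)
      show "cmod (f j x) \<le> 1" unfolding f_def norm_of_real
        by (cases "j = 0") (auto simp: indicator_def abs_le_iff simp del: of_real_diff, linarith+)
    qed
    have f0: "f j \<in> Lp M p0" for j using bounded_in_Lp[OF f] p0 by simp
    have F_eq: "complex_of_real (F x) = (\<Sum>j\<in>{0..J}. 1 * f j x)" for x
    proof -
      have "(\<Sum>j\<in>{0..J}. 1 * f j x) = f 0 x + (\<Sum>j = 1..J. f j x)"
        by (simp add: sum.atLeast_Suc_atMost)
      also have "(\<Sum>j = 1..J. f j x) = complex_of_real (\<Sum>j = 1..J. indicator (E j) x)"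
        unfolding of_real_sum by (intro sum.cong) (auto simp: f_def indicator_def)
      also have "\<dots> = complex_of_real (of_int \<lfloor>F x\<rfloor>)" by (simp only: layers)
      finally show ?thesis by (simp add: f_def)
    qed
    have "AE x in M. T (\<lambda>x. complex_of_real (F x)) x = (\<Sum>j\<in>{0..J}. 1 * T (f j) x)"
      unfolding F_eq by (intro T_lincomb f0) auto
    then have "AE x in M. cmod (T (\<lambda>x. complex_of_real (F x)) x) \<le> (\<Sum>j\<in>{0..J}. cmod (T (f j) x))"
    proof eventually_elim
      case (elim x)
      then show ?case by (simp add: norm_sum)
    qed
    moreover have "(\<lambda>x. complex_of_real (F x)) \<in> Lp M p0"
      using FL p0 by (intro bounded_in_Lp[of _ L]) (auto simp: abs_of_nonneg)
    ultimately have "(LINT x|M. cmod (T (\<lambda>x. complex_of_real (F x)) x))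
        \<le> (LINT x|M. (\<Sum>j\<in>{0..J}. cmod (T (f j) x)))"
      by (intro integral_mono_AE) (auto intro!: T_integrable f0)
    also have "\<dots> = (\<Sum>j\<in>{0..J}. LINT x|M. cmod (T (f j) x))"
      by (intro Bochner_Integration.integral_sum) (auto intro!: T_integrable f0)
    also have "\<dots> = (LINT x|M. cmod (T (f 0) x)) + (\<Sum>j = 1..J. LINT x|M. cmod (T (f j) x))"
      by (simp add: sum.atLeast_Suc_atMost)
    also have "\<dots> \<le> K * m + (\<Sum>j = 1..J. B * (real j powr (- 3 / 2) + measure M (E j) * (1 + ln (real j)) powr r))"
    proof (intro add_mono sum_mono)
      show "(LINT x|M. cmod (T (f 0) x)) \<le> K * m"
        unfolding m_def by (intro T_L1_bound_unit f)
      fix j assume "j \<in> {1..J}"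
      then show "(LINT x|M. cmod (T (f j) x)) \<le> B * (real j powr (- 3 / 2) + measure M (E j) * (1 + ln (real j)) powr r)"
        using B(2)[OF E, of j j] by (simp add: f_def)
    qed
    also have "\<dots> = K * m + B * (\<Sum>j = 1..J. real j powr (- 3 / 2))
        + B * (\<Sum>j = 1..J. measure M (E j) * (1 + ln (real j)) powr r)"
      by (simp add: sum.distrib sum_distrib_left distrib_left)
    also have "(\<Sum>j = 1..J. real j powr (- 3 / 2)) \<le> Z"
      unfolding Z_def by (intro sum_le_suminf sm) auto
    also have "(\<Sum>j = 1..J. measure M (E j) * (1 + ln (real j)) powr r) \<le> (LINT x|M. LlogL r (F x))"
    proof -
      have "(\<Sum>j = 1..J. measure M (E j) * (1 + ln (real j)) powr r)
          = (LINT x|M. (\<Sum>j = 1..J. indicator (E j) x * (1 + ln (real j)) powr r))"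
        by (subst Bochner_Integration.integral_sum)
           (auto simp: emeasure_eq_measure space_UNIV integrable_real_indicator)
      also have "\<dots> \<le> (LINT x|M. LlogL r (F x))"
      proof (rule integral_mono)
        show "integrable M (\<lambda>x. LlogL r (F x))"
          using FL r LlogL_mono[of r] LlogL_nonneg[of _ r]
          by (intro integrable_const_bound[of _ "LlogL r L"]) (auto simp: abs_of_nonneg)
        fix x
        have "(\<Sum>j = 1..J. indicator (E j) x * (1 + ln (real j)) powr r)
            \<le> (\<Sum>j = 1..J. indicator (E j) x * (1 + ln (1 + F x)) powr r)"
        proof (rule sum_mono)
          fix j assume j: "j \<in> {1..J}"
          have "(1 + ln (real j)) powr r \<le> (1 + ln (1 + F x)) powr r" if "x \<in> E j"
            using that j r by (intro powr_mono2) (auto simp: E_def)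
          then show "indicator (E j) x * (1 + ln (real j)) powr r \<le> indicator (E j) x * (1 + ln (1 + F x)) powr r"
            by (auto simp: indicator_def)
        qed
        also have "\<dots> = real_of_int \<lfloor>F x\<rfloor> * (1 + ln (1 + F x)) powr r"
          by (simp only: layers flip: sum_distrib_right)
        also have "\<dots> \<le> LlogL r (F x)"
          unfolding LlogL_def by (intro mult_right_mono) auto
        finally show "(\<Sum>j = 1..J. indicator (E j) x * (1 + ln (real j)) powr r) \<le> LlogL r (F x)" .
      qed (intro Bochner_Integration.integrable_sum integrable_mult_left,
           auto simp: emeasure_eq_measure integrable_real_indicator)
      finally show ?thesis .
    qed
    finally have "(LINT x|M. cmod (T (\<lambda>x. complex_of_real (F x)) x))
        \<le> K * m + B * Z + B * (LINT x|M. LlogL r (F x))"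
      using B(1) by simp
    moreover have "0 \<le> (LINT x|M. LlogL r (F x))"
      using FL by (intro integral_nonneg_AE AE_I2 LlogL_nonneg) auto
    moreover have "B \<le> D" "K * m + B * Z \<le> D"
      using m K_ge_1 B(1) Z by (auto simp: D_def)
    ultimately have "(LINT x|M. cmod (T (\<lambda>x. complex_of_real (F x)) x))
        \<le> D + D * (LINT x|M. LlogL r (F x))"
      using mult_right_mono[of B D "LINT x|M. LlogL r (F x)"] by linarith
    then show ?thesis by (simp add: distrib_left)
  qed
  then show ?thesis using that D by blast
qed

lemma L_log_L_bound:
  obtains B where "0 < B" "\<And>F L. F \<in> borel_measurable M \<Longrightarrow> (\<And>x. cmod (F x) \<le> L) \<Longrightarrow>
    (LINT x|M. cmod (T F x)) \<le> B * (1 + (LINT x|M. LlogL r (cmod (F x))))"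
proof -
  obtain B where B: "0 < B" "\<And>F L. F \<in> borel_measurable M \<Longrightarrow> (\<And>x. 0 \<le> F x \<and> F x \<le> L) \<Longrightarrow>
    (LINT x|M. cmod (T (\<lambda>x. complex_of_real (F x)) x)) \<le> B * (1 + (LINT x|M. LlogL r (F x)))"
    using L1_bound_nonneg by blast
  have "(LINT x|M. cmod (T F x)) \<le> (4 * B) * (1 + (LINT x|M. LlogL r (cmod (F x))))"
    if Fm: "F \<in> borel_measurable M" and FL: "\<And>x. cmod (F x) \<le> L" for F :: "'a \<Rightarrow> complex" and L
  proof -
    note [measurable] = Fm
    define P where "P k x = max 0 (Re ((- \<i>) ^ k * F x))" for k :: nat and x
    have Pm [measurable]: "P k \<in> borel_measurable M" for k unfolding P_def by measurable
    have P_le: "0 \<le> P k x \<and> P k x \<le> cmod (F x)" for k x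
      using complex_Re_le_cmod[of "(- \<i>) ^ k * F x"] by (simp add: P_def norm_mult norm_power)
    have P0: "(\<lambda>x. complex_of_real (P k x)) \<in> Lp M p0" for k
      using P_le FL p0 by (intro bounded_in_Lp[of _ L]) (auto intro: order_trans)
    \<comment> \<open>The four nonnegative parts of a complex function: \<open>P k\<close> is the positive part of the component of \<open>F\<close> in
      the direction \<open>\<i> ^ k\<close>.\<close>
    have F_eq: "F = (\<lambda>x. \<Sum>k\<in>{..<4}. \<i> ^ k * complex_of_real (P k x))"
    proof
      fix x
      show "F x = (\<Sum>k\<in>{..<4}. \<i> ^ k * complex_of_real (P k x))"
        by (simp add: P_def eval_nat_numeral complex_eq_iff max_def)
    qed
    have "AE x in M. T F x = (\<Sum>k\<in>{..<4}. \<i> ^ k * T (\<lambda>x. complex_of_real (P k x)) x)"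
      by (subst F_eq, intro T_lincomb P0) auto
    then have "AE x in M. cmod (T F x) \<le> (\<Sum>k\<in>{..<4}. cmod (T (\<lambda>x. complex_of_real (P k x)) x))"
    proof eventually_elim
      case (elim x)
      have "cmod (T F x) \<le> (\<Sum>k\<in>{..<4}. cmod (\<i> ^ k * T (\<lambda>x. complex_of_real (P k x)) x))"
        unfolding elim by (rule norm_sum)
      then show ?case by (simp add: norm_mult norm_power)
    qed
    moreover have "F \<in> Lp M p0" using bounded_in_Lp[OF Fm FL] p0 by simp
    ultimately have "(LINT x|M. cmod (T F x)) \<le> (LINT x|M. (\<Sum>k\<in>{..<4}. cmod (T (\<lambda>x. complex_of_real (P k x)) x)))"
      by (intro integral_mono_AE) (auto intro!: T_integrable P0)
    also have "\<dots> = (\<Sum>k\<in>{..<4}. LINT x|M. cmod (T (\<lambda>x. complex_of_real (P k x)) x))"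
      by (intro Bochner_Integration.integral_sum) (auto intro!: T_integrable P0)
    also have "\<dots> \<le> (\<Sum>k\<in>{..<4::nat}. B * (1 + (LINT x|M. LlogL r (cmod (F x)))))"
    proof (rule sum_mono)
      fix k :: nat
      have "(LINT x|M. cmod (T (\<lambda>x. complex_of_real (P k x)) x)) \<le> B * (1 + (LINT x|M. LlogL r (P k x)))"
        using P_le FL by (intro B(2)[OF Pm, where L = L]) (meson order_trans)
      also have "\<dots> \<le> B * (1 + (LINT x|M. LlogL r (cmod (F x))))"
      proof (intro mult_left_mono add_left_mono integral_mono)
        have L: "LlogL r (cmod (F x)) \<le> LlogL r L" "LlogL r (P k x) \<le> LlogL r L" for x
          using P_le[of k x] FL[of x] r by (auto intro!: LlogL_mono)
        have N: "0 \<le> LlogL r (cmod (F x))" "0 \<le> LlogL r (P k x)" for x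
          using P_le[of k x] by (auto intro!: LlogL_nonneg)
        show "integrable M (\<lambda>x. LlogL r (cmod (F x)))" "integrable M (\<lambda>x. LlogL r (P k x))"
          using L N by (auto intro!: integrable_const_bound[of _ "LlogL r L"] simp: abs_of_nonneg)
        show "LlogL r (P k x) \<le> LlogL r (cmod (F x))" for x
          using P_le[of k x] r by (intro LlogL_mono) auto
      qed (use B(1) in auto)
      finally show "(LINT x|M. cmod (T (\<lambda>x. complex_of_real (P k x)) x)) \<le> B * (1 + (LINT x|M. LlogL r (cmod (F x))))" .
    qed
    finally show ?thesis by simp
  qed
  then show ?thesis using that[of "4 * B"] B(1) by auto
qed

end

section \<open>Sums over words of translates\<close>

text \<open>
  Subsets without \<open>i\<close> are paired with the same subsets enlarged by \<open>i\<close>; the two sums of a pair differ by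
  \<open>z i\<close>, so one of them has norm at least \<open>norm (z i) / 2\<close>. The random subset plays the role of random
  signs: it prevents cancellation between the summands.
\<close>
lemma norm_le_subset_sums:
  fixes z :: "'i \<Rightarrow> 'b::real_normed_vector"
  assumes "finite J" "i \<in> J"
  shows "2 ^ card J * norm (z i) \<le> 2 * (\<Sum>S\<in>Pow J. norm (\<Sum>k\<in>S. z k))"
proof -
  define I where "I = J - {i}"
  have I: "finite I" "i \<notin> I" "J = insert i I" using assms by (auto simp: I_def)
  have "(\<Sum>S\<in>Pow J. norm (\<Sum>k\<in>S. z k))
      = (\<Sum>S\<in>Pow I. norm (\<Sum>k\<in>S. z k)) + (\<Sum>S\<in>insert i ` Pow I. norm (\<Sum>k\<in>S. z k))"
    unfolding I(3) Pow_insert using I(1,2) by (intro sum.union_disjoint) auto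
  also have "(\<Sum>S\<in>insert i ` Pow I. norm (\<Sum>k\<in>S. z k)) = (\<Sum>S\<in>Pow I. norm (\<Sum>k\<in>insert i S. z k))"
    using I(2) by (subst sum.reindex) (auto simp: inj_on_def)
  also have "\<dots> = (\<Sum>S\<in>Pow I. norm (z i + (\<Sum>k\<in>S. z k)))"
  proof (intro sum.cong refl)
    fix S assume "S \<in> Pow I"
    then have "finite S" "i \<notin> S" using I(1,2) finite_subset by auto
    then show "norm (\<Sum>k\<in>insert i S. z k) = norm (z i + (\<Sum>k\<in>S. z k))" by simp
  qed
  finally have "(\<Sum>S\<in>Pow J. norm (\<Sum>k\<in>S. z k))
      = (\<Sum>S\<in>Pow I. norm (\<Sum>k\<in>S. z k) + norm (z i + (\<Sum>k\<in>S. z k)))"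
    by (simp add: sum.distrib)
  also have "\<dots> \<ge> (\<Sum>S\<in>Pow I. norm (z i))"
  proof (rule sum_mono)
    fix S
    show "norm (z i) \<le> norm (\<Sum>k\<in>S. z k) + norm (z i + (\<Sum>k\<in>S. z k))"
      using norm_triangle_ineq4[of "z i + (\<Sum>k\<in>S. z k)" "\<Sum>k\<in>S. z k"] by simp
  qed
  also have "(\<Sum>S\<in>Pow I. norm (z i)) = 2 ^ card I * norm (z i)"
    using I(1) by (simp add: card_Pow)
  finally show ?thesis using I by simp
qed

text \<open>
  The weight of a sum is bounded by the weight of one term plus a linear function of the other. The
  linear growth in \<open>t\<close> is wasteful, but it makes the mixed terms in the next lemma products of two
  independent variables.
\<close>
lemma log_weight_add:
  fixes r s t :: real
  assumes r: "0 < r" and s: "0 \<le> s" and t: "0 \<le> t"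
  shows "(1 + ln (1 + (s + t))) powr r
    \<le> 2 powr r * (1 + r powr r) * ((1 + ln (1 + s)) powr r + t)"
proof -
  define a where "a = (1 + ln (1 + s)) powr r"
  have a: "1 \<le> a" unfolding a_def using r s by (intro log_weight_ge_1) auto
  have lnt: "ln (1 + t) powr r \<le> r powr r * (1 + t)"
    using ln_powr_bound2[of "1 + t" r] r t by (cases "t = 0") auto
  have "ln (1 + (s + t)) \<le> ln ((1 + s) * (1 + t))"
    using s t by (subst ln_le_cancel_iff) (auto simp: algebra_simps add_pos_nonneg)
  also have "\<dots> = ln (1 + s) + ln (1 + t)" using s t by (simp add: ln_mult)
  finally have "1 + ln (1 + (s + t)) \<le> (1 + ln (1 + s)) + ln (1 + t)" by simp
  also have "\<dots> \<le> 2 * max (1 + ln (1 + s)) (ln (1 + t))" unfolding max_def by auto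
  finally have "(1 + ln (1 + (s + t))) powr r \<le> (2 * max (1 + ln (1 + s)) (ln (1 + t))) powr r"
    using r s t by (intro powr_mono2) auto
  also have "\<dots> \<le> 2 powr r * (a + ln (1 + t) powr r)"
    using s t unfolding powr_mult a_def by (intro mult_left_mono) (auto simp: max_def)
  also have "\<dots> \<le> 2 powr r * (a + r powr r * (1 + t))"
    using lnt by (intro mult_left_mono add_left_mono) auto
  also have "\<dots> \<le> 2 powr r * ((1 + r powr r) * (a + t))"
  proof (intro mult_left_mono)
    have "r powr r * 1 \<le> r powr r * a" using a by (intro mult_left_mono) auto
    then show "a + r powr r * (1 + t) \<le> (1 + r powr r) * (a + t)"
      using t by (simp add: algebra_simps)
  qed auto
  finally show ?thesis by (simp add: a_def mult.assoc)
qed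

lemma LlogL_sum_le:
  fixes X :: "'i \<Rightarrow> real"
  assumes r: "0 < r" and "finite I" and X: "\<And>i. i \<in> I \<Longrightarrow> 0 \<le> X i"
  shows "LlogL r (\<Sum>i\<in>I. X i) \<le> 2 powr r * (1 + r powr r) *
    ((\<Sum>i\<in>I. LlogL r (X i)) + (\<Sum>i\<in>I. \<Sum>j\<in>I - {i}. X i * X j))"
proof -
  define D where "D = 2 powr r * (1 + r powr r)"
  have "LlogL r (\<Sum>i\<in>I. X i) = (\<Sum>i\<in>I. X i * (1 + ln (1 + (\<Sum>i\<in>I. X i))) powr r)"
    by (simp add: LlogL_def sum_distrib_right)
  also have "\<dots> \<le> (\<Sum>i\<in>I. D * (LlogL r (X i) + (\<Sum>j\<in>I - {i}. X i * X j)))"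
  proof (rule sum_mono)
    fix i assume i: "i \<in> I"
    have "(\<Sum>i\<in>I. X i) = X i + (\<Sum>j\<in>I - {i}. X j)"
      using assms(2) i by (rule sum.remove)
    then have "(1 + ln (1 + (\<Sum>i\<in>I. X i))) powr r
        \<le> D * ((1 + ln (1 + X i)) powr r + (\<Sum>j\<in>I - {i}. X j))"
      unfolding D_def by (simp only:) (intro log_weight_add r X i sum_nonneg, auto)
    then have "X i * (1 + ln (1 + (\<Sum>i\<in>I. X i))) powr r
        \<le> X i * (D * ((1 + ln (1 + X i)) powr r + (\<Sum>j\<in>I - {i}. X j)))"
      using X[OF i] by (intro mult_left_mono)
    also have "\<dots> = D * (LlogL r (X i) + (\<Sum>j\<in>I - {i}. X i * X j))"
      by (simp add: LlogL_def sum_distrib_left algebra_simps)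
    finally show "X i * (1 + ln (1 + (\<Sum>i\<in>I. X i))) powr r
        \<le> D * (LlogL r (X i) + (\<Sum>j\<in>I - {i}. X i * X j))" .
  qed
  finally show ?thesis by (simp add: D_def sum.distrib sum_distrib_left distrib_left)
qed

text \<open>
  Here \<open>d\<close> bounds the maximum of the \<open>y i\<close>. The first product is 1 exactly if no \<open>y i\<close> exceeds 1. In the
  second estimate, the term of \<open>i\<close> is nonzero only if \<open>y i\<close> is the one value above 1, so at most one term
  counts. In both, every factor depends on a single index, which makes the expectation over independent
  translates computable.
\<close>
lemma large_values_le_max:
  fixes y :: "'i \<Rightarrow> real"
  assumes I: "finite I" "I \<noteq> {}" and y: "\<And>i. i \<in> I \<Longrightarrow> 0 \<le> y i" "\<And>i. i \<in> I \<Longrightarrow> y i \<le> d"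
  shows "1 - (\<Prod>i\<in>I. if y i \<le> 1 then 1 else 0) \<le> d"
    and "(\<Sum>i\<in>I. \<Prod>j\<in>I. if j = i then (if y j \<le> 1 then 0 else y j) else (if y j \<le> 1 then 1 else 0)) \<le> d"
proof -
  have d: "0 \<le> d" using I y by (metis all_not_in_conv order_trans)
  show "1 - (\<Prod>i\<in>I. if y i \<le> 1 then 1 else 0) \<le> d"
  proof (cases "\<forall>i\<in>I. y i \<le> 1")
    case True
    then have "(\<Prod>i\<in>I. if y i \<le> 1 then 1 else 0) = (1::real)" by (intro prod.neutral) auto
    then show ?thesis using d by linarith
  next
    case False
    then obtain i where i: "i \<in> I" "y i > 1" by force
    have "(\<Prod>i\<in>I. if y i \<le> 1 then 1 else 0) = (0::real)"
      using I(1) i by (intro prod_zero bexI[of _ i]) auto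
    then show ?thesis using i(2) y(2)[OF i(1)] by linarith
  qed
  let ?t = "\<lambda>i. \<Prod>j\<in>I. if j = i then (if y j \<le> 1 then 0 else y j) else (if y j \<le> 1 then 1 else 0)"
  have zero: "?t i = 0" if "i \<in> I" "y i \<le> 1 \<or> (\<exists>k\<in>I - {i}. y k > 1)" for i
  proof -
    have "\<exists>k\<in>I. if k = i then y k \<le> 1 else y k > 1"
      using that(2)
    proof
      assume "\<exists>k\<in>I - {i}. y k > 1"
      then obtain k where "k \<in> I - {i}" "y k > 1" ..
      then show ?thesis by (intro bexI[of _ k]) auto
    qed (use that(1) in \<open>auto intro!: bexI[of _ i]\<close>)
    then obtain k where k: "k \<in> I" "if k = i then y k \<le> 1 else y k > 1" ..
    then show ?thesis using I(1) by (intro prod_zero bexI[of _ k]) (auto split: if_splits)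
  qed
  show "(\<Sum>i\<in>I. ?t i) \<le> d"
  proof (cases "\<exists>i\<in>I. ?t i \<noteq> 0")
    case False
    then have "(\<Sum>i\<in>I. ?t i) = 0" by (intro sum.neutral) blast
    then show ?thesis using d by linarith
  next
    case True
    then obtain i where i: "i \<in> I" "?t i \<noteq> 0" by blast
    have others: "y k \<le> 1" if "k \<in> I - {i}" for k
      using zero[OF i(1)] i(2) that not_le by blast
    have "(\<Sum>k\<in>I. ?t k) = ?t i"
    proof (subst sum.remove[OF I(1) i(1)])
      have "(\<Sum>k\<in>I - {i}. ?t k) = 0" using others by (intro sum.neutral ballI zero) auto
      then show "?t i + (\<Sum>k\<in>I - {i}. ?t k) = ?t i" by linarith
    qed
    also have "\<dots> = (if y i \<le> 1 then 0 else y i) * (\<Prod>j\<in>I - {i}. if y j \<le> 1 then 1 else 0)"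
      using I(1) i(1) by (subst prod.remove[of _ i]) (auto intro!: prod.cong)
    also have "(\<Prod>j\<in>I - {i}. if y j \<le> 1 then 1 else (0::real)) = 1"
      using others by (intro prod.neutral) auto
    finally show ?thesis using y(2)[OF i(1)] d by auto
  qed
qed

context compact_group_action begin

text \<open>
  A word of length \<open>N\<close> in the list \<open>as\<close>, drawn uniformly, is a choice of \<open>N\<close> independent random
  translates; this is the product rule for expectations.
\<close>
lemma sum_over_words:
  assumes "as \<noteq> []"
  shows "(\<Sum>w\<in>PiE {..<N} (\<lambda>_. {..<length as}). \<Prod>i<N. h i (act (as ! w i) x))
    = real (length as) ^ N * (\<Prod>i<N. average as (h i) x)"
proof -
  have "(\<Sum>k<length as. h i (act (as ! k) x)) = real (length as) * average as (h i) x" for i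
    using assms by (simp add: average_def sum_list_sum_nth atLeast0LessThan)
  then have "real (length as) ^ N * (\<Prod>i<N. average as (h i) x)
      = (\<Prod>i<N. \<Sum>k<length as. h i (act (as ! k) x))"
    by (simp add: prod.distrib)
  also have "\<dots> = (\<Sum>w\<in>PiE {..<N} (\<lambda>_. {..<length as}). \<Prod>i<N. h i (act (as ! w i) x))"
    by (intro prod_sum_PiE) auto
  finally show ?thesis ..
qed

lemma sum_over_words_one_special:
  assumes "as \<noteq> []" "i < N"
  shows "(\<Sum>w\<in>PiE {..<N} (\<lambda>_. {..<length as}).
      \<Prod>j<N. if j = i then u (act (as ! w j) x) else v (act (as ! w j) x))
    = real (length as) ^ N * (average as u x * average as v x ^ (N - 1))"
proof -
  have "(\<Sum>w\<in>PiE {..<N} (\<lambda>_. {..<length as}).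
      \<Prod>j<N. if j = i then u (act (as ! w j) x) else v (act (as ! w j) x))
    = (\<Sum>w\<in>PiE {..<N} (\<lambda>_. {..<length as}). \<Prod>j<N. (if j = i then u else v) (act (as ! w j) x))"
    by (intro sum.cong prod.cong) auto
  also have "\<dots> = real (length as) ^ N * (\<Prod>j<N. average as (if j = i then u else v) x)"
    by (rule sum_over_words[OF assms(1)])
  also have "(\<Prod>j<N. average as (if j = i then u else v) x)
      = average as u x * (\<Prod>j\<in>{..<N} - {i}. average as v x)"
    using assms(2) by (subst prod.remove[of _ i]) (auto intro!: prod.cong)
  finally show ?thesis using assms(2) by simp
qed

lemma sum_over_words_one:
  assumes "as \<noteq> []" "i < N"
  shows "(\<Sum>w\<in>PiE {..<N} (\<lambda>_. {..<length as}). u (act (as ! w i) x))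
    = real (length as) ^ N * average as u x"
  using sum_over_words_one_special[OF assms, of u x "\<lambda>_. 1"] assms
  by (simp add: average_const prod.delta)

lemma sum_over_words_two:
  assumes "as \<noteq> []" "i < N" "j < N" "i \<noteq> j"
  shows "(\<Sum>w\<in>PiE {..<N} (\<lambda>_. {..<length as}). u (act (as ! w i) x) * u (act (as ! w j) x))
    = real (length as) ^ N * (average as u x * average as u x)"
proof -
  let ?h = "\<lambda>k. if k = i \<or> k = j then u else (\<lambda>_. 1)"
  have split: "(\<Prod>k<N. F k) = F i * F j" if "\<And>k. k < N \<Longrightarrow> k \<noteq> i \<Longrightarrow> k \<noteq> j \<Longrightarrow> F k = 1" for F :: "nat \<Rightarrow> real"
  proof -
    have "(\<Prod>k<N. F k) = (\<Prod>k\<in>{i, j}. F k)"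
      using assms that by (intro prod.mono_neutral_right) auto
    then show ?thesis using assms(4) by simp
  qed
  have "(\<Sum>w\<in>PiE {..<N} (\<lambda>_. {..<length as}). \<Prod>k<N. ?h k (act (as ! w k) x))
    = real (length as) ^ N * (\<Prod>k<N. average as (?h k) x)"
    by (rule sum_over_words[OF assms(1)])
  moreover have "(\<Prod>k<N. ?h k (act (as ! w k) x)) = u (act (as ! w i) x) * u (act (as ! w j) x)" for w
    by (subst split) auto
  moreover have "(\<Prod>k<N. average as (?h k) x) = average as u x * average as u x"
    by (subst split) (auto simp: average_const[OF assms(1)])
  ultimately show ?thesis by simp
qed

end


locale invariant_L_log_L_operator =
  compact_group_action M act + L_log_L_on_sets M T p0 K r c C
  for M :: "'x::{t2_space, second_countable_topology} measure"
    and act :: "'g::{topological_group_add, t2_space} \<Rightarrow> 'x \<Rightarrow> 'x"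
    and T p0 K r c C +
  assumes invariant_T: "translation_invariant act M p0 T"
begin

lemma T_translate:
  assumes "f \<in> Lp M p0"
  shows "AE x in M. T (\<lambda>x. f (act a x)) x = T f (act a x)"
  using invariant_T assms by (simp add: translation_invariant_def o_def)

lemma integrable_LlogL_bounded:
  assumes [measurable]: "h \<in> borel_measurable M" and h: "\<And>x. 0 \<le> h x \<and> h x \<le> L"
  shows "integrable M (\<lambda>x. LlogL r (h x))"
proof -
  have "norm (LlogL r (h x)) \<le> LlogL r L" for x
    using h[of x] r by (simp add: LlogL_nonneg LlogL_mono)
  then show ?thesis by (intro integrable_const_bound[of _ "LlogL r L"]) auto
qed

text \<open>
  By translation invariance \<open>T\<close> maps a sum of translates of \<open>f\<close> to the sum of the corresponding translates of
  \<open>T f\<close>. Each partial sum is dominated by the full sum of the moduli.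
\<close>
lemma L1_bound_translates:
  assumes bound: "\<And>F L. F \<in> borel_measurable M \<Longrightarrow> (\<And>x. cmod (F x) \<le> L) \<Longrightarrow>
      (LINT x|M. cmod (T F x)) \<le> B * (1 + (LINT x|M. LlogL r (cmod (F x))))"
    and B: "0 < B"
    and f [measurable]: "f \<in> borel_measurable M" and fL: "\<And>x. cmod (f x) \<le> L"
    and J: "finite J"
  shows "(LINT x|M. (\<Sum>S\<in>Pow J. cmod (\<Sum>k\<in>S. T f (act (b k) x))))
    \<le> 2 ^ card J * (B * (1 + (LINT x|M. LlogL r (\<Sum>k\<in>J. cmod (f (act (b k) x))))))"
proof -
  have f0: "f \<in> Lp M p0" using bounded_in_Lp[OF f fL] p0 by simp
  have act_f0: "(\<lambda>x. f (act a x)) \<in> Lp M p0" for a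
    using p0 by (intro bounded_in_Lp[where B = L] fL) auto
  have Tint: "integrable M (\<lambda>x. T f (act a x))" for a
    by (intro integrable_act T_integrable f0)
  have L: "0 \<le> L" using fL norm_ge_zero order_trans by blast
  have each: "(LINT x|M. cmod (\<Sum>k\<in>S. T f (act (b k) x)))
      \<le> B * (1 + (LINT x|M. LlogL r (\<Sum>k\<in>J. cmod (f (act (b k) x)))))" if S: "S \<in> Pow J" for S
  proof -
    have finS: "finite S" using S J finite_subset by auto
    define F where "F x = (\<Sum>k\<in>S. f (act (b k) x))" for x
    have Fm [measurable]: "F \<in> borel_measurable M" unfolding F_def by measurable
    have F_le: "cmod (F x) \<le> (\<Sum>k\<in>J. cmod (f (act (b k) x)))" for x
    proof -
      have "cmod (F x) \<le> (\<Sum>k\<in>S. cmod (f (act (b k) x)))" unfolding F_def by (rule norm_sum)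
      also have "\<dots> \<le> (\<Sum>k\<in>J. cmod (f (act (b k) x)))" using S J by (intro sum_mono2) auto
      finally show ?thesis .
    qed
    have J_le: "(\<Sum>k\<in>J. cmod (f (act (b k) x))) \<le> card J * L" for x
      using sum_bounded_above[of J "\<lambda>k. cmod (f (act (b k) x))" L] fL by simp
    have F_leL: "cmod (F x) \<le> card J * L" for x using F_le[of x] J_le[of x] by linarith
    have "AE x in M. \<forall>k\<in>S. T (\<lambda>x. f (act (b k) x)) x = T f (act (b k) x)"
      using finS T_translate[OF f0] by (intro AE_finite_allI) auto
    moreover have "AE x in M. T (\<lambda>x. \<Sum>k\<in>S. 1 * f (act (b k) x)) x = (\<Sum>k\<in>S. 1 * T (\<lambda>x. f (act (b k) x)) x)"
      using finS act_f0 by (rule T_lincomb)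
    ultimately have "AE x in M. cmod (\<Sum>k\<in>S. T f (act (b k) x)) = cmod (T F x)"
      by eventually_elim (simp add: F_def[abs_def])
    moreover have F0: "F \<in> Lp M p0"
      using p0 by (intro bounded_in_Lp[OF Fm F_leL]) simp
    moreover have [measurable]: "T f \<in> borel_measurable M" "T F \<in> borel_measurable M"
      by (intro T_measurable f0 F0)+
    ultimately have "(LINT x|M. cmod (\<Sum>k\<in>S. T f (act (b k) x))) = (LINT x|M. cmod (T F x))"
      by (intro integral_cong_AE) measurable
    also have "\<dots> \<le> B * (1 + (LINT x|M. LlogL r (cmod (F x))))"
      by (rule bound[OF Fm F_leL])
    also have "\<dots> \<le> B * (1 + (LINT x|M. LlogL r (\<Sum>k\<in>J. cmod (f (act (b k) x)))))"
    proof (intro mult_left_mono add_left_mono integral_mono)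
      show "integrable M (\<lambda>x. LlogL r (cmod (F x)))"
        using F_leL by (intro integrable_LlogL_bounded[where L = "card J * L"]) auto
      show "integrable M (\<lambda>x. LlogL r (\<Sum>k\<in>J. cmod (f (act (b k) x))))"
        using J_le by (intro integrable_LlogL_bounded[where L = "card J * L"]) (auto intro: sum_nonneg)
      show "LlogL r (cmod (F x)) \<le> LlogL r (\<Sum>k\<in>J. cmod (f (act (b k) x)))" for x
        using F_le r by (intro LlogL_mono) auto
    qed (use B in auto)
    finally show ?thesis .
  qed
  have "(LINT x|M. (\<Sum>S\<in>Pow J. cmod (\<Sum>k\<in>S. T f (act (b k) x))))
      = (\<Sum>S\<in>Pow J. LINT x|M. cmod (\<Sum>k\<in>S. T f (act (b k) x)))"
    by (intro Bochner_Integration.integral_sum integrable_norm Bochner_Integration.integrable_sum Tint)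
  also have "\<dots> \<le> (\<Sum>S\<in>Pow J. B * (1 + (LINT x|M. LlogL r (\<Sum>k\<in>J. cmod (f (act (b k) x))))))"
    by (intro sum_mono each)
  finally show ?thesis using J by (simp add: card_Pow)
qed

end

section \<open>The bound on the large values\<close>

context invariant_L_log_L_operator begin

lemma sum_over_words_LlogL:
  fixes X :: "'x \<Rightarrow> real"
  assumes as: "as \<noteq> []" and X: "\<And>x. 0 \<le> X x"
  shows "(\<Sum>w\<in>PiE {..<N} (\<lambda>_. {..<length as}). LlogL r (\<Sum>k<N. X (act (as ! w k) x)))
    \<le> real (length as) ^ N * (2 powr r * (1 + r powr r) *
        (real N * average as (\<lambda>x. LlogL r (X x)) x + real N * real (N - 1) * (average as X x * average as X x)))"
proof -
  define W where "W = PiE {..<N} (\<lambda>_. {..<length as})"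
  define D where "D = 2 powr r * (1 + r powr r)"
  have D: "0 \<le> D" by (simp add: D_def)
  have "(\<Sum>w\<in>W. LlogL r (\<Sum>k<N. X (act (as ! w k) x)))
      \<le> (\<Sum>w\<in>W. D * ((\<Sum>i<N. LlogL r (X (act (as ! w i) x)))
          + (\<Sum>i<N. \<Sum>j\<in>{..<N} - {i}. X (act (as ! w i) x) * X (act (as ! w j) x))))"
    unfolding D_def by (intro sum_mono LlogL_sum_le r X) auto
  also have "\<dots> = D * ((\<Sum>w\<in>W. \<Sum>i<N. LlogL r (X (act (as ! w i) x)))
          + (\<Sum>w\<in>W. \<Sum>i<N. \<Sum>j\<in>{..<N} - {i}. X (act (as ! w i) x) * X (act (as ! w j) x)))"
    by (simp add: sum_distrib_left sum.distrib distrib_left)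
  also have "(\<Sum>w\<in>W. \<Sum>i<N. LlogL r (X (act (as ! w i) x)))
      = (\<Sum>i<N. \<Sum>w\<in>W. LlogL r (X (act (as ! w i) x)))"
    by (rule sum.swap)
  also have "\<dots> = (\<Sum>i<N. real (length as) ^ N * average as (\<lambda>x. LlogL r (X x)) x)"
    unfolding W_def by (intro sum.cong refl sum_over_words_one[OF as]) auto
  also have "(\<Sum>w\<in>W. \<Sum>i<N. \<Sum>j\<in>{..<N} - {i}. X (act (as ! w i) x) * X (act (as ! w j) x))
      = (\<Sum>i<N. \<Sum>j\<in>{..<N} - {i}. \<Sum>w\<in>W. X (act (as ! w i) x) * X (act (as ! w j) x))"
    by (subst sum.swap, intro sum.cong refl sum.swap)
  also have "\<dots> = (\<Sum>i<N. \<Sum>j\<in>{..<N} - {i}. real (length as) ^ N * (average as X x * average as X x))"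
    unfolding W_def by (intro sum.cong refl sum_over_words_two[OF as]) auto
  also have "\<dots> = real N * (real (N - 1) * (real (length as) ^ N * (average as X x * average as X x)))"
  proof -
    have "(\<Sum>i<N. \<Sum>j\<in>{..<N} - {i}. y) = (\<Sum>i<N. real (N - 1) * y)" for y :: real
      by (intro sum.cong refl) simp
    then show ?thesis by (simp only: sum_constant card_lessThan)
  qed
  also have "(\<Sum>i<N. real (length as) ^ N * average as (\<lambda>x. LlogL r (X x)) x)
      = real N * (real (length as) ^ N * average as (\<lambda>x. LlogL r (X x)) x)" by simp
  finally have "(\<Sum>w\<in>W. LlogL r (\<Sum>k<N. X (act (as ! w k) x)))
      \<le> D * (real N * (real (length as) ^ N * average as (\<lambda>x. LlogL r (X x)) x)
        + real N * (real (N - 1) * (real (length as) ^ N * (average as X x * average as X x))))" .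
  also have "\<dots> = real (length as) ^ N * (D * (real N * average as (\<lambda>x. LlogL r (X x)) x
        + real N * real (N - 1) * (average as X x * average as X x)))"
    by (simp only: distrib_left mult.assoc mult.left_commute)
  finally show ?thesis by (simp only: W_def D_def)
qed

text \<open>
  The two conclusions bound the expectations of the two quantities in \<open>large_values_le_max\<close>, for the
  values of \<open>|T f| / \<mu>\<close> at \<open>N\<close> random translates of a point, by a bound
  \<open>Q\<close> for the expected integral of a majorant of their maximum.
  The averages of \<open>u\<close>, \<open>v\<close> and \<open>X\<close> stand for expectations and still depend on the point until they are
  replaced by means in the limit.
\<close>
lemma random_translates:
  assumes bound: "\<And>F L. F \<in> borel_measurable M \<Longrightarrow> (\<And>x. cmod (F x) \<le> L) \<Longrightarrow>
      (LINT x|M. cmod (T F x)) \<le> B * (1 + (LINT x|M. LlogL r (cmod (F x))))"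
    and B: "0 < B"
    and f [measurable]: "f \<in> borel_measurable M" and fL: "\<And>x. cmod (f x) \<le> L"
    and as: "as \<noteq> []" and N: "1 \<le> N" and \<mu>: "0 < \<mu>"
  defines "X \<equiv> \<lambda>x. cmod (f x)"
  defines "u \<equiv> \<lambda>x. if cmod (T f x) / \<mu> \<le> 1 then 0 else cmod (T f x) / \<mu>"
  defines "v \<equiv> \<lambda>x. if cmod (T f x) / \<mu> \<le> 1 then 1 else 0 :: real"
  defines "Q \<equiv> 2 * B * (1 + 2 powr r * (1 + r powr r) * (real N * (LINT x|M. LlogL r (X x))
      + real N * real (N - 1) * (LINT x|M. average as X x * average as X x))) / \<mu>"
  shows "(LINT x|M. 1 - average as v x * average as v x ^ (N - 1)) \<le> Q"
    and "real N * (LINT x|M. average as u x * average as v x ^ (N - 1)) \<le> Q"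
proof -
  define W where "W = PiE {..<N} (\<lambda>_. {..<length as})"
  define n where "n = real (length as) ^ N"
  define D where "D = 2 powr r * (1 + r powr r)"
  have n: "0 < n" using as by (simp add: n_def)
  have W: "finite W" "real (card W) = n"
    by (simp_all add: W_def n_def finite_PiE card_PiE)
  have f0: "f \<in> Lp M p0" using bounded_in_Lp[OF f fL] p0 by simp
  have Tm [measurable]: "T f \<in> borel_measurable M" by (rule T_measurable[OF f0])
  have Tint: "integrable M (\<lambda>x. T f (act a x))" for a by (intro integrable_act T_integrable f0)
  have Xm [measurable]: "X \<in> borel_measurable M" unfolding X_def by measurable
  have X0: "0 \<le> X x" and XL: "X x \<le> L" for x using fL by (auto simp: X_def)
  have Xi: "integrable M X" using X0 XL by (intro integrable_const_bound[of _ L]) auto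
  have ui: "integrable M u"
  proof (rule Bochner_Integration.integrable_bound)
    show "integrable M (\<lambda>x. cmod (T f x) / \<mu>)" using T_integrable[OF f0] by auto
    show "u \<in> borel_measurable M" unfolding u_def by measurable
  qed (use \<mu> in \<open>auto simp: u_def\<close>)
  have vi: "integrable M v"
  proof (rule integrable_const_bound[of _ 1])
    show "v \<in> borel_measurable M" unfolding v_def by measurable
  qed (auto simp: v_def)
  have v01: "0 \<le> average as v x \<and> average as v x \<le> 1" for x
    using average_mono[of "\<lambda>_. 0" v as x] average_mono[of v "\<lambda>_. 1" as x] average_const[OF as]
    by (auto simp: v_def)
  have u0: "0 \<le> average as u x" for x
    using average_mono[of "\<lambda>_. 0" u as x] average_const[OF as] \<mu> by (auto simp: u_def)
  \<comment> \<open>Twice the mean over all subsets dominates the maximum for the word \<open>w\<close>.\<close>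
  define d where "d w x = 2 / 2 ^ N / \<mu> * (\<Sum>S\<in>Pow {..<N}. cmod (\<Sum>k\<in>S. T f (act (as ! w k) x)))" for w x
  have d_int: "integrable M (d w)" for w
    unfolding d_def
    by (intro integrable_mult_right Bochner_Integration.integrable_sum integrable_norm Tint)
  have d_ge: "cmod (T f (act (as ! w i) x)) / \<mu> \<le> d w x" if "i < N" for w i x
    using norm_le_subset_sums[of "{..<N}" i "\<lambda>k. T f (act (as ! w k) x)"] that \<mu>
    by (simp add: d_def field_simps)
  have Li: "integrable M (\<lambda>x. LlogL r (X x))"
    using X0 XL by (intro integrable_LlogL_bounded[where L = L]) auto
  have Lw: "integrable M (\<lambda>x. LlogL r (\<Sum>k<N. X (act (as ! w k) x)))" for w
  proof (intro integrable_LlogL_bounded[where L = "N * L"] conjI)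
    show "(\<Sum>k<N. X (act (as ! w k) x)) \<le> N * L" for x
      using sum_bounded_above[of "{..<N}" "\<lambda>k. X (act (as ! w k) x)" L] XL by simp
  qed (auto intro: sum_nonneg X0)
  have PX_le: "0 \<le> average as X x" "average as X x \<le> L" for x
    using average_mono[of "\<lambda>_. 0" X as x] average_mono[of X "\<lambda>_. L" as x] average_const[OF as] X0 XL
    by auto
  have PXi: "integrable M (\<lambda>x. average as X x * average as X x)"
  proof (rule integrable_const_bound[of _ "L * L"])
    show "(\<lambda>x. average as X x * average as X x) \<in> borel_measurable M"
      using integrable_average[OF Xi, of as] by (intro borel_measurable_times) auto
    show "AE x in M. norm (average as X x * average as X x) \<le> L * L"
    proof (rule AE_I2)
      fix x show "norm (average as X x * average as X x) \<le> L * L"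
        using PX_le[of x] by (simp add: abs_mult mult_mono)
    qed
  qed
  have total: "(LINT x|M. (\<Sum>w\<in>W. d w x)) \<le> n * Q"
  proof -
    have "(LINT x|M. (\<Sum>w\<in>W. d w x)) = (\<Sum>w\<in>W. LINT x|M. d w x)"
      by (intro Bochner_Integration.integral_sum d_int)
    also have "\<dots> \<le> (\<Sum>w\<in>W. 2 / \<mu> * (B * (1 + (LINT x|M. LlogL r (\<Sum>k<N. X (act (as ! w k) x))))))"
    proof (rule sum_mono)
      fix w
      have "(LINT x|M. d w x) = 2 / 2 ^ N / \<mu> * (LINT x|M. (\<Sum>S\<in>Pow {..<N}. cmod (\<Sum>k\<in>S. T f (act (as ! w k) x))))"
        unfolding d_def by (rule integral_mult_right_zero)
      also have "\<dots> \<le> 2 / 2 ^ N / \<mu> * (2 ^ card {..<N} * (B * (1 + (LINT x|M. LlogL r (\<Sum>k<N. cmod (f (act (as ! w k) x)))))))"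
        using \<mu> by (intro mult_left_mono L1_bound_translates[OF bound B f fL]) auto
      also have "\<dots> = 2 / \<mu> * (B * (1 + (LINT x|M. LlogL r (\<Sum>k<N. X (act (as ! w k) x)))))"
        by (simp add: X_def)
      finally show "(LINT x|M. d w x) \<le> 2 / \<mu> * (B * (1 + (LINT x|M. LlogL r (\<Sum>k<N. X (act (as ! w k) x)))))" .
    qed
    also have "\<dots> = 2 / \<mu> * B * (n + (\<Sum>w\<in>W. LINT x|M. LlogL r (\<Sum>k<N. X (act (as ! w k) x))))"
      by (simp add: W sum.distrib sum_distrib_left distrib_left mult.assoc)
    also have "\<dots> \<le> 2 / \<mu> * B * (n + n * (D * (real N * (LINT x|M. LlogL r (X x))
          + real N * real (N - 1) * (LINT x|M. average as X x * average as X x))))"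
    proof (intro mult_left_mono add_left_mono)
      have "(\<Sum>w\<in>W. LINT x|M. LlogL r (\<Sum>k<N. X (act (as ! w k) x)))
          = (LINT x|M. (\<Sum>w\<in>W. LlogL r (\<Sum>k<N. X (act (as ! w k) x))))"
        by (intro Bochner_Integration.integral_sum[symmetric] Lw)
      also have "\<dots> \<le> (LINT x|M. n * (D * (real N * average as (\<lambda>x. LlogL r (X x)) x
            + real N * real (N - 1) * (average as X x * average as X x))))"
        unfolding W_def n_def D_def
        by (intro integral_mono sum_over_words_LlogL as X0 Bochner_Integration.integrable_sum Lw
            integrable_mult_right Bochner_Integration.integrable_add integrable_average Li PXi)
      also have "\<dots> = n * (D * (real N * (LINT x|M. LlogL r (X x))
            + real N * real (N - 1) * (LINT x|M. average as X x * average as X x)))"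
        using Li PXi as by (simp add: integrable_average integral_average)
      finally show "(\<Sum>w\<in>W. LINT x|M. LlogL r (\<Sum>k<N. X (act (as ! w k) x)))
          \<le> n * (D * (real N * (LINT x|M. LlogL r (X x))
            + real N * real (N - 1) * (LINT x|M. average as X x * average as X x)))" .
    qed (use \<mu> B in auto)
    also have "\<dots> = n * Q"
    proof -
      have "2 / \<mu> * B * (n + n * z) = n * (2 * B * (1 + z) / \<mu>)" for z
        by (simp add: distrib_left mult.commute mult.left_commute)
      then show ?thesis by (simp only: Q_def D_def)
    qed
    finally show ?thesis .
  qed
  have ne: "{..<N} \<noteq> {}"
  proof -
    have "0 \<in> {..<N}" using N by simp
    then show ?thesis by blast
  qed
  have dsum_int: "integrable M (\<lambda>x. \<Sum>w\<in>W. d w x)"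
    by (intro Bochner_Integration.integrable_sum d_int)
  have pointwise1: "n * (1 - average as v x * average as v x ^ (N - 1)) \<le> (\<Sum>w\<in>W. d w x)" for x
  proof -
    have "(\<Sum>w\<in>W. \<Prod>i<N. v (act (as ! w i) x)) = n * average as v x ^ N"
      unfolding W_def n_def using sum_over_words[OF as, of "\<lambda>_. v" x N] by simp
    then have "n * (1 - average as v x ^ N) = (\<Sum>w\<in>W. 1 - (\<Prod>i<N. v (act (as ! w i) x)))"
      by (simp add: W sum_subtractf right_diff_distrib)
    also have "\<dots> \<le> (\<Sum>w\<in>W. d w x)"
      unfolding v_def using ne \<mu> d_ge by (intro sum_mono large_values_le_max(1)) auto
    finally show ?thesis using N by (simp flip: power_Suc)
  qed
  have pointwise2: "n * (real N * (average as u x * average as v x ^ (N - 1))) \<le> (\<Sum>w\<in>W. d w x)" for x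
  proof -
    have "n * (real N * (average as u x * average as v x ^ (N - 1)))
        = (\<Sum>i<N. n * (average as u x * average as v x ^ (N - 1)))" by simp
    also have "\<dots> = (\<Sum>i<N. \<Sum>w\<in>W. \<Prod>j<N. if j = i then u (act (as ! w j) x) else v (act (as ! w j) x))"
      unfolding W_def n_def by (intro sum.cong refl sum_over_words_one_special[OF as, symmetric]) auto
    also have "\<dots> = (\<Sum>w\<in>W. \<Sum>i<N. \<Prod>j<N. if j = i then u (act (as ! w j) x) else v (act (as ! w j) x))"
      by (rule sum.swap)
    also have "\<dots> \<le> (\<Sum>w\<in>W. d w x)"
      unfolding u_def v_def using ne \<mu> d_ge by (intro sum_mono large_values_le_max(2)) auto
    finally show ?thesis .
  qed
  have vm [measurable]: "average as v \<in> borel_measurable M" and um [measurable]: "average as u \<in> borel_measurable M"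
    using integrable_average[OF vi, of as] integrable_average[OF ui, of as] by auto
  have "n * (LINT x|M. 1 - average as v x * average as v x ^ (N - 1))
      = (LINT x|M. n * (1 - average as v x * average as v x ^ (N - 1)))" by simp
  also have "\<dots> \<le> (LINT x|M. (\<Sum>w\<in>W. d w x))"
  proof (intro integral_mono dsum_int pointwise1 integrable_mult_right Bochner_Integration.integrable_diff)
    show "integrable M (\<lambda>x. average as v x * average as v x ^ (N - 1))"
      using v01 by (intro integrable_const_bound[of _ 1])
        (auto simp: abs_mult power_abs intro!: mult_le_one power_le_one)
  qed auto
  finally show "(LINT x|M. 1 - average as v x * average as v x ^ (N - 1)) \<le> Q"
    using total n by (meson mult_le_cancel_left_pos order_trans)
  have "n * (real N * (LINT x|M. average as u x * average as v x ^ (N - 1)))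
      = (LINT x|M. n * (real N * (average as u x * average as v x ^ (N - 1))))" by simp
  also have "\<dots> \<le> (LINT x|M. (\<Sum>w\<in>W. d w x))"
  proof (intro integral_mono dsum_int pointwise2 integrable_mult_right)
    show "integrable M (\<lambda>x. average as u x * average as v x ^ (N - 1))"
    proof (rule Bochner_Integration.integrable_bound[OF integrable_average[OF ui, of as]])
      show "AE x in M. norm (average as u x * average as v x ^ (N - 1)) \<le> norm (average as u x)"
      proof (rule AE_I2)
        fix x
        have "average as v x ^ (N - 1) \<le> 1" using v01[of x] by (intro power_le_one) auto
        then show "norm (average as u x * average as v x ^ (N - 1)) \<le> norm (average as u x)"
          using u0[of x] v01[of x] by (simp add: abs_mult mult_left_le)
      qed
    qed measurable
  qed
  finally show "real N * (LINT x|M. average as u x * average as v x ^ (N - 1)) \<le> Q"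
    using total n by (meson mult_le_cancel_left_pos order_trans)
qed

text \<open>
  Let the averages in the previous lemma converge to means. For the stated normalisation of \<open>f\<close> the right-hand
  side is at most half the total mass if \<open>R\<close> is large. The first estimate then says that the proportion \<open>mean v\<close> of
  points with \<open>|T f| \<le> R\<close> satisfies \<open>mean v ^ N \<ge> 1 / 2\<close>, and this absorbs the power of \<open>mean v\<close> in the second.
\<close>
lemma tail_bound_scaled:
  obtains R where "1 \<le> R" "\<And>f L N. f \<in> borel_measurable M \<Longrightarrow> (\<And>x. cmod (f x) \<le> L) \<Longrightarrow> 1 \<le> (N::nat) \<Longrightarrow>
    real N * (LINT x|M. LlogL r (cmod (f x))) \<le> 1 \<Longrightarrow>
    real N * (LINT x|M. (if cmod (T f x) / R \<le> 1 then 0 else cmod (T f x) / R)) \<le> measure M UNIV"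
proof -
  obtain B where B: "0 < B" "\<And>F L. F \<in> borel_measurable M \<Longrightarrow> (\<And>x. cmod (F x) \<le> L) \<Longrightarrow>
    (LINT x|M. cmod (T F x)) \<le> B * (1 + (LINT x|M. LlogL r (cmod (F x))))"
    using L_log_L_bound by blast
  define m where "m = measure M UNIV"
  have m: "0 < m" using measure_UNIV_pos by (simp add: m_def)
  define D where "D = 2 powr r * (1 + r powr r)"
  have D: "0 \<le> D" by (simp add: D_def)
  define R0 where "R0 = 2 * B * (1 + D * (1 + 1 / m))"
  have R0: "0 < R0" using B(1) D m by (auto simp: R0_def intro!: mult_pos_pos add_pos_nonneg)
  define R where "R = max 1 (2 * R0 / m)"
  have R: "1 \<le> R" "0 < R" "R0 / R \<le> m / 2"
    using m R0 by (auto simp: R_def field_simps max_def)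
  have "real N * (LINT x|M. (if cmod (T f x) / R \<le> 1 then 0 else cmod (T f x) / R)) \<le> m"
    if f [measurable]: "f \<in> borel_measurable M" and fL: "\<And>x. cmod (f x) \<le> L" and N: "1 \<le> N"
      and NA: "real N * (LINT x|M. LlogL r (cmod (f x))) \<le> 1" for f L and N :: nat
  proof -
    define X where "X = (\<lambda>x. cmod (f x))"
    define u where "u = (\<lambda>x. if cmod (T f x) / R \<le> 1 then 0 else cmod (T f x) / R)"
    define v where "v = (\<lambda>x. if cmod (T f x) / R \<le> 1 then 1 else 0 :: real)"
    have f0: "f \<in> Lp M p0" using bounded_in_Lp[OF f fL] p0 by simp
    have Tm [measurable]: "T f \<in> borel_measurable M" by (rule T_measurable[OF f0])
    have Xm [measurable]: "X \<in> borel_measurable M" unfolding X_def by measurable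
    have X0: "0 \<le> X x" and XL: "X x \<le> L" for x using fL by (auto simp: X_def)
    have L0: "0 \<le> L" using X0[of undefined] XL[of undefined] by linarith
    have Xi: "integrable M X" using X0 XL by (intro integrable_const_bound[of _ L]) auto
    have ui: "integrable M u"
    proof (rule Bochner_Integration.integrable_bound)
      show "integrable M (\<lambda>x. cmod (T f x) / R)" using T_integrable[OF f0] by auto
      show "u \<in> borel_measurable M" unfolding u_def by measurable
    qed (use R in \<open>auto simp: u_def\<close>)
    have vi: "integrable M v"
    proof (rule integrable_const_bound[of _ 1])
      show "v \<in> borel_measurable M" unfolding v_def by measurable
    qed (auto simp: v_def)
    obtain as :: "nat \<Rightarrow> 'g list" where as: "\<And>k. as k \<noteq> []"
      "\<And>h. h \<in> {X, u, v} \<Longrightarrow> (\<lambda>k. LINT x|M. \<bar>average (as k) h x - mean h\<bar>) \<longlonglongrightarrow> 0"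
      using averages_tendsto_means[of "{X, u, v}"] Xi ui vi by auto
    have mean_X: "0 \<le> mean X" "mean X \<le> L"
    proof -
      have "0 \<le> (LINT x|M. X x)" using X0 by simp
      then show "0 \<le> mean X" by (simp add: mean_def)
      have "(LINT x|M. X x) \<le> (LINT x|M. L)" using XL by (intro integral_mono Xi) auto
      then show "mean X \<le> L" using m by (simp add: mean_def m_def field_simps)
    qed
    have mean_v: "0 \<le> mean v" "mean v \<le> 1"
    proof -
      have "0 \<le> (LINT x|M. v x)" by (simp add: v_def)
      then show "0 \<le> mean v" by (simp add: mean_def)
      have "(LINT x|M. v x) \<le> (LINT x|M. 1)" by (intro integral_mono vi) (auto simp: v_def)
      then show "mean v \<le> 1" using m by (simp add: mean_def m_def field_simps)
    qed
    have bd_X: "\<bar>average (as k) X x\<bar> \<le> L" for k x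
      using average_mono[of "\<lambda>_. 0" X "as k" x] average_mono[of X "\<lambda>_. L" "as k" x]
        average_const[OF as(1)] X0 XL by (auto simp: abs_le_iff)
    have bd_v: "\<bar>average (as k) v x\<bar> \<le> 1" for k x
      using average_mono[of "\<lambda>_. 0" v "as k" x] average_mono[of v "\<lambda>_. 1" "as k" x]
        average_const[OF as(1)] by (auto simp: v_def abs_le_iff)
    define Q where "Q k = 2 * B * (1 + D * (real N * (LINT x|M. LlogL r (X x))
      + real N * real (N - 1) * (LINT x|M. average (as k) X x * average (as k) X x))) / R" for k
    have le_Q: "(LINT x|M. 1 - average (as k) v x * average (as k) v x ^ (N - 1)) \<le> Q k"
      "real N * (LINT x|M. average (as k) u x * average (as k) v x ^ (N - 1)) \<le> Q k" for k
      unfolding Q_def D_def X_def u_def v_def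
      by (rule random_translates[OF B(2) B(1) f fL as(1) N R(2)]; assumption)+
    have "(\<lambda>k. LINT x|M. average (as k) X x * average (as k) X x ^ 1) \<longlonglongrightarrow> m * (mean X * mean X ^ 1)"
      using tendsto_integral_mult_power(1)[of "\<lambda>k. average (as k) X" "\<lambda>k. average (as k) X" L "mean X" "mean X" 1]
        mean_X bd_X as Xi by (simp add: m_def integrable_average)
    then have limX: "(\<lambda>k. LINT x|M. average (as k) X x * average (as k) X x) \<longlonglongrightarrow> m * (mean X * mean X)"
      by simp
    define Q' where "Q' = 2 * B * (1 + D * (real N * (LINT x|M. LlogL r (X x))
      + real N * real (N - 1) * (m * (mean X * mean X)))) / R"
    have limQ: "Q \<longlonglongrightarrow> Q'"
      unfolding Q_def Q'_def by (intro tendsto_intros limX) (use R in auto)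
    have Q': "Q' \<le> m / 2"
    proof -
      have "(LINT x|M. X x) \<le> (LINT x|M. LlogL r (X x))"
        using X0 XL r by (intro integral_mono Xi integrable_LlogL_bounded[where L = L] LlogL_ge) auto
      then have "real N * (LINT x|M. X x) \<le> real N * (LINT x|M. LlogL r (X x))"
        by (intro mult_left_mono) auto
      then have NX: "real N * (LINT x|M. X x) \<le> 1" "0 \<le> real N * (LINT x|M. X x)"
        using NA X0 by (auto simp: X_def)
      have "real N * real (N - 1) * (m * (mean X * mean X)) \<le> real N * real N * (m * (mean X * mean X))"
        using m mean_X by (intro mult_right_mono mult_left_mono) auto
      also have "\<dots> = (real N * (LINT x|M. X x)) * (real N * (LINT x|M. X x)) / m"
        using m by (simp add: mean_def flip: m_def)
      also have "\<dots> \<le> 1 / m"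
        using mult_le_one[OF NX(1) NX(2) NX(1)] m by (intro divide_right_mono) auto
      finally have "1 + D * (real N * (LINT x|M. LlogL r (X x)) + real N * real (N - 1) * (m * (mean X * mean X)))
          \<le> 1 + D * (1 + 1 / m)"
        using NA D by (intro add_left_mono mult_left_mono add_mono) (auto simp: X_def)
      then have "Q' \<le> R0 / R"
        unfolding Q'_def R0_def using B(1) R by (intro divide_right_mono mult_left_mono) auto
      then show ?thesis using R(3) by linarith
    qed
    have lim1: "(\<lambda>k. LINT x|M. average (as k) v x * average (as k) v x ^ (N - 1)) \<longlonglongrightarrow> m * (mean v * mean v ^ (N - 1))"
      using tendsto_integral_mult_power(1)[of "\<lambda>k. average (as k) v" "\<lambda>k. average (as k) v" 1 "mean v" "mean v" "N - 1"]
        mean_v bd_v as vi by (simp add: m_def integrable_average)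
    have int1: "integrable M (\<lambda>x. average (as k) v x * average (as k) v x ^ (N - 1))" for k
    proof (rule integrable_const_bound[of _ 1])
      show "(\<lambda>x. average (as k) v x * average (as k) v x ^ (N - 1)) \<in> borel_measurable M"
        using integrable_average[OF vi, of "as k"] by (intro borel_measurable_times borel_measurable_power) auto
      show "AE x in M. norm (average (as k) v x * average (as k) v x ^ (N - 1)) \<le> 1"
      proof (rule AE_I2)
        fix x
        show "norm (average (as k) v x * average (as k) v x ^ (N - 1)) \<le> 1"
          using bd_v[of k x] unfolding real_norm_def abs_mult power_abs
          by (intro mult_le_one power_le_one) auto
      qed
    qed
    have lim2: "(\<lambda>k. LINT x|M. average (as k) u x * average (as k) v x ^ (N - 1)) \<longlonglongrightarrow> m * (mean u * mean v ^ (N - 1))"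
      using tendsto_integral_mult_power(1)[of "\<lambda>k. average (as k) u" "\<lambda>k. average (as k) v" 1 "mean v" "mean u" "N - 1"]
        mean_v bd_v as vi ui by (simp add: m_def integrable_average)
    have "m - (LINT x|M. average (as k) v x * average (as k) v x ^ (N - 1)) \<le> Q k" for k
      using le_Q(1)[of k] int1[of k] by (simp add: m_def)
    then have "m - m * (mean v * mean v ^ (N - 1)) \<le> Q'"
      by (intro LIMSEQ_le[OF tendsto_diff[OF tendsto_const lim1] limQ]) auto
    then have "m * (1 / 2) \<le> m * (mean v * mean v ^ (N - 1))" using Q' by linarith
    then have "1 / 2 \<le> mean v * mean v ^ (N - 1)" using m by (simp only: mult_le_cancel_left_pos)
    also have "\<dots> \<le> mean v ^ (N - 1)" using mean_v by (intro mult_left_le_one_le) auto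
    finally have half: "1 / 2 \<le> mean v ^ (N - 1)" .
    have "real N * (m * (mean u * mean v ^ (N - 1))) \<le> Q'"
      using le_Q(2) by (intro LIMSEQ_le[OF tendsto_mult[OF tendsto_const lim2] limQ]) auto
    then have 1: "real N * (LINT x|M. u x) * mean v ^ (N - 1) \<le> m / 2"
      using Q' m by (simp add: mean_def mult.assoc flip: m_def)
    have "0 \<le> (LINT x|M. u x)" using R by (intro Bochner_Integration.integral_nonneg) (auto simp: u_def)
    then have "real N * (LINT x|M. u x) * (1 / 2) \<le> real N * (LINT x|M. u x) * mean v ^ (N - 1)"
      using half by (intro mult_left_mono) auto
    with 1 show ?thesis by (simp add: u_def)
  qed
  then show ?thesis using that[OF R(1)] unfolding m_def by blast
qed

text \<open>
  The modular \<open>A\<close> of \<open>f\<close> determines the number of translates: \<open>N\<close> is about \<open>1 / A\<close>. If \<open>A > 1\<close>, the additive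
  constant in \<open>L_log_L_bound\<close> is itself at most \<open>A\<close>; if \<open>A = 0\<close>, all \<open>N\<close> are admissible.
\<close>
lemma tail_bound:
  obtains R B where "1 \<le> R" "0 < B" "\<And>f L. f \<in> borel_measurable M \<Longrightarrow> (\<And>x. cmod (f x) \<le> L) \<Longrightarrow>
    (LINT x|M. (if cmod (T f x) \<le> R then 0 else cmod (T f x))) \<le> B * (LINT x|M. LlogL r (cmod (f x)))"
proof -
  obtain B where B: "0 < B" "\<And>F L. F \<in> borel_measurable M \<Longrightarrow> (\<And>x. cmod (F x) \<le> L) \<Longrightarrow>
    (LINT x|M. cmod (T F x)) \<le> B * (1 + (LINT x|M. LlogL r (cmod (F x))))"
    using L_log_L_bound by blast
  obtain R where R: "1 \<le> R" "\<And>f L N. f \<in> borel_measurable M \<Longrightarrow> (\<And>x. cmod (f x) \<le> L) \<Longrightarrow> 1 \<le> (N::nat) \<Longrightarrow>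
    real N * (LINT x|M. LlogL r (cmod (f x))) \<le> 1 \<Longrightarrow>
    real N * (LINT x|M. (if cmod (T f x) / R \<le> 1 then 0 else cmod (T f x) / R)) \<le> measure M UNIV"
    using tail_bound_scaled by blast
  define m where "m = measure M UNIV"
  have m: "0 < m" using measure_UNIV_pos by (simp add: m_def)
  have "(LINT x|M. (if cmod (T f x) \<le> R then 0 else cmod (T f x)))
      \<le> (2 * B + 2 * m * R) * (LINT x|M. LlogL r (cmod (f x)))"
    if f [measurable]: "f \<in> borel_measurable M" and fL: "\<And>x. cmod (f x) \<le> L" for f L
  proof -
    define A where "A = (LINT x|M. LlogL r (cmod (f x)))"
    define t where "t = (LINT x|M. (if cmod (T f x) \<le> R then 0 else cmod (T f x)))"
    have A: "0 \<le> A" unfolding A_def by (intro Bochner_Integration.integral_nonneg LlogL_nonneg) auto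
    have t: "0 \<le> t" unfolding t_def by (intro Bochner_Integration.integral_nonneg) auto
    have f0: "f \<in> Lp M p0" using bounded_in_Lp[OF f fL] p0 by simp
    have Tm [measurable]: "T f \<in> borel_measurable M" by (rule T_measurable[OF f0])
    have tR: "(LINT x|M. (if cmod (T f x) / R \<le> 1 then 0 else cmod (T f x) / R)) = t / R"
    proof -
      have "(if cmod (T f x) / R \<le> 1 then 0 else cmod (T f x) / R)
          = (if cmod (T f x) \<le> R then 0 else cmod (T f x)) / R" for x
        using R(1) by (auto simp: field_simps)
      then show ?thesis by (simp add: t_def)
    qed
    have N_bound: "real N * t \<le> m * R" if "1 \<le> N" "real N * A \<le> 1" for N :: nat
    proof -
      have "real N * (t / R) \<le> m"
        using R(2)[OF f fL that(1)] that(2) by (simp only: tR A_def m_def)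
      then show ?thesis using R(1) by (simp add: field_simps)
    qed
    consider "A = 0" | "0 < A" "A \<le> 1" | "1 < A" using A by linarith
    then show ?thesis
    proof cases
      case 1
      have "t = 0"
      proof (rule ccontr)
        assume "t \<noteq> 0"
        then have "0 < t" using t by simp
        then obtain N :: nat where N: "m * R < real N * t" using reals_Archimedean3 by blast
        have "0 \<le> m * R" using m R(1) by simp
        then have "1 \<le> N" using N by (cases N) auto
        then show False using N_bound[of N] N 1 by simp
      qed
      then show ?thesis using 1 by (simp add: t_def A_def)
    next
      case 2
      define N where "N = nat \<lfloor>1 / A\<rfloor>"
      have A1: "1 \<le> 1 / A" using 2 by simp
      then have fl: "1 \<le> \<lfloor>1 / A\<rfloor>" by (simp add: le_floor_iff)
      have N1: "1 \<le> N" using fl unfolding N_def by linarith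
      have rN: "real N = of_int \<lfloor>1 / A\<rfloor>" using fl unfolding N_def by (intro of_nat_nat) linarith
      have "real N \<le> 1 / A" unfolding rN by simp
      then have NA: "real N * A \<le> 1" using 2 by (simp add: field_simps)
      have "1 / A < real N + 1" unfolding rN by linarith
      then have "1 / A \<le> 2 * real N" using N1 by linarith
      then have "1 \<le> 2 * real N * A" using 2 by (simp add: field_simps)
      then have "1 * t \<le> 2 * real N * A * t" using t by (intro mult_right_mono)
      also have "\<dots> = 2 * A * (real N * t)" by simp
      also have "\<dots> \<le> 2 * A * (m * R)" using N_bound[OF N1 NA] A by (intro mult_left_mono) auto
      also have "\<dots> \<le> (2 * B + 2 * m * R) * A" using A B(1) by (simp add: algebra_simps)
      finally show ?thesis by (simp add: t_def A_def)
    next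
      case 3
      have "t \<le> (LINT x|M. cmod (T f x))"
        unfolding t_def using T_integrable[OF f0]
        by (intro integral_mono Bochner_Integration.integrable_bound[of M "\<lambda>x. cmod (T f x)" "\<lambda>x. if cmod (T f x) \<le> R then 0 else cmod (T f x)"]) auto
      also have "\<dots> \<le> B * (1 + A)" using B(2)[OF f fL] by (simp add: A_def)
      also have "\<dots> \<le> B * (2 * A)" using 3 B(1) by (intro mult_left_mono) auto
      also have "\<dots> \<le> (2 * B + 2 * m * R) * A" using A m R(1) by (simp add: algebra_simps)
      finally show ?thesis by (simp add: t_def A_def)
    qed
  qed
  moreover have "0 < 2 * B + 2 * m * R" using B(1) m R(1) by (intro add_pos_nonneg) auto
  ultimately show ?thesis using that[OF R(1)] by blast
qed

end

section \<open>Interpolation by integrating over levels\<close>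

text \<open>
  For \<open>0 < a \<le> b\<close> and \<open>s \<ge> 0\<close> this is the minimum of \<open>s powr a\<close> and \<open>s powr b\<close>; the case distinction
  matches the splitting of a function into its parts above and below 1.
\<close>
definition min_powr :: "real \<Rightarrow> real \<Rightarrow> real \<Rightarrow> real" where
  "min_powr a b s = (if s \<le> 1 then s powr b else s powr a)"

lemma min_powr_measurable [measurable]: "min_powr a b \<in> borel_measurable borel"
  unfolding min_powr_def[abs_def] by measurable

lemma nn_integral_powr_from_0:
  fixes a c :: real
  assumes "-1 < a" "0 \<le> c"
  shows "(\<integral>\<^sup>+t. ennreal (t powr a) * indicator {0..c} t \<partial>lborel) = ennreal (c powr (a + 1) / (a + 1))"
proof -
  have "((\<lambda>t. t powr a * indicator {0..c} t) has_integral (c powr (a + 1) / (a + 1))) UNIV"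
    using has_integral_powr_from_0[OF assms]
    by (subst (asm) has_integral_restrict_UNIV[symmetric])
       (simp add: indicator_def of_bool_def if_distrib cong: if_cong)
  then have "(\<integral>\<^sup>+t. ennreal (t powr a * indicator {0..c} t) \<partial>lborel) = ennreal (c powr (a + 1) / (a + 1))"
    by (intro nn_integral_has_integral_lborel) auto
  moreover have "ennreal (t powr a * indicator {0..c} t) = ennreal (t powr a) * indicator {0..c} t" for t
    by (auto simp: indicator_def)
  ultimately show ?thesis by simp
qed

lemma nn_integral_powr_to_inf:
  fixes a c :: real
  assumes "a < -1" "0 < c"
  shows "(\<integral>\<^sup>+t. ennreal (t powr a) * indicator {c..} t \<partial>lborel) = ennreal (- (c powr (a + 1)) / (a + 1))"
proof -
  have "((\<lambda>t. t powr a * indicator {c..} t) has_integral (- (c powr (a + 1)) / (a + 1))) UNIV"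
    using has_integral_powr_to_inf[OF assms]
    by (subst (asm) has_integral_restrict_UNIV[symmetric])
       (simp add: indicator_def of_bool_def if_distrib cong: if_cong)
  then have "(\<integral>\<^sup>+t. ennreal (t powr a * indicator {c..} t) \<partial>lborel) = ennreal (- (c powr (a + 1)) / (a + 1))"
    by (intro nn_integral_has_integral_lborel) auto
  moreover have "ennreal (t powr a * indicator {c..} t) = ennreal (t powr a) * indicator {c..} t" for t
    by (auto simp: indicator_def)
  ultimately show ?thesis by simp
qed

text \<open>
  The constant by which \<open>\<psi>\<close> reproduces the power \<open>p\<close>: integrating \<open>\<psi> (s / l)\<close> against
  \<open>l powr (p - 1)\<close> gives \<open>mellin p \<psi>\<close> times \<open>s powr p\<close>. Substituting \<open>t = 1 / u\<close> identifies it with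
  the Mellin transform of \<open>\<psi>\<close> at \<open>- p\<close>.
\<close>
definition mellin :: "real \<Rightarrow> (real \<Rightarrow> real) \<Rightarrow> ennreal" where
  "mellin p \<psi> = (\<integral>\<^sup>+t. ennreal (\<psi> (1 / t) * t powr (p - 1)) * indicator {0<..} t \<partial>lborel)"

lemma mellin_scale:
  fixes \<psi> :: "real \<Rightarrow> real"
  assumes [measurable]: "\<psi> \<in> borel_measurable borel" and \<psi>: "\<And>s. 0 \<le> \<psi> s" "\<psi> 0 = 0" and s: "0 \<le> s"
  shows "(\<integral>\<^sup>+l. ennreal (\<psi> (s / l) * l powr (p - 1)) * indicator {0<..} l \<partial>lborel)
    = ennreal (s powr p) * mellin p \<psi>"
proof (cases "s = 0")
  case True
  then show ?thesis using \<psi> by simp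
next
  case False
  with s have s: "s > 0" by simp
  have "(\<integral>\<^sup>+l. ennreal (\<psi> (s / l) * l powr (p - 1)) * indicator {0<..} l \<partial>lborel)
      = ennreal s * (\<integral>\<^sup>+t. ennreal (\<psi> (s / (s * t)) * (s * t) powr (p - 1)) * indicator {0<..} (s * t) \<partial>lborel)"
    using nn_integral_real_affine[of "\<lambda>l. ennreal (\<psi> (s / l) * l powr (p - 1)) * indicator {0<..} l" s 0] s
    by simp
  also have "(\<integral>\<^sup>+t. ennreal (\<psi> (s / (s * t)) * (s * t) powr (p - 1)) * indicator {0<..} (s * t) \<partial>lborel)
      = (\<integral>\<^sup>+t. ennreal (s powr (p - 1)) * (ennreal (\<psi> (1 / t) * t powr (p - 1)) * indicator {0<..} t) \<partial>lborel)"
  proof (intro nn_integral_cong)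
    fix t :: real
    show "ennreal (\<psi> (s / (s * t)) * (s * t) powr (p - 1)) * indicator {0<..} (s * t)
        = ennreal (s powr (p - 1)) * (ennreal (\<psi> (1 / t) * t powr (p - 1)) * indicator {0<..} t)"
    proof (cases "t > 0")
      case True
      then have eq: "\<psi> (s / (s * t)) * (s * t) powr (p - 1) = s powr (p - 1) * (\<psi> (1 / t) * t powr (p - 1))"
        using s by (simp add: powr_mult)
      show ?thesis unfolding eq using True s \<psi> by (simp add: ennreal_mult)
    next
      case False
      then show ?thesis using s by (simp add: indicator_def zero_less_mult_iff)
    qed
  qed
  also have "\<dots> = ennreal (s powr (p - 1)) * mellin p \<psi>"
    unfolding mellin_def by (rule nn_integral_cmult) measurable
  also have "ennreal s * (ennreal (s powr (p - 1)) * mellin p \<psi>) = ennreal (s powr p) * mellin p \<psi>"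
    using s by (simp add: powr_mult_base flip: mult.assoc ennreal_mult)
  finally show ?thesis .
qed

lemma nn_integral_mellin:
  fixes \<psi> :: "real \<Rightarrow> real" and h :: "'a \<Rightarrow> real"
  assumes "sigma_finite_measure M"
    and [measurable]: "\<psi> \<in> borel_measurable borel" "h \<in> borel_measurable M"
    and \<psi>: "\<And>s. 0 \<le> \<psi> s" "\<psi> 0 = 0" and h: "\<And>x. 0 \<le> h x"
  shows "(\<integral>\<^sup>+l. (\<integral>\<^sup>+x. ennreal (\<psi> (h x / l)) \<partial>M) * (ennreal (l powr (p - 1)) * indicator {0<..} l) \<partial>lborel)
    = (\<integral>\<^sup>+x. ennreal (h x powr p) \<partial>M) * mellin p \<psi>"
proof -
  interpret pair_sigma_finite M lborel
    using assms(1) sigma_finite_lborel by (simp add: pair_sigma_finite_def)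
  have "(\<integral>\<^sup>+l. (\<integral>\<^sup>+x. ennreal (\<psi> (h x / l)) \<partial>M) * (ennreal (l powr (p - 1)) * indicator {0<..} l) \<partial>lborel)
      = (\<integral>\<^sup>+l. (\<integral>\<^sup>+x. ennreal (\<psi> (h x / l) * l powr (p - 1)) * indicator {0<..} l \<partial>M) \<partial>lborel)"
    by (intro nn_integral_cong) (simp add: nn_integral_multc ennreal_mult \<psi> mult.assoc flip: nn_integral_multc)
  also have "\<dots> = (\<integral>\<^sup>+x. (\<integral>\<^sup>+l. ennreal (\<psi> (h x / l) * l powr (p - 1)) * indicator {0<..} l \<partial>lborel) \<partial>M)"
    by (rule Fubini') measurable
  also have "\<dots> = (\<integral>\<^sup>+x. ennreal (h x powr p) * mellin p \<psi> \<partial>M)"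
    by (intro nn_integral_cong mellin_scale \<psi> h) measurable
  also have "\<dots> = (\<integral>\<^sup>+x. ennreal (h x powr p) \<partial>M) * mellin p \<psi>"
    by (rule nn_integral_multc) measurable
  finally show ?thesis .
qed

lemma mellin_min_powr:
  assumes "a < p" "p < b"
  shows "mellin p (min_powr a b) \<le> ennreal (1 / (p - a) + 1 / (b - p))"
    and "ennreal (1 / (b - p)) \<le> mellin p (min_powr a b)"
proof -
  have large: "min_powr a b (1 / t) * t powr (p - 1) = t powr (p - 1 - b)" if "1 \<le> t" for t
    using that by (simp add: min_powr_def powr_divide powr_diff)
  have small: "min_powr a b (1 / t) * t powr (p - 1) = t powr (p - 1 - a)" if "0 < t" "t < 1" for t
    using that by (simp add: min_powr_def powr_divide powr_diff)
  have L: "(\<integral>\<^sup>+t. ennreal (t powr (p - 1 - b)) * indicator {1..} t \<partial>lborel) = ennreal (1 / (b - p))"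
    using nn_integral_powr_to_inf[of "p - 1 - b" 1] assms
    by (simp add: minus_divide_right)
  have S: "(\<integral>\<^sup>+t. ennreal (t powr (p - 1 - a)) * indicator {0..1} t \<partial>lborel) = ennreal (1 / (p - a))"
    using nn_integral_powr_from_0[of "p - 1 - a" 1] assms by simp
  have "mellin p (min_powr a b) \<le> (\<integral>\<^sup>+t. ennreal (t powr (p - 1 - a)) * indicator {0..1} t
      + ennreal (t powr (p - 1 - b)) * indicator {1..} t \<partial>lborel)"
    unfolding mellin_def
  proof (intro nn_integral_mono)
    fix t :: real
    show "ennreal (min_powr a b (1 / t) * t powr (p - 1)) * indicator {0<..} t
        \<le> ennreal (t powr (p - 1 - a)) * indicator {0..1} t + ennreal (t powr (p - 1 - b)) * indicator {1..} t"
      using large[of t] small[of t] by (cases "t \<le> 0"; cases "t < 1") (auto simp: indicator_def)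
  qed
  also have "\<dots> = ennreal (1 / (p - a)) + ennreal (1 / (b - p))"
    unfolding L[symmetric] S[symmetric] by (intro nn_integral_add) measurable
  also have "\<dots> = ennreal (1 / (p - a) + 1 / (b - p))" using assms by simp
  finally show "mellin p (min_powr a b) \<le> ennreal (1 / (p - a) + 1 / (b - p))" .
  show "ennreal (1 / (b - p)) \<le> mellin p (min_powr a b)"
    unfolding L[symmetric] mellin_def
  proof (intro nn_integral_mono)
    fix t :: real
    show "ennreal (t powr (p - 1 - b)) * indicator {1..} t
        \<le> ennreal (min_powr a b (1 / t) * t powr (p - 1)) * indicator {0<..} t"
      using large[of t] by (auto simp: indicator_def)
  qed
qed

lemma mellin_tail:
  assumes "1 < p" "0 < R"
  shows "mellin p (\<lambda>s. if s < R then 0 else s) = ennreal ((1 / R) powr (p - 1) / (p - 1))"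
proof -
  have "mellin p (\<lambda>s. if s < R then 0 else s)
      = (\<integral>\<^sup>+t. ennreal (t powr (p - 2)) * indicator {0..1 / R} t \<partial>lborel)"
    unfolding mellin_def
  proof (intro nn_integral_cong)
    fix t :: real
    consider "t \<le> 0" | "0 < t" "t \<le> 1 / R" | "0 < t" "1 / R < t" by linarith
    then show "ennreal ((if 1 / t < R then 0 else 1 / t) * t powr (p - 1)) * indicator {0<..} t
        = ennreal (t powr (p - 2)) * indicator {0..1 / R} t"
    proof cases
      case 1
      then show ?thesis by (cases "t = 0") (auto simp: indicator_def)
    next
      case 2
      then have "\<not> 1 / t < R" using assms by (simp add: field_simps)
      moreover have "1 / t * t powr (p - 1) = t powr (p - 2)"
        using 2 powr_add[of t "-1" "p - 1"] by (simp add: powr_minus_divide)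
      ultimately show ?thesis using 2 by simp
    next
      case 3
      then have "1 / t < R" using assms by (simp add: field_simps)
      then show ?thesis using 3 by simp
    qed
  qed
  also have "\<dots> = ennreal ((1 / R) powr (p - 1) / (p - 1))"
    using nn_integral_powr_from_0[of "p - 2" "1 / R"] assms by simp
  finally show ?thesis .
qed

context Lp_operator begin

lemma T_power_bound_nn:
  assumes "f \<in> Lp M p0"
  shows "(\<integral>\<^sup>+x. ennreal (cmod (T f x) powr p0) \<partial>M) \<le> ennreal (K powr p0) * (\<integral>\<^sup>+x. ennreal (cmod (f x) powr p0) \<partial>M)"
proof -
  have "(\<integral>\<^sup>+x. ennreal (cmod (T f x) powr p0) \<partial>M) = ennreal (LINT x|M. cmod (T f x) powr p0)"
    using Lp_integrable[OF T_in_Lp[OF assms]] by (intro nn_integral_eq_integral) auto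
  moreover have "(\<integral>\<^sup>+x. ennreal (cmod (f x) powr p0) \<partial>M) = ennreal (LINT x|M. cmod (f x) powr p0)"
    using Lp_integrable[OF assms] by (intro nn_integral_eq_integral) auto
  ultimately show ?thesis
    using T_power_bound[OF assms] by (simp add: ennreal_leI flip: ennreal_mult)
qed

text \<open>
  Real interpolation in modular form. At each level \<open>l\<close> the function \<open>f / l\<close> is cut at height 1; the large part
  is estimated through \<open>large\<close>, the small part through the \<open>p0\<close> bound, and together they cost the
  integral of \<open>min_powr a p0 (|f| / l)\<close>. Integrating over \<open>l\<close> turns both sides into \<open>p\<close>-th powers; the dependence
  on \<open>p\<close> is the quotient of the two Mellin constants.
\<close>
lemma interpolate_with_p0:
  fixes \<psi> \<eta> :: "real \<Rightarrow> real"
  assumes a: "a < p" "p < p0" and A: "0 \<le> A" "0 \<le> C"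
    and \<psi>m [measurable]: "\<psi> \<in> borel_measurable borel" and \<eta>m [measurable]: "\<eta> \<in> borel_measurable borel"
    and \<psi>: "\<And>s. 0 \<le> \<psi> s" "\<psi> 0 = 0" and \<eta>: "\<And>s. 0 \<le> \<eta> s"
    and split: "\<And>s u v. 0 \<le> s \<Longrightarrow> 0 \<le> u \<Longrightarrow> 0 \<le> v \<Longrightarrow> s \<le> u + v \<Longrightarrow> \<psi> s \<le> A * (\<eta> u + v powr p0)"
    and large: "\<And>f L. f \<in> borel_measurable M \<Longrightarrow> (\<And>x. cmod (f x) \<le> L) \<Longrightarrow> (\<And>x. f x = 0 \<or> 1 < cmod (f x)) \<Longrightarrow>
      (\<integral>\<^sup>+x. ennreal (\<eta> (cmod (T f x))) \<partial>M) \<le> ennreal C * (\<integral>\<^sup>+x. ennreal (cmod (f x) powr a) \<partial>M)"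
    and f [measurable]: "f \<in> borel_measurable M" and fL: "\<And>x. cmod (f x) \<le> L"
  shows "(\<integral>\<^sup>+x. ennreal (cmod (T f x) powr p) \<partial>M) * mellin p \<psi>
    \<le> ennreal (A * (C + K powr p0)) * ((\<integral>\<^sup>+x. ennreal (cmod (f x) powr p) \<partial>M) * mellin p (min_powr a p0))"
proof -
  have level: "(\<integral>\<^sup>+x. ennreal (\<psi> (cmod (T h x))) \<partial>M)
      \<le> ennreal (A * (C + K powr p0)) * (\<integral>\<^sup>+x. ennreal (min_powr a p0 (cmod (h x))) \<partial>M)"
    if h [measurable]: "h \<in> borel_measurable M" and hL: "\<And>x. cmod (h x) \<le> L" for h L
  proof -
    define h1 where "h1 x = (if cmod (h x) \<le> 1 then 0 else h x)" for x
    define h2 where "h2 x = (if cmod (h x) \<le> 1 then h x else 0)" for x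
    have hm [measurable]: "h1 \<in> borel_measurable M" "h2 \<in> borel_measurable M"
      unfolding h1_def h2_def by measurable
    have L: "0 \<le> L" using hL norm_ge_zero order_trans by blast
    have hL1: "cmod (h1 x) \<le> L" and hL2: "cmod (h2 x) \<le> L" for x
      using hL[of x] L by (auto simp: h1_def h2_def)
    have h0: "h \<in> Lp M p0" "h1 \<in> Lp M p0" "h2 \<in> Lp M p0"
      using p0 by (auto intro!: bounded_in_Lp[where B = L] hL hL1 hL2)
    have Tm [measurable]: "T h1 \<in> borel_measurable M" "T h2 \<in> borel_measurable M"
      by (intro T_measurable h0)+
    have "(\<lambda>x. h1 x + h2 x) = h" by (auto simp: h1_def h2_def)
    then have "AE x in M. T h x = T h1 x + T h2 x" using T_add[OF h0(2,3)] by simp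
    then have "AE x in M. ennreal (\<psi> (cmod (T h x)))
        \<le> ennreal A * (ennreal (\<eta> (cmod (T h1 x))) + ennreal (cmod (T h2 x) powr p0))"
    proof eventually_elim
      case (elim x)
      have "\<psi> (cmod (T h x)) \<le> A * (\<eta> (cmod (T h1 x)) + cmod (T h2 x) powr p0)"
        unfolding elim by (intro split norm_triangle_ineq) auto
      then show ?case using A(1) \<eta>
        by (simp add: ennreal_leI flip: ennreal_mult ennreal_plus)
    qed
    then have "(\<integral>\<^sup>+x. ennreal (\<psi> (cmod (T h x))) \<partial>M)
        \<le> (\<integral>\<^sup>+x. ennreal A * (ennreal (\<eta> (cmod (T h1 x))) + ennreal (cmod (T h2 x) powr p0)) \<partial>M)"
      by (rule nn_integral_mono_AE)
    also have "\<dots> = ennreal A * ((\<integral>\<^sup>+x. ennreal (\<eta> (cmod (T h1 x))) \<partial>M) + (\<integral>\<^sup>+x. ennreal (cmod (T h2 x) powr p0) \<partial>M))"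
      by (subst nn_integral_cmult, measurable, subst nn_integral_add, measurable)
    also have "\<dots> \<le> ennreal A * (ennreal C * (\<integral>\<^sup>+x. ennreal (min_powr a p0 (cmod (h x))) \<partial>M)
        + ennreal (K powr p0) * (\<integral>\<^sup>+x. ennreal (min_powr a p0 (cmod (h x))) \<partial>M))"
    proof (intro mult_left_mono add_mono)
      have "(\<integral>\<^sup>+x. ennreal (\<eta> (cmod (T h1 x))) \<partial>M) \<le> ennreal C * (\<integral>\<^sup>+x. ennreal (cmod (h1 x) powr a) \<partial>M)"
        by (rule large[OF hm(1) hL1]) (auto simp: h1_def)
      also have "\<dots> \<le> ennreal C * (\<integral>\<^sup>+x. ennreal (min_powr a p0 (cmod (h x))) \<partial>M)"
        by (intro mult_left_mono nn_integral_mono) (auto simp: h1_def min_powr_def)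
      finally show "(\<integral>\<^sup>+x. ennreal (\<eta> (cmod (T h1 x))) \<partial>M) \<le> ennreal C * (\<integral>\<^sup>+x. ennreal (min_powr a p0 (cmod (h x))) \<partial>M)" .
      have "(\<integral>\<^sup>+x. ennreal (cmod (T h2 x) powr p0) \<partial>M) \<le> ennreal (K powr p0) * (\<integral>\<^sup>+x. ennreal (cmod (h2 x) powr p0) \<partial>M)"
        by (rule T_power_bound_nn[OF h0(3)])
      also have "\<dots> \<le> ennreal (K powr p0) * (\<integral>\<^sup>+x. ennreal (min_powr a p0 (cmod (h x))) \<partial>M)"
        by (intro mult_left_mono nn_integral_mono) (auto simp: h2_def min_powr_def)
      finally show "(\<integral>\<^sup>+x. ennreal (cmod (T h2 x) powr p0) \<partial>M) \<le> ennreal (K powr p0) * (\<integral>\<^sup>+x. ennreal (min_powr a p0 (cmod (h x))) \<partial>M)" .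
    qed auto
    also have "\<dots> = ennreal (A * (C + K powr p0)) * (\<integral>\<^sup>+x. ennreal (min_powr a p0 (cmod (h x))) \<partial>M)"
      using A by (simp add: ennreal_mult distrib_right mult.assoc)
    finally show ?thesis .
  qed
  have f0: "f \<in> Lp M p0" using bounded_in_Lp[OF f fL] p0 by simp
  have Tm [measurable]: "T f \<in> borel_measurable M" by (rule T_measurable[OF f0])
  have scaled: "(\<integral>\<^sup>+x. ennreal (\<psi> (cmod (T f x) / l)) \<partial>M)
      \<le> ennreal (A * (C + K powr p0)) * (\<integral>\<^sup>+x. ennreal (min_powr a p0 (cmod (f x) / l)) \<partial>M)" if l: "0 < l" for l
  proof -
    have "AE x in M. T (\<lambda>x. of_real (1 / l) * f x) x = of_real (1 / l) * T f x"
      by (rule T_cmult[OF f0])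
    then have "AE x in M. ennreal (\<psi> (cmod (T f x) / l)) = ennreal (\<psi> (cmod (T (\<lambda>x. of_real (1 / l) * f x) x)))"
    proof eventually_elim
      case (elim x)
      show ?case unfolding elim using l by (simp add: norm_mult norm_divide)
    qed
    then have "(\<integral>\<^sup>+x. ennreal (\<psi> (cmod (T f x) / l)) \<partial>M) = (\<integral>\<^sup>+x. ennreal (\<psi> (cmod (T (\<lambda>x. of_real (1 / l) * f x) x))) \<partial>M)"
      by (rule nn_integral_cong_AE)
    also have "\<dots> \<le> ennreal (A * (C + K powr p0)) * (\<integral>\<^sup>+x. ennreal (min_powr a p0 (cmod (of_real (1 / l) * f x))) \<partial>M)"
    proof (rule level)
      show "cmod (of_real (1 / l) * f x) \<le> L / l" for x
        using fL[of x] l by (simp add: norm_mult norm_divide divide_right_mono)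
    qed measurable
    also have "\<dots> = ennreal (A * (C + K powr p0)) * (\<integral>\<^sup>+x. ennreal (min_powr a p0 (cmod (f x) / l)) \<partial>M)"
      using l by (simp add: norm_mult norm_divide)
    finally show ?thesis .
  qed
  have sf: "sigma_finite_measure M" by unfold_locales
  let ?w = "\<lambda>l. ennreal (l powr (p - 1)) * indicator {0<..} l"
  have "(\<integral>\<^sup>+x. ennreal (cmod (T f x) powr p) \<partial>M) * mellin p \<psi>
      = (\<integral>\<^sup>+l. (\<integral>\<^sup>+x. ennreal (\<psi> (cmod (T f x) / l)) \<partial>M) * ?w l \<partial>lborel)"
    by (intro nn_integral_mellin[symmetric] sf \<psi>) auto
  also have "\<dots> \<le> (\<integral>\<^sup>+l. ennreal (A * (C + K powr p0)) * ((\<integral>\<^sup>+x. ennreal (min_powr a p0 (cmod (f x) / l)) \<partial>M) * ?w l) \<partial>lborel)"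
  proof (intro nn_integral_mono)
    fix l :: real
    show "(\<integral>\<^sup>+x. ennreal (\<psi> (cmod (T f x) / l)) \<partial>M) * ?w l
        \<le> ennreal (A * (C + K powr p0)) * ((\<integral>\<^sup>+x. ennreal (min_powr a p0 (cmod (f x) / l)) \<partial>M) * ?w l)"
    proof (cases "0 < l")
      case True
      show ?thesis unfolding mult.assoc[symmetric] by (intro mult_right_mono scaled True) auto
    qed (simp add: indicator_def)
  qed
  also have "\<dots> = ennreal (A * (C + K powr p0)) * (\<integral>\<^sup>+l. (\<integral>\<^sup>+x. ennreal (min_powr a p0 (cmod (f x) / l)) \<partial>M) * ?w l \<partial>lborel)"
    by (rule nn_integral_cmult) measurable
  also have "(\<integral>\<^sup>+l. (\<integral>\<^sup>+x. ennreal (min_powr a p0 (cmod (f x) / l)) \<partial>M) * ?w l \<partial>lborel)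
      = (\<integral>\<^sup>+x. ennreal (cmod (f x) powr p) \<partial>M) * mellin p (min_powr a p0)"
    by (intro nn_integral_mellin sf) (auto simp: min_powr_def)
  finally show ?thesis .
qed

end

section \<open>From the bound on large values to operator norms\<close>

text \<open>
  The power \<open>e powr (- r)\<close> is exactly the final loss: \<open>z powr r \<le> r powr r * exp z\<close> at
  \<open>z = e * (1 + ln (1 + s)) / 2\<close>. Half of \<open>e = p - 1\<close> is left so that the exponent \<open>1 + e / 2\<close> stays below \<open>p\<close>.
\<close>
lemma LlogL_le_powr:
  fixes e r s :: real
  assumes e: "0 < e" "e \<le> 1" and r: "0 < r" and s: "1 \<le> s"
  shows "LlogL r s \<le> (2 powr r * r powr r * (2 * exp 1)) * e powr (- r) * s powr (1 + e / 2)"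
proof -
  define y where "y = 1 + ln (1 + s)"
  have y: "1 \<le> y" using s by (simp add: y_def)
  have "(e * y / 2) powr r \<le> r powr r * exp (e * y / 2)"
    using ln_powr_bound2[of "exp (e * y / 2)" r] e y r by simp
  moreover have "y powr r = (2 / e) powr r * (e * y / 2) powr r"
    using e by (simp flip: powr_mult)
  ultimately have "y powr r \<le> (2 / e) powr r * (r powr r * exp (e * y / 2))"
    by (simp add: mult_left_mono)
  also have "exp (e * y / 2) \<le> (2 * exp 1) * s powr (e / 2)"
  proof -
    have "exp (e * y / 2) = (exp 1 * (1 + s)) powr (e / 2)"
    proof -
      have "ln (exp 1 * (1 + s)) = y" using s by (subst ln_mult) (auto simp: y_def)
      moreover have "exp 1 * (1 + s) \<noteq> 0" using s by simp
      ultimately show ?thesis by (simp only: powr_def if_False) simp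
    qed
    also have "\<dots> \<le> (2 * exp 1 * s) powr (e / 2)"
      using e s by (intro powr_mono2) auto
    also have "\<dots> = (2 * exp 1) powr (e / 2) * s powr (e / 2)" by (rule powr_mult)
    also have "\<dots> \<le> (2 * exp 1) powr 1 * s powr (e / 2)"
      using e exp_ge_add_one_self[of 1] by (intro mult_right_mono powr_mono) auto
    finally show ?thesis by simp
  qed
  finally have "y powr r \<le> (2 / e) powr r * (r powr r * ((2 * exp 1) * s powr (e / 2)))"
    by (simp add: mult_left_mono)
  also have "\<dots> = (2 powr r * r powr r * (2 * exp 1)) * e powr (- r) * s powr (e / 2)"
    by (simp add: powr_divide powr_minus_divide)
  finally have "s * y powr r \<le> s * ((2 powr r * r powr r * (2 * exp 1)) * e powr (- r) * s powr (e / 2))"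
    using s by (intro mult_left_mono) auto
  also have "\<dots> = (2 powr r * r powr r * (2 * exp 1)) * e powr (- r) * s powr (1 + e / 2)"
    using s by (simp add: powr_add)
  finally show ?thesis by (simp add: LlogL_def y_def)
qed

context Lp_operator begin

lemma nn_integral_moment:
  assumes "f \<in> Lp M p0" "0 < p" "p \<le> p0"
  shows "(\<integral>\<^sup>+x. ennreal (cmod (f x) powr p) \<partial>M) = ennreal (LINT x|M. cmod (f x) powr p)"
  using Lp_integrable[OF Lp_mono[OF assms]] by (intro nn_integral_eq_integral) auto

text \<open>
  With \<open>\<psi> = min_powr a p0\<close> the two Mellin constants coincide and cancel, so the bound does not
  deteriorate as \<open>p\<close> approaches \<open>a\<close> or \<open>p0\<close>, in contrast to the usual Marcinkiewicz constants.
\<close>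
lemma interpolate_upper_range:
  assumes a: "1 < a" "a < p" "p < p0" and C: "0 \<le> C"
    and bound: "\<And>f L. f \<in> borel_measurable M \<Longrightarrow> (\<And>x. cmod (f x) \<le> L) \<Longrightarrow>
      (LINT x|M. cmod (T f x) powr a) \<le> C * (LINT x|M. cmod (f x) powr a)"
    and f: "f \<in> borel_measurable M" and fL: "\<And>x. cmod (f x) \<le> L"
  shows "(LINT x|M. cmod (T f x) powr p) \<le> 2 powr p0 * (C + K powr p0) * (LINT x|M. cmod (f x) powr p)"
proof -
  define J where "J = mellin p (min_powr a p0)"
  have "J < \<infinity>" using mellin_min_powr(1)[OF a(2,3)] by (auto simp: J_def intro: le_less_trans)
  moreover have "0 < J"
  proof -
    have "0 < ennreal (1 / (p0 - p))" using a by simp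
    then show ?thesis unfolding J_def using mellin_min_powr(2)[OF a(2,3)] by (rule less_le_trans)
  qed
  ultimately obtain j where j: "J = ennreal j" "0 < j"
    by (cases J) auto
  have f0: "f \<in> Lp M p0" using bounded_in_Lp[OF f fL] p0 by simp
  have "(\<integral>\<^sup>+x. ennreal (cmod (T f x) powr p) \<partial>M) * mellin p (min_powr a p0)
      \<le> ennreal (2 powr p0 * (C + K powr p0)) * ((\<integral>\<^sup>+x. ennreal (cmod (f x) powr p) \<partial>M) * mellin p (min_powr a p0))"
  proof (rule interpolate_with_p0[OF a(2,3), where \<eta> = "\<lambda>s. s powr a"])
    fix s u v :: real assume *: "0 \<le> s" "0 \<le> u" "0 \<le> v" "s \<le> u + v"
    have le: "min_powr a p0 s \<le> s powr a" "min_powr a p0 s \<le> s powr p0"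
      using * a powr_mono'[of a p0 s] powr_mono[of a p0 s] by (auto simp: min_powr_def)
    show "min_powr a p0 s \<le> 2 powr p0 * (u powr a + v powr p0)"
    proof (cases "v \<le> u")
      case True
      have "s powr a \<le> (2 * u) powr a" using * True a by (intro powr_mono2) auto
      also have "\<dots> = 2 powr a * u powr a" by (rule powr_mult)
      also have "\<dots> \<le> 2 powr p0 * u powr a" using a by (intro mult_right_mono powr_mono) auto
      finally have "s powr a \<le> 2 powr p0 * u powr a" .
      moreover have "0 \<le> 2 powr p0 * v powr p0" by simp
      ultimately show ?thesis using le(1) unfolding distrib_left by linarith
    next
      case False
      have "s powr p0 \<le> (2 * v) powr p0" using * False p0 by (intro powr_mono2) auto
      also have "\<dots> = 2 powr p0 * v powr p0" by (rule powr_mult)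
      finally have "s powr p0 \<le> 2 powr p0 * v powr p0" .
      moreover have "0 \<le> 2 powr p0 * u powr a" by simp
      ultimately show ?thesis using le(2) unfolding distrib_left by linarith
    qed
  next
    fix h L assume h: "h \<in> borel_measurable M" "\<And>x. cmod (h x) \<le> L"
    have h0: "h \<in> Lp M p0" using bounded_in_Lp[OF h] p0 by simp
    show "(\<integral>\<^sup>+x. ennreal (cmod (T h x) powr a) \<partial>M) \<le> ennreal C * (\<integral>\<^sup>+x. ennreal (cmod (h x) powr a) \<partial>M)"
      using nn_integral_moment[OF h0, of a] nn_integral_moment[OF T_in_Lp[OF h0], of a] a C bound[OF h]
      by (simp add: ennreal_leI flip: ennreal_mult)
  qed (use C f fL in \<open>auto simp: min_powr_def\<close>)
  then have "ennreal ((LINT x|M. cmod (T f x) powr p) * j)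
      \<le> ennreal (2 powr p0 * (C + K powr p0) * ((LINT x|M. cmod (f x) powr p) * j))"
    using nn_integral_moment[OF f0, of p] nn_integral_moment[OF T_in_Lp[OF f0], of p] a j C
    by (simp add: J_def[symmetric] flip: ennreal_mult)
  then have "(LINT x|M. cmod (T f x) powr p) * j \<le> 2 powr p0 * (C + K powr p0) * (LINT x|M. cmod (f x) powr p) * j"
    using j C by (simp add: mult.assoc)
  then show ?thesis using j by simp
qed

text \<open>
  Cut \<open>f\<close> at height \<open>n\<close>. The remainder tends to 0 in \<open>L\<^sup>p\<^sup>0\<close>, hence so does its image in \<open>L\<^sup>p\<close>. The factor
  \<open>2 powr p\<close> stems from using \<open>|u + v| ^ p \<le> 2 ^ p (|u| ^ p + |v| ^ p)\<close>. The hypothesis \<open>1 \<le> 2 powr p * \<kappa>\<close> permits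
  dropping the \<open>p\<close>-th root of the constant.
\<close>
lemma Lp_bounded_from_bounded_functions:
  assumes p: "1 \<le> p" "p < p0" and \<kappa>: "0 \<le> \<kappa>" "1 \<le> 2 powr p * \<kappa>"
    and bound: "\<And>f L. f \<in> borel_measurable M \<Longrightarrow> (\<And>x. cmod (f x) \<le> L) \<Longrightarrow>
      (LINT x|M. cmod (T f x) powr p) \<le> \<kappa> * (LINT x|M. cmod (f x) powr p)"
  shows "Lp_bounded M p0 p T (2 powr p * \<kappa>)"
  unfolding Lp_bounded_def
proof
  fix f assume f0: "f \<in> Lp M p0"
  have fm [measurable]: "f \<in> borel_measurable M" by (rule Lp_measurable[OF f0])
  define m where "m = measure M (space M)"
  define g where "g n x = (if cmod (f x) \<le> real n then f x else 0)" for n x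
  define h where "h n x = (if cmod (f x) \<le> real n then 0 else f x)" for n x
  have gm [measurable]: "g n \<in> borel_measurable M" and hm [measurable]: "h n \<in> borel_measurable M" for n
    unfolding g_def h_def by measurable
  have g_le: "cmod (g n x) \<le> real n" for n x by (simp add: g_def)
  have g0: "g n \<in> Lp M p0" for n using bounded_in_Lp[OF gm g_le] p0 by simp
  have h0: "h n \<in> Lp M p0" for n
    unfolding Lp_def
    using p0 by (auto intro!: Bochner_Integration.integrable_bound[OF Lp_integrable[OF f0]] simp: h_def)
  define t where "t n = (LINT x|M. cmod (h n x) powr p0)" for n
  define S where "S = (LINT x|M. cmod (f x) powr p)"
  have fp: "integrable M (\<lambda>x. cmod (f x) powr p)" using Lp_integrable[OF Lp_mono[OF f0]] p by simp
  have main: "(LINT x|M. cmod (T f x) powr p)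
      \<le> 2 powr p * (\<kappa> * S + m powr (1 - p / p0) * (K powr p0 * t n) powr (p / p0))" for n
  proof -
    have Tg: "integrable M (\<lambda>x. cmod (T (g n) x) powr p)" "integrable M (\<lambda>x. cmod (T (h n) x) powr p)"
      using p by (auto intro!: Lp_integrable Lp_mono[OF T_in_Lp] g0 h0)
    have "(\<lambda>x. g n x + h n x) = f" by (auto simp: g_def h_def)
    then have "AE x in M. T f x = T (g n) x + T (h n) x" using T_add[OF g0[of n] h0[of n]] by simp
    then have "AE x in M. cmod (T f x) powr p \<le> 2 powr p * (cmod (T (g n) x) powr p + cmod (T (h n) x) powr p)"
    proof eventually_elim
      case (elim x)
      have "cmod (T f x) powr p \<le> (2 * max (cmod (T (g n) x)) (cmod (T (h n) x))) powr p"
        unfolding elim using norm_triangle_ineq[of "T (g n) x" "T (h n) x"] p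
        by (intro powr_mono2) auto
      also have "\<dots> \<le> 2 powr p * (cmod (T (g n) x) powr p + cmod (T (h n) x) powr p)"
        by (auto simp: powr_mult max_def)
      finally show ?case .
    qed
    then have "(LINT x|M. cmod (T f x) powr p)
        \<le> (LINT x|M. 2 powr p * (cmod (T (g n) x) powr p + cmod (T (h n) x) powr p))"
      using p by (intro integral_mono_AE Lp_integrable Lp_mono[OF T_in_Lp[OF f0]]) (auto intro: Tg)
    also have "\<dots> = 2 powr p * ((LINT x|M. cmod (T (g n) x) powr p) + (LINT x|M. cmod (T (h n) x) powr p))"
      using Tg by simp
    also have "\<dots> \<le> 2 powr p * (\<kappa> * S + m powr (1 - p / p0) * (K powr p0 * t n) powr (p / p0))"
    proof (intro mult_left_mono add_mono)
      have "(LINT x|M. cmod (T (g n) x) powr p) \<le> \<kappa> * (LINT x|M. cmod (g n x) powr p)"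
        by (rule bound[OF gm g_le])
      also have "\<dots> \<le> \<kappa> * S"
        unfolding S_def using \<kappa> p
        by (intro mult_left_mono integral_mono fp Lp_integrable[OF Lp_mono[OF g0]]) (auto simp: g_def)
      finally show "(LINT x|M. cmod (T (g n) x) powr p) \<le> \<kappa> * S" .
      have "(LINT x|M. cmod (T (h n) x) powr p)
          \<le> m powr (1 - p / p0) * (LINT x|M. cmod (T (h n) x) powr p0) powr (p / p0)"
        unfolding m_def using p M_pos T_measurable[OF h0[of n]] Lp_integrable[OF T_in_Lp[OF h0[of n]]]
        by (intro moment_mono(2)) auto
      also have "\<dots> \<le> m powr (1 - p / p0) * (K powr p0 * t n) powr (p / p0)"
        unfolding t_def using p T_power_bound[OF h0] by (intro mult_left_mono powr_mono2) auto
      finally show "(LINT x|M. cmod (T (h n) x) powr p) \<le> m powr (1 - p / p0) * (K powr p0 * t n) powr (p / p0)" .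
    qed auto
    finally show ?thesis .
  qed
  have "t \<longlonglongrightarrow> (LINT x|M. 0)"
    unfolding t_def
  proof (rule integral_dominated_convergence[where w = "\<lambda>x. cmod (f x) powr p0"])
    show "AE x in M. (\<lambda>n. cmod (h n x) powr p0) \<longlonglongrightarrow> 0"
    proof (rule AE_I2)
      fix x
      have "eventually (\<lambda>n. cmod (f x) \<le> real n) sequentially"
        using eventually_ge_at_top[of "nat \<lceil>cmod (f x)\<rceil>"] by eventually_elim linarith
      then have "eventually (\<lambda>n. cmod (h n x) powr p0 = 0) sequentially"
        by eventually_elim (simp add: h_def)
      then show "(\<lambda>n. cmod (h n x) powr p0) \<longlonglongrightarrow> 0" by (rule tendsto_eventually)
    qed
    show "AE x in M. norm (cmod (h n x) powr p0) \<le> cmod (f x) powr p0" for n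
      by (auto simp: h_def)
  qed (use Lp_integrable[OF f0] in auto)
  then have t0: "t \<longlonglongrightarrow> 0" by simp
  have "(\<lambda>n. (K powr p0 * t n) powr (p / p0)) \<longlonglongrightarrow> (K powr p0 * 0) powr (p / p0)"
    using p by (intro tendsto_powr2 tendsto_intros t0) (auto simp: t_def)
  then have rest: "(\<lambda>n. (K powr p0 * t n) powr (p / p0)) \<longlonglongrightarrow> 0" by simp
  have "(\<lambda>n. 2 powr p * (\<kappa> * S + m powr (1 - p / p0) * (K powr p0 * t n) powr (p / p0)))
      \<longlonglongrightarrow> 2 powr p * (\<kappa> * S + m powr (1 - p / p0) * 0)"
    by (rule tendsto_mult[OF tendsto_const tendsto_add[OF tendsto_const tendsto_mult[OF tendsto_const rest]]])
  then have "(LINT x|M. cmod (T f x) powr p) \<le> 2 powr p * (\<kappa> * S + m powr (1 - p / p0) * 0)"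
    by (rule LIMSEQ_le_const) (use main in blast)
  then have "(LINT x|M. cmod (T f x) powr p) \<le> (2 powr p * \<kappa>) * S" by simp
  then have "(LINT x|M. cmod (T f x) powr p) powr (1 / p) \<le> ((2 powr p * \<kappa>) * S) powr (1 / p)"
    using p by (intro powr_mono2) auto
  also have "\<dots> = (2 powr p * \<kappa>) powr (1 / p) * S powr (1 / p)" by (rule powr_mult)
  also have "\<dots> \<le> (2 powr p * \<kappa>) powr 1 * S powr (1 / p)"
    using \<kappa> p by (intro mult_right_mono powr_mono) auto
  finally show "Lp_norm M p (T f) \<le> 2 powr p * \<kappa> * Lp_norm M p f"
    using \<kappa> by (simp add: Lp_norm_def S_def)
qed

text \<open>
  The constant \<open>c\<close> is so small that \<open>p = 1 + 1 / ln (1 / |E|)\<close> lies below \<open>p0\<close>. At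
  this exponent \<open>(p - 1) powr (- r)\<close> is the required power of the logarithm, and \<open>|E| powr (1 / p)\<close> is at
  most \<open>exp 1 * |E|\<close>.
\<close>
lemma L_log_L_on_sets_from_Lp_bounded:
  fixes r C :: real
  assumes r: "0 < r"
    and C: "\<And>p. 1 < p \<Longrightarrow> p < p0 \<Longrightarrow> Lp_bounded M p0 p T (C * (p - 1) powr (- r))"
  shows "\<exists>c C'. 0 < c \<and> c < 1 \<and> 0 < C' \<and> (\<forall>E\<in>sets M. 0 < measure M E \<and> measure M E \<le> c \<longrightarrow>
    (LINT x|M. cmod (T (indicator E) x)) \<le> C' * (measure M E * ln (1 / measure M E) powr r))"
proof -
  define m where "m = measure M (space M)"
  define c where "c = exp (- (1 / (p0 - 1)) - 1)"
  define C' where "C' = max 1 m * (\<bar>C\<bar> + 1) * exp 1"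
  have "0 < 1 / (p0 - 1)" using p0 by simp
  then have c: "0 < c" "c < 1" unfolding c_def by (simp, subst exp_less_one_iff, linarith)
  have C': "0 < C'" by (auto simp: C'_def intro!: mult_pos_pos)
  have "(LINT x|M. cmod (T (indicator E) x)) \<le> C' * (measure M E * ln (1 / measure M E) powr r)"
    if E [measurable]: "E \<in> sets M" and mE: "0 < measure M E" "measure M E \<le> c" for E
  proof -
    define e where "e = measure M E"
    define l where "l = ln (1 / e)"
    have "ln e \<le> ln c" using mE c by (simp add: e_def)
    then have l: "1 / (p0 - 1) + 1 \<le> l" using mE by (simp add: l_def e_def c_def ln_div)
    moreover have "0 < 1 / (p0 - 1)" using p0 by simp
    ultimately have l1: "1 < l" "1 / (p0 - 1) < l" by linarith+
    define p where "p = 1 + 1 / l"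
    have p: "1 < p" using l1 by (simp add: p_def)
    have pp0: "p < p0" using l1 p0 by (simp add: p_def field_simps)
    have ind0: "indicator E \<in> Lp M p0"
      using p0 by (intro bounded_in_Lp[where B = 1]) (auto simp: indicator_def)
    have "cmod (indicator E x) powr p = indicator E x" for x
      by (auto simp: indicator_def)
    then have norm_ind: "Lp_norm M p (indicator E) = e powr (1 / p)"
      by (simp add: Lp_norm_def e_def space_UNIV)
    have pow: "e powr (1 / p) \<le> exp 1 * e"
    proof -
      have "e powr (1 / p) = exp (- l / p)"
        using mE by (simp add: powr_def l_def e_def ln_div)
      also have "- l / p = - l + 1 / p"
        using l1 p by (simp add: p_def field_simps)
      also have "exp (- l + 1 / p) \<le> exp (1 - l)" using p by simp
      also have "\<dots> = exp 1 * e" using mE by (simp add: exp_diff l_def e_def)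
      finally show ?thesis .
    qed
    have "Lp_norm M p (T (indicator E)) \<le> C * (p - 1) powr (- r) * Lp_norm M p (indicator E)"
      using C[OF p pp0] ind0 by (simp add: Lp_bounded_def)
    also have "(p - 1) powr (- r) = l powr r"
      using l1 by (simp add: p_def powr_divide powr_minus_divide)
    finally have "Lp_norm M p (T (indicator E)) \<le> C * l powr r * e powr (1 / p)"
      by (simp add: norm_ind)
    also have "\<dots> \<le> (\<bar>C\<bar> + 1) * l powr r * (exp 1 * e)"
      using mE by (intro mult_mono pow) (auto simp: e_def)
    finally have norm_le: "Lp_norm M p (T (indicator E)) \<le> (\<bar>C\<bar> + 1) * l powr r * (exp 1 * e)" .
    have "(LINT x|M. cmod (T (indicator E) x) powr 1)
        \<le> m powr (1 - 1 / p) * (LINT x|M. cmod (T (indicator E) x) powr p) powr (1 / p)"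
      unfolding m_def using p pp0 M_pos T_measurable[OF ind0] Lp_integrable[OF Lp_mono[OF T_in_Lp[OF ind0], of p]]
      by (intro moment_mono(2)) auto
    also have "\<dots> = m powr (1 - 1 / p) * Lp_norm M p (T (indicator E))" by (simp add: Lp_norm_def)
    also have "\<dots> \<le> max 1 m * ((\<bar>C\<bar> + 1) * l powr r * (exp 1 * e))"
    proof (intro mult_mono norm_le)
      have "m powr (1 - 1 / p) \<le> max 1 m powr (1 - 1 / p)"
        using p M_pos by (intro powr_mono2) (auto simp: m_def)
      also have "\<dots> \<le> max 1 m powr 1" using p by (intro powr_mono) auto
      finally show "m powr (1 - 1 / p) \<le> max 1 m" by simp
    qed (auto simp: Lp_norm_def)
    finally show ?thesis by (simp add: C'_def e_def l_def mult_ac)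
  qed
  then show ?thesis using c C' by blast
qed

end

context invariant_L_log_L_operator begin

text \<open>
  With \<open>e = p - 1\<close>, the Mellin constants are of order \<open>1 / e\<close> for the truncation \<open>s \<ge> 3 * R\<close> and for
  \<open>min_powr (1 + e / 2) p0\<close>, so that only the factor \<open>e powr (- r)\<close> of \<open>LlogL_le_powr\<close> survives. The upper
  limit \<open>p1\<close> keeps \<open>e \<le> 1\<close> and \<open>p\<close> away from \<open>p0\<close>.
\<close>
lemma bounded_near_one:
  obtains G p1 where "1 < p1" "p1 < p0" "0 \<le> G"
    "\<And>p f L. 1 < p \<Longrightarrow> p \<le> p1 \<Longrightarrow> f \<in> borel_measurable M \<Longrightarrow> (\<And>x. cmod (f x) \<le> L) \<Longrightarrow>
      (LINT x|M. cmod (T f x) powr p) \<le> G * (p - 1) powr (- r) * (LINT x|M. cmod (f x) powr p)"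
proof -
  obtain R B where R: "1 \<le> R" and B: "0 < B" "\<And>f L. f \<in> borel_measurable M \<Longrightarrow> (\<And>x. cmod (f x) \<le> L) \<Longrightarrow>
    (LINT x|M. (if cmod (T f x) \<le> R then 0 else cmod (T f x))) \<le> B * (LINT x|M. LlogL r (cmod (f x)))"
    using tail_bound by blast
  define p1 where "p1 = min 2 ((1 + p0) / 2)"
  have p1: "1 < p1" "p1 < p0" "p1 \<le> 2" using p0 by (auto simp: p1_def min_def)
  define E where "E = 2 powr r * r powr r * (2 * exp 1)"
  have E: "0 \<le> E" by (simp add: E_def)
  define G where "G = 2 * (B * E + K powr p0) * (3 * R) * (2 + 1 / (p0 - p1))"
  have G: "0 \<le> G" using B(1) E R p1 by (auto simp: G_def)
  have "(LINT x|M. cmod (T f x) powr p) \<le> G * (p - 1) powr (- r) * (LINT x|M. cmod (f x) powr p)"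
    if p: "1 < p" "p \<le> p1" and f: "f \<in> borel_measurable M" and fL: "\<And>x. cmod (f x) \<le> L" for p f L
  proof -
    define e where "e = p - 1"
    have e: "0 < e" "e \<le> 1" using p p1 by (auto simp: e_def)
    define a where "a = 1 + e / 2"
    have a: "1 < a" "a < p" "p < p0" using e p p1 by (auto simp: a_def e_def field_simps)
    define D where "D = B * E * e powr (- r)"
    have D: "0 \<le> D" using B(1) E by (simp add: D_def)
    have f0: "f \<in> Lp M p0" using bounded_in_Lp[OF f fL] p0 by simp
    define It where "It = (LINT x|M. cmod (T f x) powr p)"
    define If where "If = (LINT x|M. cmod (f x) powr p)"
    have I0: "0 \<le> It" "0 \<le> If" by (simp_all add: It_def If_def)
    have "(\<integral>\<^sup>+x. ennreal (cmod (T f x) powr p) \<partial>M) * mellin p (\<lambda>s. if s < 3 * R then 0 else s)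
        \<le> ennreal (2 * (D + K powr p0)) * ((\<integral>\<^sup>+x. ennreal (cmod (f x) powr p) \<partial>M) * mellin p (min_powr a p0))"
    proof (rule interpolate_with_p0[OF a(2,3), where \<eta> = "\<lambda>s. if s \<le> R then 0 else s"])
      fix s u v :: real assume *: "0 \<le> s" "0 \<le> u" "0 \<le> v" "s \<le> u + v"
      have v: "v \<le> v powr p0" if "1 \<le> v"
        using powr_mono[of 1 p0 v] that p0 by simp
      have nn: "0 \<le> (if u \<le> R then 0 else u) + v powr p0" using * by simp
      \<comment> \<open>If \<open>s \<ge> 3 * R\<close>, the larger of \<open>u\<close> and \<open>v\<close> is at least \<open>s / 2 > R\<close>.\<close>
      show "(if s < 3 * R then 0 else s) \<le> 2 * ((if u \<le> R then 0 else u) + v powr p0)"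
      proof (cases "s < 3 * R")
        case False
        show ?thesis
        proof (cases "v \<le> u")
          case True
          then have "R < u" "s \<le> 2 * u" using * False R by linarith+
          then show ?thesis using False by (simp add: add_increasing2)
        next
          case False': False
          then have "1 \<le> v" "s \<le> 2 * v" using * False R by linarith+
          then have "s \<le> 2 * v powr p0" using v by linarith
          then show ?thesis using False * by simp
        qed
      qed (use nn in simp)
    next
      fix h L assume h [measurable]: "h \<in> borel_measurable M" and hL: "\<And>x. cmod (h x) \<le> L"
        and large: "\<And>x. h x = 0 \<or> 1 < cmod (h x)"
      have h0: "h \<in> Lp M p0" using bounded_in_Lp[OF h hL] p0 by simp
      have Tm [measurable]: "T h \<in> borel_measurable M" by (rule T_measurable[OF h0])
      have hp: "integrable M (\<lambda>x. cmod (h x) powr a)"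
        using Lp_integrable[OF Lp_mono[OF h0]] a by simp
      have "integrable M (\<lambda>x. if cmod (T h x) \<le> R then 0 else cmod (T h x))"
        using T_integrable[OF h0]
        by (intro Bochner_Integration.integrable_bound[of M "\<lambda>x. cmod (T h x)" "\<lambda>x. if cmod (T h x) \<le> R then 0 else cmod (T h x)"]) auto
      then have "(\<integral>\<^sup>+x. ennreal (if cmod (T h x) \<le> R then 0 else cmod (T h x)) \<partial>M)
          = ennreal (LINT x|M. (if cmod (T h x) \<le> R then 0 else cmod (T h x)))"
        by (intro nn_integral_eq_integral) auto
      also have "\<dots> \<le> ennreal (D * (LINT x|M. cmod (h x) powr a))"
      proof (rule ennreal_leI)
        have "(LINT x|M. (if cmod (T h x) \<le> R then 0 else cmod (T h x))) \<le> B * (LINT x|M. LlogL r (cmod (h x)))"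
          by (rule B(2)[OF h hL])
        also have "\<dots> \<le> B * (LINT x|M. (E * e powr (- r)) * cmod (h x) powr a)"
        proof (intro mult_left_mono integral_mono)
          show "integrable M (\<lambda>x. LlogL r (cmod (h x)))"
            using hL by (intro integrable_LlogL_bounded[where L = L]) auto
          show "LlogL r (cmod (h x)) \<le> (E * e powr (- r)) * cmod (h x) powr a" for x
            using LlogL_le_powr[OF e r, of "cmod (h x)"] large[of x] by (auto simp: E_def a_def)
        qed (use B(1) hp in auto)
        also have "\<dots> = D * (LINT x|M. cmod (h x) powr a)" by (simp add: D_def)
        finally show "(LINT x|M. (if cmod (T h x) \<le> R then 0 else cmod (T h x))) \<le> D * (LINT x|M. cmod (h x) powr a)" .
      qed
      also have "\<dots> = ennreal D * (\<integral>\<^sup>+x. ennreal (cmod (h x) powr a) \<partial>M)"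
        using D hp by (subst nn_integral_eq_integral) (auto simp: ennreal_mult)
      finally show "(\<integral>\<^sup>+x. ennreal (if cmod (T h x) \<le> R then 0 else cmod (T h x)) \<partial>M)
          \<le> ennreal D * (\<integral>\<^sup>+x. ennreal (cmod (h x) powr a) \<partial>M)" .
    qed (use D R f fL in auto)
    also have "\<dots> \<le> ennreal (2 * (D + K powr p0)) * (ennreal If * ennreal (1 / (p - a) + 1 / (p0 - p)))"
      using mellin_min_powr(1)[OF a(2,3)] nn_integral_moment[OF f0, of p] a
      by (intro mult_left_mono mult_mono) (auto simp: If_def)
    also have "\<dots> = ennreal (2 * (D + K powr p0) * (If * (1 / (p - a) + 1 / (p0 - p))))"
      using D I0 a by (simp add: ennreal_mult)
    also have "(\<integral>\<^sup>+x. ennreal (cmod (T f x) powr p) \<partial>M) = ennreal It"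
      using nn_integral_moment[OF T_in_Lp[OF f0], of p] a by (simp add: It_def)
    also have "mellin p (\<lambda>s. if s < 3 * R then 0 else s) = ennreal ((1 / (3 * R)) powr (p - 1) / (p - 1))"
      using a R by (intro mellin_tail) auto
    also have "ennreal It * ennreal ((1 / (3 * R)) powr (p - 1) / (p - 1))
        = ennreal (It * ((1 / (3 * R)) powr (p - 1) / (p - 1)))"
      using I0 a by (intro ennreal_mult[symmetric]) auto
    finally have bound: "ennreal (It * ((1 / (3 * R)) powr (p - 1) / (p - 1)))
        \<le> ennreal (2 * (D + K powr p0) * (If * (1 / (p - a) + 1 / (p0 - p))))" .
    have "It * ((1 / (3 * R)) powr e / e) \<le> 2 * (D + K powr p0) * (If * (2 / e + 1 / (p0 - p)))"
    proof -
      have "p - a = e / 2" by (simp add: a_def e_def field_simps)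
      then have "1 / (p - a) = 2 / e" by (simp only:) simp
      moreover have "p - 1 = e" by (simp add: e_def)
      moreover have "It * ((1 / (3 * R)) powr (p - 1) / (p - 1))
          \<le> 2 * (D + K powr p0) * (If * (1 / (p - a) + 1 / (p0 - p)))"
        using bound D I0 a by (subst (asm) ennreal_le_iff) auto
      ultimately show ?thesis by simp
    qed
    then have "(It * ((1 / (3 * R)) powr e / e)) * (e * (3 * R) powr e)
        \<le> (2 * (D + K powr p0) * (If * (2 / e + 1 / (p0 - p)))) * (e * (3 * R) powr e)"
      using e by (intro mult_right_mono) auto
    moreover have "(It * ((1 / (3 * R)) powr e / e)) * (e * (3 * R) powr e) = It"
      using e R by (simp add: powr_divide)
    ultimately have weighted: "It \<le> (2 * (D + K powr p0) * (If * (2 / e + 1 / (p0 - p)))) * (e * (3 * R) powr e)"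
      by linarith
    have "It \<le> 2 * (D + K powr p0) * (3 * R) powr e * (2 + e / (p0 - p)) * If"
    proof -
      have "(2 / e + 1 / (p0 - p)) * e = 2 + e / (p0 - p)" using e by (simp add: distrib_right)
      then have "(x * (If * (2 / e + 1 / (p0 - p)))) * (e * w) = x * w * (2 + e / (p0 - p)) * If" for x w
        by (simp only: mult_ac flip: \<open>(2 / e + 1 / (p0 - p)) * e = 2 + e / (p0 - p)\<close>)
      then show ?thesis using weighted by (simp only:)
    qed
    also have "\<dots> \<le> 2 * ((B * E + K powr p0) * e powr (- r)) * (3 * R) * (2 + 1 / (p0 - p1)) * If"
    proof (intro mult_right_mono mult_mono mult_left_mono)
      have "1 \<le> e powr (- r)" using powr_mono'[of "- r" 0 e] e r by simp
      then have "K powr p0 * 1 \<le> K powr p0 * e powr (- r)" by (intro mult_left_mono) auto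
      then show "D + K powr p0 \<le> (B * E + K powr p0) * e powr (- r)"
        by (simp add: D_def distrib_right)
      have "(3 * R) powr e \<le> (3 * R) powr 1" using e R by (intro powr_mono) auto
      then show "(3 * R) powr e \<le> 3 * R" using R by simp
      have "e / (p0 - p) \<le> 1 / (p0 - p1)" using e p p1 by (intro frac_le) auto
      then show "2 + e / (p0 - p) \<le> 2 + 1 / (p0 - p1)" by simp
    qed (use D B(1) E R e a I0 in auto)
    also have "\<dots> = G * (p - 1) powr (- r) * If" by (simp add: G_def e_def mult_ac)
    finally show ?thesis by (simp add: It_def If_def)
  qed
  then show ?thesis by (rule that[OF p1(1,2) G])
qed

lemma Lp_bounded_uniformly:
  "\<exists>C. \<forall>p. 1 < p \<and> p < p0 \<longrightarrow> Lp_bounded M p0 p T (C * (p - 1) powr (- r))"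
proof (rule bounded_near_one)
  fix C p1 assume p1: "1 < p1" "p1 < p0" and C: "0 \<le> C"
    "\<And>p f L. 1 < p \<Longrightarrow> p \<le> p1 \<Longrightarrow> f \<in> borel_measurable M \<Longrightarrow> (\<And>x. cmod (f x) \<le> L) \<Longrightarrow>
      (LINT x|M. cmod (T f x) powr p) \<le> C * (p - 1) powr (- r) * (LINT x|M. cmod (f x) powr p)"
  define C1 where "C1 = C * (p1 - 1) powr (- r)"
  have C1: "0 \<le> C1" using C(1) by (simp add: C1_def)
  define C2 where "C2 = 2 powr p0 * (C1 + K powr p0)"
  have C2: "0 \<le> C2" using C1 by (simp add: C2_def)
  define q where "q = (p0 - 1) powr r"
  have q: "0 < q" using p0 by (simp add: q_def)
  define D where "D = C + C2 * q + q"
  have D: "0 < D" using C(1) C2 q by (auto simp: D_def intro!: add_nonneg_pos)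
  have "Lp_bounded M p0 p T (2 powr p0 * D * (p - 1) powr (- r))" if p: "1 < p" "p < p0" for p
  proof -
    define e where "e = (p - 1) powr (- r)"
    have e: "0 < e" using p by (simp add: e_def)
    have qe: "1 \<le> q * e"
    proof -
      have "q * e = ((p0 - 1) / (p - 1)) powr r"
        using p by (simp add: q_def e_def powr_divide powr_minus_divide)
      also have "\<dots> \<ge> 1" using p r by (intro ge_one_powr_ge_zero) auto
      finally show ?thesis .
    qed
    define \<kappa> where "\<kappa> = 2 powr (p0 - p) * D * e"
    have k1: "D * e \<le> \<kappa>"
      using p D e by (auto simp: \<kappa>_def mult.assoc intro!: mult_right_mono[of 1 _ "D * e", simplified] ge_one_powr_ge_zero)
    have "Lp_bounded M p0 p T (2 powr p * \<kappa>)"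
    proof (rule Lp_bounded_from_bounded_functions)
      show "0 \<le> \<kappa>" using D e by (simp add: \<kappa>_def)
      have De: "1 \<le> D * e"
      proof -
        have "q * e \<le> D * e" using C(1) C2 q e by (intro mult_right_mono) (auto simp: D_def)
        then show ?thesis using qe by linarith
      qed
      have "1 * 1 \<le> 2 powr p * \<kappa>"
        using p De k1 by (intro mult_mono ge_one_powr_ge_zero) auto
      then show "1 \<le> 2 powr p * \<kappa>" by simp
      fix f L assume f: "f \<in> borel_measurable M" "\<And>x. cmod (f x) \<le> L"
      have nn: "0 \<le> (LINT x|M. cmod (f x) powr p)" by simp
      show "(LINT x|M. cmod (T f x) powr p) \<le> \<kappa> * (LINT x|M. cmod (f x) powr p)"
      proof (cases "p \<le> p1")
        case True
        have "(LINT x|M. cmod (T f x) powr p) \<le> C * e * (LINT x|M. cmod (f x) powr p)"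
          unfolding e_def by (rule C(2)[OF p(1) True f])
        also have "C * e \<le> D * e" using C2 q e by (intro mult_right_mono) (auto simp: D_def)
        finally show ?thesis using k1 nn by (meson mult_right_mono order_trans)
      next
        case False
        have upper: "(LINT x|M. cmod (T f x) powr p) \<le> C2 * (LINT x|M. cmod (f x) powr p)"
          unfolding C2_def using False p p1 C1 C(2)[OF p1(1) order_refl] f
          by (intro interpolate_upper_range[of p1]) (auto simp: C1_def)
        have "C2 * 1 \<le> C2 * (q * e)" using C2 qe by (intro mult_left_mono)
        moreover have "C2 * q * e \<le> D * e" using C(1) q e by (intro mult_right_mono) (auto simp: D_def)
        ultimately have "C2 \<le> \<kappa>" using k1 by (simp add: mult.assoc)
        then have "C2 * (LINT x|M. cmod (f x) powr p) \<le> \<kappa> * (LINT x|M. cmod (f x) powr p)"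
          using nn by (rule mult_right_mono)
        with upper show ?thesis by linarith
      qed
    qed (use p in auto)
    moreover have "2 powr p * \<kappa> = 2 powr p0 * D * (p - 1) powr (- r)"
      by (simp add: \<kappa>_def e_def flip: powr_add mult.assoc)
    ultimately show ?thesis by simp
  qed
  then show "\<exists>C. \<forall>p. 1 < p \<and> p < p0 \<longrightarrow> Lp_bounded M p0 p T (C * (p - 1) powr (- r))"
    by blast
qed

end

theorem corollary1p2:
  fixes A :: "('x::{t2_space, second_countable_topology}, 'e::euclidean_space) chart set"
    and g :: "('x, 'e) metric_coeffs"
    and act :: "'g::{topological_group_add, t2_space} \<Rightarrow> 'x \<Rightarrow> 'x"
    and M :: "'x measure"
    and T :: "('x \<Rightarrow> complex) \<Rightarrow> 'x \<Rightarrow> complex"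
    and r p0 :: real
  assumes "compact_symmetric_space A g"
    and "compact_symmetry_group A g act"
    and "invariant_measure act M"
    and "0 < r" and "1 < p0"
    and "linear_operator_on_Lp M p0 T"
    and "\<exists>K. Lp_bounded M p0 p0 T K"
    and "translation_invariant act M p0 T"
  shows "(\<exists>C. \<forall>p. 1 < p \<and> p < p0 \<longrightarrow> Lp_bounded M p0 p T (C * (p - 1) powr (- r)))
     \<longleftrightarrow>
     (\<exists>c C'. 0 < c \<and> c < 1 \<and> 0 < C' \<and>
        (\<forall>E\<in>sets M. 0 < measure M E \<and> measure M E \<le> c \<longrightarrow>
           (LINT x|M. cmod (T (indicator E) x))
             \<le> C' * (measure M E * ln (1 / measure M E) powr r)))"
proof -
  interpret finite_measure M using assms(3) by (simp add: invariant_measure_def)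
  interpret compact_group_action M act
  proof
    show "compact (UNIV :: 'x set)" using assms(1) by (simp add: compact_symmetric_space_def)
  qed (use assms(2,3) in \<open>auto simp: compact_symmetry_group_def invariant_measure_def\<close>)
  obtain K where K: "Lp_bounded M p0 p0 T K" using assms(7) by blast
  have K1: "Lp_bounded M p0 p0 T (max 1 K)"
    unfolding Lp_bounded_def
  proof
    fix f assume "f \<in> Lp M p0"
    then have "Lp_norm M p0 (T f) \<le> K * Lp_norm M p0 f" using K by (simp add: Lp_bounded_def)
    also have "\<dots> \<le> max 1 K * Lp_norm M p0 f" by (intro mult_right_mono) (auto simp: Lp_norm_def)
    finally show "Lp_norm M p0 (T f) \<le> max 1 K * Lp_norm M p0 f" .
  qed
  interpret Lp_operator M T p0 "max 1 K"
    using assms(5,6) K1 measure_UNIV_pos by unfold_locales auto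
  show ?thesis (is "?i \<longleftrightarrow> ?ii")
  proof
    assume ?i
    then show ?ii using L_log_L_on_sets_from_Lp_bounded[OF assms(4)] by blast
  next
    assume ?ii
    then obtain c C' where c: "0 < c" "c < 1" "0 < C'"
      "\<And>E. E \<in> sets M \<Longrightarrow> 0 < measure M E \<Longrightarrow> measure M E \<le> c \<Longrightarrow>
        (LINT x|M. cmod (T (indicator E) x)) \<le> C' * (measure M E * ln (1 / measure M E) powr r)"
      by blast
    interpret invariant_L_log_L_operator M act T p0 "max 1 K" r c C'
      using assms(4,8) c by unfold_locales auto
    show ?i by (rule Lp_bounded_uniformly)
  qed
qed

end
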